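(* Let $0\le\alpha<1$, $s\geq 0$ and let $\psi,\varphi \in L^2(\mathbb{R})$, $\psi\neq 0$, be such that $\hat\psi,\hat\varphi \in C^2(\mathbb{R})$ and, for some constant $C>0$, $|\hat\psi^{(l)}(\xi)|\leq C (1+|\xi|)^{-r}$ and $|\hat\varphi^{(l)}(\xi)|\leq C (1+|\xi|)^{-r}$ for all $\xi\in\mathbb{R}$ and $l = 0,1,2$, where $$r > \frac{2+2s+7\alpha-4\alpha^2}{2(1-\alpha)^2}.$$ Then, for $\kappa = 0,1,2$, $$\sup_{(x^\ast,\omega^\ast)\in\mathbb{R}^2}\int_{\mathbb{R}}\int_{\mathbb{R}}\left|K_{\psi,\varphi}^\kappa(x,\omega,x^\ast,\omega^\ast)\right|w_s(\omega,\omega^\ast)\,dx\,d\omega < \infty.$$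
   Context: Fourier transform: $\hat f(\xi)=\int_{\mathbb{R}} f(x)e^{-2\pi i \xi x}\,dx$. For $x,\omega\in\mathbb{R}$ and $a>0$ define on $L^2(\mathbb{R})$: $T_xf(t)=f(t-x)$, $M_\omega f(t)=e^{2\pi i\omega t}f(t)$, $D_af(t)=a^{-1/2}f(t/a)$. Let $\beta(\omega)=(1+|\omega|)^{-\alpha}$. $A_\sigma$ is the operator defined weakly by $A_\sigma f=\int_{\mathbb{R}}\int_{\mathbb{R}}\langle f,T_xM_\omega D_{\beta(\omega)}\psi\rangle\,T_xM_\omega D_{\beta(\omega)}\psi\,dx\,d\omega$. It is known that it is the Fourier multiplier $\widehat{A_\sigma f}=m_\psi\hat f$ with symbol $m_\psi(\xi)=\int_{\mathbb{R}}|\hat\psi(\beta(\omega)(\xi-\omega))|^2\beta(\omega)\,d\omega$. Under the stated hypotheses $m_\psi$ is bounded above and bounded below away from zero, so $A_\sigma$ is bounded and boundedly invertible on $L^2(\mathbb{R})$ and $A_\sigma^{-\kappa}$ is the Fourier multiplier with symbol $m_\psi^{-\kappa}$. The kernel is $$K_{\psi,\varphi}^\kappa(x,\omega,x^\ast,\omega^\ast) = \langle T_x M_\omega D_{\beta(\omega)}\psi,\;A^{-\kappa}_\sigma T_{x^\ast}M_{\omega^\ast} D_{\beta(\omega^\ast)}\varphi\rangle_{L^2(\mathbb{R})},$$ and the weight is $$w_s(\omega,\omega^\ast)=\max\left\{\frac{1+|\omega^\ast|}{1+|\omega|},\frac{1+|\omega|}{1+|\omega^\ast|}\right\}^{|s|}.$$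 *)

theory Defs
  imports "HOL-Analysis.Analysis"
begin

text \<open>Elements of \<open>L\<^sup>2(\<real>)\<close> are represented by Borel measurable square integrable functions;
  equality in \<open>L\<^sup>2(\<real>)\<close> is equality almost everywhere.\<close>

definition L2 :: "(real \<Rightarrow> complex) set" where
  "L2 = {f \<in> borel_measurable lborel. integrable lborel (\<lambda>t. (cmod (f t))\<^sup>2)}"

definition L2_inner :: "(real \<Rightarrow> complex) \<Rightarrow> (real \<Rightarrow> complex) \<Rightarrow> complex" where
  "L2_inner f g = (\<integral>t. f t * cnj (g t) \<partial>lborel)"

definition fourier :: "(real \<Rightarrow> complex) \<Rightarrow> real \<Rightarrow> complex" where
  "fourier f \<xi> = (\<integral>x. f x * exp (- (2 * complex_of_real pi * \<i> * complex_of_real (\<xi> * x))) \<partial>lborel)"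

text \<open>The function \<open>g\<close> represents the Fourier--Plancherel transform of \<open>f \<in> L\<^sup>2(\<real>)\<close>: the Fourier
  integrals of the truncations of \<open>f\<close> to \<open>[-n, n]\<close> (which lie in \<open>L\<^sup>1 \<inter> L\<^sup>2\<close>) converge
  to \<open>g\<close> in \<open>L\<^sup>2(\<real>)\<close>. This determines \<open>g\<close> up to null sets.\<close>

definition has_fourier_L2 :: "(real \<Rightarrow> complex) \<Rightarrow> (real \<Rightarrow> complex) \<Rightarrow> bool" where
  "has_fourier_L2 f g \<longleftrightarrow> f \<in> L2 \<and> g \<in> L2 \<and>
     (\<lambda>n::nat. \<integral>\<^sup>+ \<xi>. ennreal
        ((cmod (fourier (\<lambda>x. indicator {- real n..real n} x * f x) \<xi> - g \<xi>))\<^sup>2) \<partial>lborel)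
       \<longlonglongrightarrow> 0"

definition vderiv :: "(real \<Rightarrow> complex) \<Rightarrow> real \<Rightarrow> complex" where
  "vderiv f = (\<lambda>x. vector_derivative f (at x))"

definition C2 :: "(real \<Rightarrow> complex) \<Rightarrow> bool" where
  "C2 f \<longleftrightarrow> f C1_differentiable_on UNIV \<and> vderiv f C1_differentiable_on UNIV"

definition translation :: "real \<Rightarrow> (real \<Rightarrow> complex) \<Rightarrow> real \<Rightarrow> complex" where
  "translation x f = (\<lambda>t. f (t - x))"

definition modulation :: "real \<Rightarrow> (real \<Rightarrow> complex) \<Rightarrow> real \<Rightarrow> complex" where
  "modulation \<omega> f = (\<lambda>t. exp (2 * complex_of_real pi * \<i> * complex_of_real (\<omega> * t)) * f t)"

definition dilation :: "real \<Rightarrow> (real \<Rightarrow> complex) \<Rightarrow> real \<Rightarrow> complex" where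
  "dilation a f = (\<lambda>t. complex_of_real (a powr (- 1 / 2)) * f (t / a))"

definition beta :: "real \<Rightarrow> real \<Rightarrow> real" where
  "beta \<alpha> \<omega> = (1 + \<bar>\<omega>\<bar>) powr (- \<alpha>)"

definition atom :: "real \<Rightarrow> (real \<Rightarrow> complex) \<Rightarrow> real \<Rightarrow> real \<Rightarrow> real \<Rightarrow> complex" where
  "atom \<alpha> \<psi> x \<omega> = translation x (modulation \<omega> (dilation (beta \<alpha> \<omega>) \<psi>))"

text \<open>The weakly defined operator \<open>A\<^sub>\<sigma>\<close>: the vector \<open>A\<^sub>\<sigma> f\<close> is specified by its inner products
  with all \<open>g \<in> L\<^sup>2(\<real>)\<close>, hence up to null sets. The choice operator picks a representative,
  which depends on \<open>f\<close> only through its class in \<open>L\<^sup>2(\<real>)\<close>.\<close>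

definition A_sigma :: "real \<Rightarrow> (real \<Rightarrow> complex) \<Rightarrow> (real \<Rightarrow> complex) \<Rightarrow> real \<Rightarrow> complex" where
  "A_sigma \<alpha> \<psi> f = (SOME h. h \<in> L2 \<and> (\<forall>g\<in>L2. L2_inner h g =
     (\<integral>\<omega>. (\<integral>x. L2_inner f (atom \<alpha> \<psi> x \<omega>) * L2_inner (atom \<alpha> \<psi> x \<omega>) g \<partial>lborel) \<partial>lborel)))"

text \<open>The inverse of \<open>A\<^sub>\<sigma>\<close> on \<open>L\<^sup>2(\<real>)\<close>, again up to the choice of a representative. Its powers
  are the iterates \<open>A_sigma_inv \<alpha> \<psi> ^^ \<kappa>\<close>.\<close>

definition A_sigma_inv :: "real \<Rightarrow> (real \<Rightarrow> complex) \<Rightarrow> (real \<Rightarrow> complex) \<Rightarrow> real \<Rightarrow> complex" where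
  "A_sigma_inv \<alpha> \<psi> h = (SOME u. u \<in> L2 \<and> (AE t in lborel. A_sigma \<alpha> \<psi> u t = h t))"

definition atom_kernel :: "real \<Rightarrow> nat \<Rightarrow> (real \<Rightarrow> complex) \<Rightarrow> (real \<Rightarrow> complex) \<Rightarrow>
    real \<Rightarrow> real \<Rightarrow> real \<Rightarrow> real \<Rightarrow> complex" where
  "atom_kernel \<alpha> \<kappa> \<psi> \<phi> x \<omega> x' \<omega>' =
     L2_inner (atom \<alpha> \<psi> x \<omega>) ((A_sigma_inv \<alpha> \<psi> ^^ \<kappa>) (atom \<alpha> \<phi> x' \<omega>'))"

definition weight :: "real \<Rightarrow> real \<Rightarrow> real \<Rightarrow> real" where
  "weight s \<omega> \<omega>' = (max ((1 + \<bar>\<omega>'\<bar>) / (1 + \<bar>\<omega>\<bar>)) ((1 + \<bar>\<omega>\<bar>) / (1 + \<bar>\<omega>'\<bar>))) powr \<bar>s\<bar>"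

end

theory Submission
  imports Defs "HOL-Probability.Characteristic_Functions"
begin

text \<open>By the Fourier--Plancherel theorem \<open>A_sigma\<close> is the Fourier multiplier with symbol
  \<open>m \<xi> = \<integral> beta \<omega> * |F (beta \<omega> * (\<xi> - \<omega>))|\<^sup>2 d\<omega>\<close>, so the kernel is the Fourier transform, at \<open>x - x'\<close>, of
  \<open>G = P\<^sub>\<omega> * cnj P'\<^sub>\<omega>\<^sub>' * m\<^sup>-\<^sup>\<kappa>\<close>, a product of two dilated windows and a power of the symbol. The \<open>j\<close>-th derivative of \<open>m\<close> is at
  most a constant times \<open>beta\<^sup>j\<close>, and \<open>m\<close> is bounded below because \<open>\<omega> \<mapsto> beta \<omega> * (\<xi> - \<omega>)\<close> takes every value
  and stays close to it on an interval of length comparable to \<open>1 / beta \<omega>\<close>.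

  Two integrations by parts at the scale \<open>l = sqrt (beta \<omega> * beta \<omega>')\<close> bound the \<open>x\<close>-integral of the kernel by
  \<open>\<integral> l * |G| + |G''| / l d\<xi>\<close>. Put \<open>u = 1 + beta \<omega> * |\<xi> - \<omega>|\<close> and \<open>v = 1 + beta \<omega>' * |\<xi> - \<omega>'|\<close>. The
  ratios of \<open>1 + |\<omega>|\<close>, \<open>1 + |\<omega>'|\<close> and \<open>1 + |\<xi>|\<close> are at most \<open>(u * v) powr (1 / (1 - \<alpha>))\<close>, so the weighted
  integrand is at most a constant times \<open>beta \<omega> * beta \<omega>' * (u * v) powr (- q)\<close> with
  \<open>q = r - (s + \<alpha>) / (1 - \<alpha>) > 1\<close>. Integrating first in \<open>\<omega>\<close> and then in \<open>\<xi>\<close> gives a uniform bound.\<close>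

section \<open>The space \<open>L\<^sup>2\<close>\<close>

text \<open>\<open>A_sigma\<close> and \<open>A_sigma_inv\<close> are picked by a choice operator,
  so nothing is known of them before existence and uniqueness of the chosen vectors are proved. Both
  come from the transform side: existence needs a preimage of a given square integrable function,
  uniqueness needs test vectors with prescribed transform. This is why the transform is developed up
  to surjectivity and not only up to isometry. The obstacle in the estimate is that the dilation
  varies with the frequency, so that three scales meet in one product: \<open>beta\<close> at
  \<omega>, at \<omega>' and at \<xi>. The geometric mean \<open>l\<close> of the first two,
  multiplied by the normalisations of the two atoms, is exactly
  \<open>beta \<alpha> \<omega> * beta \<alpha> \<omega>'\<close>, one factor for each of the two
  remaining integrations. Measured against \<open>l\<close>, second derivatives cost the power
  \<open>\<alpha> / (1 - \<alpha>)\<close> of \<open>u * v\<close>, and the weight costs the power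
  \<open>s / (1 - \<alpha>)\<close>; together these are the loss from \<open>r\<close> to
  \<open>q\<close>. Two derivatives suffice since \<open>(1 + \<bar>x\<bar> / l) powr (- 2)\<close>
  is integrable on the line.\<close>

definition sqnorm :: "(real \<Rightarrow> complex) \<Rightarrow> real" where
  "sqnorm f = (\<integral>t. (cmod (f t))\<^sup>2 \<partial>lborel)"

abbreviation L2_lim :: "(nat \<Rightarrow> real \<Rightarrow> complex) \<Rightarrow> (real \<Rightarrow> complex) \<Rightarrow> bool" where
  "L2_lim F f \<equiv> (\<lambda>n. sqnorm (\<lambda>t. F n t - f t)) \<longlonglongrightarrow> 0"

lemma sqnorm_nonneg [simp]: "0 \<le> sqnorm f"
  by (simp add: sqnorm_def)

lemma L2_measurable: "f \<in> L2 \<Longrightarrow> f \<in> borel_measurable borel"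
  by (simp add: L2_def)

lemma L2_integrable: "f \<in> L2 \<Longrightarrow> integrable lborel (\<lambda>t. (cmod (f t))\<^sup>2)"
  by (simp add: L2_def)

lemma L2I: "f \<in> borel_measurable borel \<Longrightarrow> integrable lborel (\<lambda>t. (cmod (f t))\<^sup>2) \<Longrightarrow> f \<in> L2"
  by (simp add: L2_def)

lemma L2_bound:
  assumes "f \<in> borel_measurable borel" "integrable lborel w" "\<And>t. (cmod (f t))\<^sup>2 \<le> w t"
  shows "f \<in> L2"
proof (rule L2I[OF assms(1)])
  show "integrable lborel (\<lambda>t. (cmod (f t))\<^sup>2)"
    by (rule Bochner_Integration.integrable_bound[OF assms(2)])
       (use assms in \<open>auto intro!: AE_I2 order_trans[OF assms(3)]\<close>)
qed

lemma norm_add_sq_le: "(norm (a + b :: 'a::real_normed_vector))\<^sup>2 \<le> 2 * (norm a)\<^sup>2 + 2 * (norm b)\<^sup>2"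
proof -
  have "(norm (a + b))\<^sup>2 \<le> (norm a + norm b)\<^sup>2" by (intro power_mono norm_triangle_ineq) auto
  also have "\<dots> \<le> 2 * (norm a)\<^sup>2 + 2 * (norm b)\<^sup>2"
    using sum_squares_bound[of "norm a" "norm b"] by (simp add: power2_sum)
  finally show ?thesis .
qed

lemma L2_add [intro]:
  assumes "f \<in> L2" "g \<in> L2" shows "(\<lambda>t. f t + g t) \<in> L2"
proof (rule L2_bound)
  note [measurable] = assms[THEN L2_measurable]
  show "(\<lambda>t. f t + g t) \<in> borel_measurable borel" by measurable
  show "integrable lborel (\<lambda>t. 2 * (cmod (f t))\<^sup>2 + 2 * (cmod (g t))\<^sup>2)"
    using assms[THEN L2_integrable] by auto
qed (rule norm_add_sq_le)

lemma L2_cmult [intro]: "f \<in> L2 \<Longrightarrow> (\<lambda>t. c * f t) \<in> L2"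
  by (rule L2_bound[where w = "\<lambda>t. (cmod c)\<^sup>2 * (cmod (f t))\<^sup>2"])
     (auto simp: norm_mult power_mult_distrib dest: L2_measurable L2_integrable)

lemma borel_measurable_cnj [measurable (raw)]:
  "f \<in> borel_measurable M \<Longrightarrow> (\<lambda>x. cnj (f x)) \<in> borel_measurable M"
  by (rule borel_measurable_continuous_on[OF continuous_on_cnj]) auto

lemma L2_cnj [intro]: "f \<in> L2 \<Longrightarrow> (\<lambda>t. cnj (f t)) \<in> L2"
  by (auto simp: L2_def)

lemma L2_diff [intro]: "f \<in> L2 \<Longrightarrow> g \<in> L2 \<Longrightarrow> (\<lambda>t. f t - g t) \<in> L2"
  using L2_add[OF _ L2_cmult[of g "-1"], of f] by simp

lemma L2_mult_bounded:
  assumes "f \<in> L2" "m \<in> borel_measurable borel" "\<And>t. cmod (m t) \<le> B"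
  shows "(\<lambda>t. m t * f t) \<in> L2"
proof (rule L2_bound[where w = "\<lambda>t. B\<^sup>2 * (cmod (f t))\<^sup>2"])
  note [measurable] = assms(2) L2_measurable[OF assms(1)]
  show "(\<lambda>t. m t * f t) \<in> borel_measurable borel" by measurable
  show "integrable lborel (\<lambda>t. B\<^sup>2 * (cmod (f t))\<^sup>2)" using L2_integrable[OF assms(1)] by simp
  show "(cmod (m t * f t))\<^sup>2 \<le> B\<^sup>2 * (cmod (f t))\<^sup>2" for t
    unfolding norm_mult power_mult_distrib by (intro mult_right_mono power_mono assms) auto
qed

lemma L2_integrable_mult:
  assumes "f \<in> L2" "g \<in> L2" shows "integrable lborel (\<lambda>t. f t * g t)"
proof (rule Bochner_Integration.integrable_bound)
  note [measurable] = assms[THEN L2_measurable]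
  show "integrable lborel (\<lambda>t. (cmod (f t))\<^sup>2 + (cmod (g t))\<^sup>2)"
    using assms[THEN L2_integrable] by auto
  show "(\<lambda>t. f t * g t) \<in> borel_measurable lborel" by measurable
  show "AE t in lborel. cmod (f t * g t) \<le> norm ((cmod (f t))\<^sup>2 + (cmod (g t))\<^sup>2)"
  proof (intro AE_I2)
    fix t
    have "cmod (f t) * cmod (g t) \<le> 2 * cmod (f t) * cmod (g t)" by simp
    also have "\<dots> \<le> (cmod (f t))\<^sup>2 + (cmod (g t))\<^sup>2" by (rule sum_squares_bound)
    finally show "cmod (f t * g t) \<le> norm ((cmod (f t))\<^sup>2 + (cmod (g t))\<^sup>2)"
      by (simp add: norm_mult)
  qed
qed

lemma sqnorm_nn_integral:
  "f \<in> L2 \<Longrightarrow> (\<integral>\<^sup>+t. ennreal ((cmod (f t))\<^sup>2) \<partial>lborel) = ennreal (sqnorm f)"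
  unfolding sqnorm_def by (intro nn_integral_eq_integral L2_integrable) auto

lemma L2_nn_integral:
  assumes "f \<in> borel_measurable borel"
    and "(\<integral>\<^sup>+t. ennreal ((cmod (f t))\<^sup>2) \<partial>lborel) \<le> ennreal c" "0 \<le> c"
  shows "f \<in> L2" "sqnorm f \<le> c"
proof -
  note [measurable] = assms(1)
  show L: "f \<in> L2"
    using assms(2) by (intro L2I assms) (auto simp: integrable_iff_bounded intro: le_less_trans)
  then show "sqnorm f \<le> c" using assms(2,3) by (simp add: sqnorm_nn_integral)
qed

text \<open>No conjugate on the second factor: the same estimate then serves inner products and the
  multiplication formula of the Fourier transform.\<close>

lemma L2_Cauchy_Schwarz:
  assumes "f \<in> L2" "g \<in> L2"
  shows "(cmod (\<integral>t. f t * g t \<partial>lborel))\<^sup>2 \<le> sqnorm f * sqnorm g"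
proof -
  note [measurable] = assms[THEN L2_measurable]
  have "ennreal (cmod (\<integral>t. f t * g t \<partial>lborel)) \<le> (\<integral>\<^sup>+t. ennreal (cmod (f t)) * ennreal (cmod (g t)) \<partial>lborel)"
    using integral_norm_bound_ennreal[OF L2_integrable_mult[OF assms]]
    by (simp add: norm_mult ennreal_mult)
  then have "(ennreal (cmod (\<integral>t. f t * g t \<partial>lborel)))\<^sup>2 \<le> (\<integral>\<^sup>+t. ennreal (cmod (f t)) * ennreal (cmod (g t)) \<partial>lborel)\<^sup>2"
    by (intro power_mono) auto
  also have "\<dots> \<le> (\<integral>\<^sup>+t. (ennreal (cmod (f t)))\<^sup>2 \<partial>lborel) * (\<integral>\<^sup>+t. (ennreal (cmod (g t)))\<^sup>2 \<partial>lborel)"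
    by (rule Cauchy_Schwarz_nn_integral) auto
  also have "\<dots> = ennreal (sqnorm f * sqnorm g)"
    by (simp add: ennreal_power sqnorm_nn_integral assms ennreal_mult)
  finally show ?thesis by (simp add: ennreal_power)
qed

text \<open>The squared norm avoids square roots. The factor 2 in its triangle inequality is
  harmless, since only smallness and convergence to 0 are deduced from it.\<close>

lemma sqnorm_add_le:
  assumes "f \<in> L2" "g \<in> L2"
  shows "sqnorm (\<lambda>t. f t + g t) \<le> 2 * sqnorm f + 2 * sqnorm g"
proof -
  have "sqnorm (\<lambda>t. f t + g t) \<le> (\<integral>t. 2 * (cmod (f t))\<^sup>2 + 2 * (cmod (g t))\<^sup>2 \<partial>lborel)"
    unfolding sqnorm_def
    using assms[THEN L2_integrable] L2_add[OF assms, THEN L2_integrable] norm_add_sq_le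
    by (intro integral_mono) auto
  also have "\<dots> = 2 * sqnorm f + 2 * sqnorm g"
    using assms[THEN L2_integrable] by (simp add: sqnorm_def)
  finally show ?thesis .
qed

lemma sqnorm_minus_commute: "sqnorm (\<lambda>t. f t - g t) = sqnorm (\<lambda>t. g t - f t)"
  by (simp add: sqnorm_def norm_minus_commute)

lemma sqnorm_cnj [simp]: "sqnorm (\<lambda>t. cnj (f t)) = sqnorm f"
  by (simp add: sqnorm_def)

lemma sqnorm_triangle:
  assumes "f \<in> L2" "g \<in> L2" "h \<in> L2"
  shows "sqnorm (\<lambda>t. f t - h t) \<le> 2 * sqnorm (\<lambda>t. f t - g t) + 2 * sqnorm (\<lambda>t. g t - h t)"
  using sqnorm_add_le[OF L2_diff[OF assms(1,2)] L2_diff[OF assms(2,3)]] by simp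

lemma L2_inner_self: "L2_inner f f = complex_of_real (sqnorm f)"
  by (simp add: L2_inner_def sqnorm_def complex_norm_square[symmetric] flip: integral_complex_of_real)

lemma sqnorm_eq_0_iff: "f \<in> L2 \<Longrightarrow> sqnorm f = 0 \<longleftrightarrow> (AE t in lborel. f t = 0)"
  unfolding sqnorm_def by (subst integral_nonneg_eq_0_iff_AE) (auto dest: L2_integrable)

lemma sqnorm_diff_eq_0_iff:
  "f \<in> L2 \<Longrightarrow> g \<in> L2 \<Longrightarrow> sqnorm (\<lambda>t. f t - g t) = 0 \<longleftrightarrow> (AE t in lborel. f t = g t)"
  by (simp add: sqnorm_eq_0_iff[OF L2_diff])

text \<open>Kept with a complex scalar \<open>c\<close>, because polarization recovers both parts of
  the inner product by varying \<open>c\<close>.\<close>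

lemma sqnorm_expand:
  assumes "f \<in> L2" "g \<in> L2"
  shows "sqnorm (\<lambda>t. f t + c * g t) = sqnorm f + (cmod c)\<^sup>2 * sqnorm g + 2 * Re (cnj c * L2_inner f g)"
proof -
  have i: "integrable lborel (\<lambda>t. cnj c * (f t * cnj (g t)))"
    using L2_integrable_mult[OF assms(1) L2_cnj[OF assms(2)]] by simp
  have "(cmod (f t + c * g t))\<^sup>2 = (cmod (f t))\<^sup>2 + (cmod c)\<^sup>2 * (cmod (g t))\<^sup>2 + 2 * Re (cnj c * (f t * cnj (g t)))" for t
    unfolding cmod_power2 by (simp add: algebra_simps power2_eq_square)
  then have "sqnorm (\<lambda>t. f t + c * g t) =
      (\<integral>t. (cmod (f t))\<^sup>2 + (cmod c)\<^sup>2 * (cmod (g t))\<^sup>2 + 2 * Re (cnj c * (f t * cnj (g t))) \<partial>lborel)"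
    unfolding sqnorm_def by presburger
  also have "\<dots> = sqnorm f + (cmod c)\<^sup>2 * sqnorm g + 2 * (\<integral>t. Re (cnj c * (f t * cnj (g t))) \<partial>lborel)"
  proof -
    have "(\<integral>t. u t + x * v t + 2 * w t \<partial>lborel) = (\<integral>t. u t \<partial>lborel) + x * (\<integral>t. v t \<partial>lborel) + 2 * (\<integral>t. w t \<partial>lborel)"
      if "integrable lborel u" "integrable lborel v" "integrable lborel w" for u v w :: "real \<Rightarrow> real" and x
      using that by simp
    from this[OF assms[THEN L2_integrable] integrable_Re[OF i]] show ?thesis
      by (simp only: sqnorm_def)
  qed
  also have "(\<integral>t. Re (cnj c * (f t * cnj (g t))) \<partial>lborel) = Re (cnj c * L2_inner f g)"
    unfolding L2_inner_def using integral_Re[OF i] by simp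
  finally show ?thesis .
qed

text \<open>With \<open>F = (F - f) + f\<close> and likewise for \<open>G\<close>, every product
  except \<open>f * g\<close> contains a factor that tends to 0, and Cauchy-Schwarz disposes of
  it.\<close>

lemma L2_lim_bilinear:
  assumes "\<And>n. F n \<in> L2" "f \<in> L2" "\<And>n. G n \<in> L2" "g \<in> L2" "L2_lim F f" "L2_lim G g"
  shows "(\<lambda>n. \<integral>t. F n t * G n t \<partial>lborel) \<longlonglongrightarrow> (\<integral>t. f t * g t \<partial>lborel)"
proof -
  have *: "(\<lambda>n. \<integral>t. A n t * B n t \<partial>lborel) \<longlonglongrightarrow> 0"
    if "\<And>n. A n \<in> L2" "\<And>n. B n \<in> L2" "(\<lambda>n. sqnorm (A n) * sqnorm (B n)) \<longlonglongrightarrow> 0" for A B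
  proof (rule tendsto_norm_zero_cancel, rule real_tendsto_sandwich)
    show "(\<lambda>n. 0) \<longlonglongrightarrow> (0::real)" by simp
    show "(\<lambda>n. sqrt (sqnorm (A n) * sqnorm (B n))) \<longlonglongrightarrow> 0"
      using tendsto_real_sqrt[OF that(3)] by simp
    show "\<forall>\<^sub>F n in sequentially. cmod (\<integral>t. A n t * B n t \<partial>lborel) \<le> sqrt (sqnorm (A n) * sqnorm (B n))"
      by (intro always_eventually allI real_le_rsqrt L2_Cauchy_Schwarz that)
  qed auto
  have d: "\<And>n. (\<lambda>t. F n t - f t) \<in> L2" "\<And>n. (\<lambda>t. G n t - g t) \<in> L2" using assms by auto
  let ?a = "\<lambda>n. \<integral>t. (F n t - f t) * (G n t - g t) \<partial>lborel" and ?b = "\<lambda>n. \<integral>t. (F n t - f t) * g t \<partial>lborel"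
    and ?c = "\<lambda>n. \<integral>t. f t * (G n t - g t) \<partial>lborel" and ?d = "\<integral>t. f t * g t \<partial>lborel"
  have "(\<lambda>n. ?a n + ?b n + ?c n + ?d) \<longlonglongrightarrow> 0 + 0 + 0 + ?d"
    using assms d tendsto_mult[OF assms(5,6)] tendsto_mult[OF assms(5) tendsto_const[of "sqnorm g"]]
      tendsto_mult[OF tendsto_const[of "sqnorm f"] assms(6)]
    by (intro tendsto_add tendsto_const *) auto
  moreover have "?a n + ?b n + ?c n + ?d = (\<integral>t. F n t * G n t \<partial>lborel)" for n
  proof -
    have "(\<integral>t. F n t * G n t \<partial>lborel) = (\<integral>t. (F n t - f t) * (G n t - g t) + (F n t - f t) * g t
        + f t * (G n t - g t) + f t * g t \<partial>lborel)"
      by (intro Bochner_Integration.integral_cong) (auto simp: algebra_simps)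
    also have "\<dots> = ?a n + ?b n + ?c n + ?d"
      using L2_integrable_mult[OF d] L2_integrable_mult[OF d(1) assms(4)]
        L2_integrable_mult[OF assms(2) d(2)] L2_integrable_mult[OF assms(2,4)]
      by (simp only: Bochner_Integration.integral_add Bochner_Integration.integrable_add)
    finally show ?thesis by simp
  qed
  ultimately show ?thesis by simp
qed

lemma L2_lim_cnj: "L2_lim F f \<Longrightarrow> L2_lim (\<lambda>n t. cnj (F n t)) (\<lambda>t. cnj (f t))"
  using sqnorm_cnj[of "\<lambda>t. F n t - f t" for n] by simp

lemma L2_lim_inner:
  assumes "\<And>n. F n \<in> L2" "f \<in> L2" "\<And>n. G n \<in> L2" "g \<in> L2" "L2_lim F f" "L2_lim G g"
  shows "(\<lambda>n. L2_inner (F n) (G n)) \<longlonglongrightarrow> L2_inner f g"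
  unfolding L2_inner_def by (intro L2_lim_bilinear L2_cnj L2_lim_cnj assms)

lemma L2_lim_triangle:
  assumes "\<And>n. F n \<in> L2" "f \<in> L2" "\<And>n. G n \<in> L2" "L2_lim F f"
    and "(\<lambda>n. sqnorm (\<lambda>t. G n t - F n t)) \<longlonglongrightarrow> 0"
  shows "L2_lim G f"
proof (rule real_tendsto_sandwich[where f = "\<lambda>_. 0"])
  show "\<forall>\<^sub>F n in sequentially. sqnorm (\<lambda>t. G n t - f t) \<le> 2 * sqnorm (\<lambda>t. G n t - F n t) + 2 * sqnorm (\<lambda>t. F n t - f t)"
    by (intro always_eventually allI sqnorm_triangle assms)
  show "(\<lambda>n. 2 * sqnorm (\<lambda>t. G n t - F n t) + 2 * sqnorm (\<lambda>t. F n t - f t)) \<longlonglongrightarrow> 0"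
    using tendsto_add[OF tendsto_mult_left[OF assms(5), of 2] tendsto_mult_left[OF assms(4), of 2]] by simp
qed auto

lemma L2_lim_unique:
  assumes "\<And>n. F n \<in> L2" "f \<in> L2" "g \<in> L2" "L2_lim F f" "L2_lim F g"
  shows "AE t in lborel. f t = g t"
proof -
  have "(\<lambda>n::nat. sqnorm (\<lambda>t. g t - f t)) \<longlonglongrightarrow> 0"
    using assms by (intro L2_lim_triangle[of F f "\<lambda>_. g"]) (auto simp: sqnorm_minus_commute[of g])
  then have "sqnorm (\<lambda>t. g t - f t) = 0" by (simp add: LIMSEQ_const_iff)
  then show ?thesis using assms by (auto simp: sqnorm_diff_eq_0_iff)
qed

lemma L2_lim_dominated:
  assumes "\<And>n. F n \<in> borel_measurable borel" "f \<in> borel_measurable borel" "integrable lborel w"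
    and "AE t in lborel. (\<lambda>n. F n t) \<longlonglongrightarrow> f t"
    and "\<And>n t. (cmod (F n t - f t))\<^sup>2 \<le> w t"
  shows "L2_lim F f"
proof -
  note [measurable] = assms(1,2)
  have "(\<lambda>n. \<integral>t. (cmod (F n t - f t))\<^sup>2 \<partial>lborel) \<longlonglongrightarrow> (\<integral>(t::real). 0 \<partial>lborel)"
  proof (rule integral_dominated_convergence[where w = w])
    show "AE t in lborel. (\<lambda>n. (cmod (F n t - f t))\<^sup>2) \<longlonglongrightarrow> 0"
      using assms(4)
    proof eventually_elim
      case (elim t)
      show ?case using tendsto_power[OF tendsto_norm[OF tendsto_diff[OF elim tendsto_const[of "f t"]]], of 2] by simp
    qed
  qed (use assms(3,5) in auto)
  then show ?thesis by (simp add: sqnorm_def)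
qed

section \<open>Truncation to intervals and completeness\<close>

definition trunc :: "(real \<Rightarrow> complex) \<Rightarrow> nat \<Rightarrow> real \<Rightarrow> complex" where
  "trunc f n = (\<lambda>x. indicator {- real n..real n} x * f x)"

lemma trunc_tendsto: "(\<lambda>n. trunc f n x) \<longlonglongrightarrow> f x"
proof -
  obtain N :: nat where N: "\<bar>x\<bar> \<le> N" using real_arch_simple by blast
  have "trunc f n x = f x" if "n \<ge> N" for n
  proof -
    have "\<bar>x\<bar> \<le> real n" using N that by linarith
    then show ?thesis by (auto simp: trunc_def indicator_def)
  qed
  then show ?thesis
    by (intro tendsto_eventually) (auto simp: eventually_sequentially)
qed

lemma trunc_L2: "f \<in> L2 \<Longrightarrow> trunc f n \<in> L2"
  unfolding trunc_def by (rule L2_mult_bounded[where B = 1]) (auto simp: indicator_def)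

lemma trunc_lim:
  assumes "f \<in> L2" shows "L2_lim (trunc f) f"
proof (rule L2_lim_dominated)
  show "\<And>n. trunc f n \<in> borel_measurable borel" using trunc_L2[OF assms] by (rule L2_measurable)
  show "f \<in> borel_measurable borel" using assms by (rule L2_measurable)
  show "integrable lborel (\<lambda>t. (cmod (f t))\<^sup>2)" using assms by (rule L2_integrable)
  show "(cmod (trunc f n t - f t))\<^sup>2 \<le> (cmod (f t))\<^sup>2" for n t
    by (simp add: trunc_def indicator_def)
qed (simp add: trunc_tendsto)

text \<open>A truncation is a product of two square integrable functions, an indicator and
  \<open>f\<close>. Truncations therefore lie in both spaces and form the bridge from the integral
  transform to its extension.\<close>

lemma trunc_integrable:
  assumes "f \<in> L2" shows "integrable lborel (trunc f n)"
proof -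
  have "(\<lambda>x. indicator {- real n..real n} x) \<in> L2"
    by (rule L2_bound[where w = "indicator {- real n..real n}"]) (auto simp: indicator_def)
  from L2_integrable_mult[OF this assms] show ?thesis by (simp add: trunc_def)
qed

lemma summable_diff_imp_convergent:
  fixes F :: "nat \<Rightarrow> 'a::real_normed_vector"
  assumes "summable (\<lambda>k. F (Suc k) - F k)"
  shows "convergent F"
proof -
  have "convergent (\<lambda>n. (\<Sum>k<n. F (Suc k) - F k) + F 0)"
    using assms by (intro convergent_add) (auto simp: summable_iff_convergent convergent_const)
  then show ?thesis by (simp add: sum_lessThan_telescope)
qed

text \<open>Riesz-Fischer: a rapidly convergent subsequence converges almost everywhere, and Fatou's
  lemma turns its pointwise limit into a limit in the norm.\<close>

lemma L2_complete:
  assumes F: "\<And>n. F n \<in> L2"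
    and C: "\<And>e. e > 0 \<Longrightarrow> \<exists>M::nat. \<forall>m\<ge>M. \<forall>n\<ge>M. sqnorm (\<lambda>t. F m t - F n t) < e"
  obtains f where "f \<in> L2" "L2_lim F f"
proof -
  note [measurable] = F[THEN L2_measurable]
  \<comment> \<open>The rate 4^-k leaves room for the weight 2^k below: the weighted sum of the
    \<open>d k\<close> still has a finite integral and forces \<open>d k t\<close> to decay like
    2^-k at almost every \<open>t\<close>.\<close>
  have "\<forall>k::nat. \<exists>M. \<forall>m\<ge>M. \<forall>n\<ge>M. sqnorm (\<lambda>t. F m t - F n t) < (1/4)^k" by (intro allI C) simp
  then obtain M where M: "\<And>k m n. m \<ge> M k \<Longrightarrow> n \<ge> M k \<Longrightarrow> sqnorm (\<lambda>t. F m t - F n t) < (1/4)^k" by metis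
  \<comment> \<open>Partial sums make the indices monotone while they still dominate each
    \<open>M k\<close>.\<close>
  define r where "r k = (\<Sum>i\<le>k. M i)" for k
  have rM: "r k \<ge> M k" for k unfolding r_def by (rule member_le_sum) auto
  have rmono: "k \<le> l \<Longrightarrow> r k \<le> r l" for k l unfolding r_def by (rule sum_mono2) auto
  define d where "d k t = (cmod (F (r (Suc k)) t - F (r k) t))\<^sup>2" for k t
  have [measurable]: "d k \<in> borel_measurable borel" for k unfolding d_def by measurable
  have dint: "(\<integral>\<^sup>+t. ennreal (d k t) \<partial>lborel) \<le> ennreal ((1/4)^k)" for k
  proof -
    have "(\<integral>\<^sup>+t. ennreal (d k t) \<partial>lborel) = ennreal (sqnorm (\<lambda>t. F (r (Suc k)) t - F (r k) t))"
      unfolding d_def by (intro sqnorm_nn_integral L2_diff F)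
    also have "\<dots> \<le> ennreal ((1/4)^k)"
      using M[of k "r (Suc k)" "r k"] rM[of k] rmono[of k "Suc k"] by (intro ennreal_leI) auto
    finally show ?thesis .
  qed
  have "(\<integral>\<^sup>+t. (\<Sum>k. ennreal (2^k * d k t)) \<partial>lborel) = (\<Sum>k. \<integral>\<^sup>+t. ennreal (2^k * d k t) \<partial>lborel)"
    by (intro nn_integral_suminf) auto
  also have "\<dots> \<le> (\<Sum>k. ennreal ((1/2)^k))"
  proof (intro suminf_le)
    fix k
    have "(\<integral>\<^sup>+t. ennreal (2^k * d k t) \<partial>lborel) = ennreal (2^k) * (\<integral>\<^sup>+t. ennreal (d k t) \<partial>lborel)"
      by (simp add: ennreal_mult' nn_integral_cmult)
    also have "\<dots> \<le> ennreal (2^k) * ennreal ((1/4)^k)" by (intro mult_left_mono dint) auto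
    also have "\<dots> = ennreal ((1/2)^k)" by (simp flip: ennreal_mult' power_mult_distrib)
    finally show "(\<integral>\<^sup>+t. ennreal (2^k * d k t) \<partial>lborel) \<le> ennreal ((1/2)^k)" .
  qed auto
  also have "\<dots> = ennreal (\<Sum>k. (1/2)^k)" by (intro suminf_ennreal2) auto
  finally have fin: "(\<integral>\<^sup>+t. (\<Sum>k. ennreal (2^k * d k t)) \<partial>lborel) \<noteq> \<infinity>"
    by (auto simp: top_unique)
  have conv: "AE t in lborel. convergent (\<lambda>k. F (r k) t)"
  proof -
    have "AE t in lborel. (\<Sum>k. ennreal (2^k * d k t)) \<noteq> \<infinity>"
      by (rule nn_integral_PInf_AE[OF _ fin]) auto
    then show ?thesis
    proof eventually_elim
      case (elim t)
      then obtain c where c: "(\<Sum>k. ennreal (2^k * d k t)) = ennreal c" "0 \<le> c"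
        by (cases "\<Sum>k. ennreal (2^k * d k t)") auto
      have dle: "2^k * d k t \<le> c" for k
      proof -
        have "ennreal (2^k * d k t) \<le> (\<Sum>k. ennreal (2^k * d k t))"
          using sum_le_suminf[of "\<lambda>k. ennreal (2^k * d k t)" "{k}"] by simp
        then show ?thesis using c by simp
      qed
      have "summable (\<lambda>k. F (r (Suc k)) t - F (r k) t)"
      proof (rule summable_comparison_test)
        show "\<exists>N. \<forall>n\<ge>N. cmod (F (r (Suc n)) t - F (r n) t) \<le> sqrt c * (sqrt (1/2))^n"
        proof (intro exI allI impI)
          fix n
          have "d n t \<le> c * (1/2)^n" using dle[of n] by (simp add: field_simps power_divide)
          then have "sqrt (d n t) \<le> sqrt (c * (1/2)^n)" by simp
          then show "cmod (F (r (Suc n)) t - F (r n) t) \<le> sqrt c * (sqrt (1/2))^n"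
            by (simp add: d_def real_sqrt_mult real_sqrt_power[symmetric])
        qed
        show "summable (\<lambda>n. sqrt c * sqrt (1/2) ^ n)"
          by (intro summable_mult summable_geometric) (simp add: real_sqrt_lt_1_iff)
      qed
      then show "convergent (\<lambda>k. F (r k) t)"
        by (rule summable_diff_imp_convergent)
    qed
  qed
  define f where "f t = lim (\<lambda>k. F (r k) t)" for t
  have [measurable]: "f \<in> borel_measurable borel" unfolding f_def by measurable
  have lim: "AE t in lborel. (\<lambda>k. F (r k) t) \<longlonglongrightarrow> f t"
    using conv by eventually_elim (simp add: f_def convergent_LIMSEQ_iff)
  \<comment> \<open>Fatou along the subsequence: a late \<open>F m\<close> is within 4^-j of all
    later \<open>F (r k)\<close>, hence of their limit.\<close>
  have key: "(\<lambda>t. F m t - f t) \<in> L2 \<and> sqnorm (\<lambda>t. F m t - f t) \<le> (1/4)^j" if "m \<ge> r j" for m j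
  proof -
    have "(\<integral>\<^sup>+t. ennreal ((cmod (F m t - f t))\<^sup>2) \<partial>lborel) =
        (\<integral>\<^sup>+t. liminf (\<lambda>k. ennreal ((cmod (F m t - F (r k) t))\<^sup>2)) \<partial>lborel)"
    proof (rule nn_integral_cong_AE)
      show "AE t in lborel. ennreal ((cmod (F m t - f t))\<^sup>2) = liminf (\<lambda>k. ennreal ((cmod (F m t - F (r k) t))\<^sup>2))"
        using lim
      proof eventually_elim
        case (elim t)
        then have "(\<lambda>k. ennreal ((cmod (F m t - F (r k) t))\<^sup>2)) \<longlonglongrightarrow> ennreal ((cmod (F m t - f t))\<^sup>2)"
          by (intro tendsto_intros)
        then show ?case by (rule lim_imp_Liminf[OF sequentially_bot, symmetric])
      qed
    qed
    also have "\<dots> \<le> liminf (\<lambda>k. \<integral>\<^sup>+t. ennreal ((cmod (F m t - F (r k) t))\<^sup>2) \<partial>lborel)"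
      by (rule nn_integral_liminf) auto
    also have "\<dots> \<le> ennreal ((1/4)^j)"
    proof (rule Liminf_le)
      show "\<forall>\<^sub>F k in sequentially. (\<integral>\<^sup>+t. ennreal ((cmod (F m t - F (r k) t))\<^sup>2) \<partial>lborel) \<le> ennreal ((1/4)^j)"
        unfolding eventually_sequentially
      proof (intro exI allI impI)
        fix k assume "j \<le> k"
        then have "sqnorm (\<lambda>t. F m t - F (r k) t) < (1/4)^j"
          using that rM[of j] rmono[of j k] by (intro M) auto
        then show "(\<integral>\<^sup>+t. ennreal ((cmod (F m t - F (r k) t))\<^sup>2) \<partial>lborel) \<le> ennreal ((1/4)^j)"
          using F by (subst sqnorm_nn_integral) auto
      qed
    qed simp
    finally show ?thesis by (intro conjI L2_nn_integral) auto
  qed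
  have "(\<lambda>t. F (r 0) t - (F (r 0) t - f t)) \<in> L2"
    using key[of 0 "r 0"] by (intro L2_diff[OF F[of "r 0"], of "\<lambda>t. F (r 0) t - f t"]) simp
  then have fL: "f \<in> L2" by simp
  have "L2_lim F f"
  proof (rule LIMSEQ_I)
    fix e :: real assume "e > 0"
    then obtain j where j: "(1/4::real)^j < e" using real_arch_pow_inv[of e "1/4"] by auto
    show "\<exists>no. \<forall>n\<ge>no. norm (sqnorm (\<lambda>t. F n t - f t) - 0) < e"
      using key[where j = j] j by (intro exI[of _ "r j"]) (auto intro: le_less_trans)
  qed
  with fL show thesis by (rule that)
qed

section \<open>Plancherel theorem on \<open>L\<^sup>1 \<inter> L\<^sup>2\<close>\<close>

definition chi :: "real \<Rightarrow> real \<Rightarrow> complex" where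
  "chi \<xi> x = exp (- (2 * complex_of_real pi * \<i> * complex_of_real (\<xi> * x)))"

lemma fourier_chi: "fourier f \<xi> = (\<integral>x. f x * chi \<xi> x \<partial>lborel)"
  by (simp add: fourier_def chi_def)

lemma chi_cis: "chi \<xi> x = cis (- (2 * pi * \<xi> * x))"
  by (simp add: chi_def cis_conv_exp algebra_simps)

lemma cmod_chi [simp]: "cmod (chi \<xi> x) = 1"
  by (simp add: chi_cis)

lemma chi_add: "chi \<xi> (x + y) = chi \<xi> x * chi \<xi> y"
  by (simp add: chi_cis cis_mult algebra_simps)

lemma cnj_chi: "cnj (chi \<xi> x) = chi \<xi> (- x)"
  by (simp add: chi_cis cis_cnj)

lemma chi_commute: "chi \<xi> x = chi x \<xi>"
  by (simp add: chi_cis mult.commute mult.left_commute)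

lemma chi_0 [simp]: "chi \<xi> 0 = 1" "chi 0 x = 1"
  by (simp_all add: chi_cis)

lemma chi_mult_uminus [simp]: "chi \<xi> x * chi \<xi> (- x) = 1" "chi \<xi> (- x) * chi \<xi> x = 1"
  by (simp_all flip: chi_add)

lemma measurable_chi [measurable (raw)]:
  assumes "f \<in> borel_measurable M" "g \<in> borel_measurable M"
  shows "(\<lambda>x. chi (f x) (g x)) \<in> borel_measurable M"
  unfolding chi_def using assms by measurable

lemma fourier_measurable [measurable]:
  assumes [measurable]: "f \<in> borel_measurable borel"
  shows "fourier f \<in> borel_measurable borel"
  unfolding fourier_chi[abs_def] by measurable

lemma integrable_mult_bounded:
  fixes f m :: "'a \<Rightarrow> complex"
  assumes "integrable M f" "m \<in> borel_measurable M" "\<And>x. cmod (m x) \<le> B"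
  shows "integrable M (\<lambda>x. f x * m x)"
proof (rule Bochner_Integration.integrable_bound)
  show "integrable M (\<lambda>x. complex_of_real B * f x)" using assms by simp
  show "(\<lambda>x. f x * m x) \<in> borel_measurable M" using assms by measurable
  have "0 \<le> B" using assms(3) norm_ge_zero order_trans by blast
  then show "AE x in M. cmod (f x * m x) \<le> cmod (complex_of_real B * f x)"
    using mult_right_mono[OF assms(3) norm_ge_zero] by (intro AE_I2) (simp add: norm_mult mult.commute)
qed

lemma integrable_chi:
  "integrable lborel f \<Longrightarrow> integrable lborel (\<lambda>x. f x * chi \<xi> x)"
  by (rule integrable_mult_bounded[where B = 1]) auto

lemma cmod_fourier_le: "integrable lborel f \<Longrightarrow> cmod (fourier f \<xi>) \<le> (\<integral>x. cmod (f x) \<partial>lborel)"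
  unfolding fourier_chi
  using integral_norm_bound[of lborel "\<lambda>x. f x * chi \<xi> x"] by (simp add: norm_mult)

lemma fourier_add:
  "integrable lborel f \<Longrightarrow> integrable lborel g \<Longrightarrow> fourier (\<lambda>x. f x + c * g x) \<xi> = fourier f \<xi> + c * fourier g \<xi>"
  unfolding fourier_chi using integrable_chi[of f \<xi>] integrable_chi[of g \<xi>]
  by (simp add: distrib_right mult.assoc)

lemma fourier_diff:
  "integrable lborel f \<Longrightarrow> integrable lborel g \<Longrightarrow> fourier (\<lambda>x. f x - g x) \<xi> = fourier f \<xi> - fourier g \<xi>"
  using fourier_add[of f g "-1" \<xi>] by simp

lemma integrable_tensor:
  fixes f g :: "real \<Rightarrow> complex"
  assumes f: "integrable lborel f" and g: "integrable lborel g"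
    and [measurable]: "(\<lambda>(x, y). K x y) \<in> borel_measurable (lborel \<Otimes>\<^sub>M lborel)"
    and K: "\<And>x y. cmod (K x y) \<le> 1"
  shows "integrable (lborel \<Otimes>\<^sub>M lborel) (\<lambda>(x, y). f x * g y * K x y)"
proof (rule Bochner_Integration.integrable_bound)
  have [measurable]: "f \<in> borel_measurable borel" "g \<in> borel_measurable borel"
    using f g by (auto dest: borel_measurable_integrable)
  show "integrable (lborel \<Otimes>\<^sub>M lborel) (\<lambda>(x, y). f x * g y)"
    by (rule lborel_pair.Fubini_integrable) (use f g in \<open>auto simp: norm_mult\<close>)
  show "(\<lambda>(x, y). f x * g y * K x y) \<in> borel_measurable (lborel \<Otimes>\<^sub>M lborel)" by measurable
  show "AE x in lborel \<Otimes>\<^sub>M lborel. cmod (case x of (x, y) \<Rightarrow> f x * g y * K x y) \<le> cmod (case x of (x, y) \<Rightarrow> f x * g y)"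
    using K by (intro AE_I2) (auto simp: norm_mult intro!: mult_left_le)
qed

text \<open>Fubini, together with the symmetry of \<open>chi\<close> in its two arguments.\<close>

lemma fourier_mult_formula:
  assumes f: "integrable lborel f" and g: "integrable lborel g"
  shows "(\<integral>\<xi>. fourier f \<xi> * g \<xi> \<partial>lborel) = (\<integral>x. f x * fourier g x \<partial>lborel)"
proof -
  have "(\<integral>\<xi>. fourier f \<xi> * g \<xi> \<partial>lborel) = (\<integral>\<xi>. (\<integral>x. f x * g \<xi> * chi \<xi> x \<partial>lborel) \<partial>lborel)"
    unfolding fourier_chi
    by (intro Bochner_Integration.integral_cong refl)
       (simp add: mult.assoc mult.left_commute[of "g _"] mult.commute[of "g _"] flip: integral_mult_left_zero)
  also have "\<dots> = (\<integral>x. (\<integral>\<xi>. f x * g \<xi> * chi \<xi> x \<partial>lborel) \<partial>lborel)"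
    by (rule lborel_pair.Fubini_integral)
       (rule integrable_tensor[OF f g], auto)
  also have "\<dots> = (\<integral>x. f x * fourier g x \<partial>lborel)"
    unfolding fourier_chi
    by (intro Bochner_Integration.integral_cong refl)
       (simp add: mult.assoc chi_commute)
  finally show ?thesis .
qed

lemma L2_affine:
  assumes "f \<in> L2" "c \<noteq> 0"
  shows "(\<lambda>y. f (t + c * y)) \<in> L2" "sqnorm f = \<bar>c\<bar> * sqnorm (\<lambda>y. f (t + c * y))"
proof -
  note [measurable] = L2_measurable[OF assms(1)]
  show "(\<lambda>y. f (t + c * y)) \<in> L2"
    using lborel_integrable_real_affine[OF L2_integrable[OF assms(1)] assms(2)] by (intro L2I) measurable
  show "sqnorm f = \<bar>c\<bar> * sqnorm (\<lambda>y. f (t + c * y))"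
    unfolding sqnorm_def using lborel_integral_real_affine[OF assms(2), of "\<lambda>x. (cmod (f x))\<^sup>2" t] by simp
qed

lemma L2_shift:
  assumes "f \<in> L2"
  shows "(\<lambda>y. f (y + t)) \<in> L2" "sqnorm (\<lambda>y. f (y + t)) = sqnorm f"
  using L2_affine[OF assms, of 1 t] by (simp_all add: add.commute)

section \<open>Density of bounded continuous functions\<close>

lemma clamp_cont: "continuous_on UNIV (\<lambda>z::complex. (k / max k (cmod z)) *\<^sub>R z)" if "k > 0" for k :: real
  using that by (intro continuous_intros) auto

text \<open>Pointwise approximation by continuous functions comes without a majorant. Composing with
  a continuous retraction and a continuous cutoff supplies one that does not depend on the
  approximant.\<close>

lemma L2_approx_continuous:
  assumes f: "f \<in> L2" and "e > 0"
  obtains c where "continuous_on UNIV c" "bounded (range c)" "c \<in> L2" "sqnorm (\<lambda>t. f t - c t) < e"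
proof -
  note [measurable] = L2_measurable[OF f]
  \<comment> \<open>The radial retraction onto the closed disc of radius \<open>k\<close>. With the
    trapezoidal cutoff \<open>\<theta> k\<close> it confines values and support at once.\<close>
  define P where "P k z = (real k / max (real k) (cmod z)) *\<^sub>R z" for k :: nat and z :: complex
  define \<theta> where "\<theta> k x = max 0 (min 1 (real k + 1 - \<bar>x\<bar>))" for k :: nat and x :: real
  have \<theta>c: "continuous_on UNIV (\<theta> k)" for k unfolding \<theta>_def by (intro continuous_intros)
  have \<theta>b: "0 \<le> \<theta> k x" "\<theta> k x \<le> 1" for k x unfolding \<theta>_def by auto
  have \<theta>s: "\<theta> k x = 0" if "\<bar>x\<bar> > real k + 1" for k x using that unfolding \<theta>_def by auto
  have Pc: "continuous_on UNIV (P k)" if "k > 0" for k unfolding P_def using that clamp_cont[of "real k"] by simp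
  have Pb: "cmod (P k z) \<le> real k" "cmod (P k z) \<le> cmod z" for k z
  proof -
    show "cmod (P k z) \<le> real k"
    proof (cases "cmod z = 0")
      case False
      then have "max (real k) (cmod z) > 0" by (simp add: less_max_iff_disj)
      moreover have "real k * cmod z \<le> real k * max (real k) (cmod z)" by (intro mult_left_mono) auto
      ultimately show ?thesis by (simp add: P_def field_simps)
    qed (simp add: P_def)
    have "real k / max (real k) (cmod z) \<le> 1" by (auto simp: divide_le_eq_1 max_def)
    then have "\<bar>real k / max (real k) (cmod z)\<bar> * cmod z \<le> 1 * cmod z"
      by (intro mult_right_mono) (auto simp: max_def)
    then show "cmod (P k z) \<le> cmod z" by (simp add: P_def)
  qed
  have [measurable]: "P k \<in> borel_measurable borel" "\<theta> k \<in> borel_measurable borel" for k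
    unfolding P_def \<theta>_def by measurable
  let ?T = "\<lambda>k x z. \<theta> k x *\<^sub>R P k z"
  have l1: "L2_lim (\<lambda>k x. ?T k x (f x)) f"
  proof (rule L2_lim_dominated)
    show "integrable lborel (\<lambda>t. 4 * (cmod (f t))\<^sup>2)" using L2_integrable[OF f] by simp
    show "AE t in lborel. (\<lambda>n. ?T n t (f t)) \<longlonglongrightarrow> f t"
    proof (intro AE_I2 tendsto_eventually)
      fix t
      have "?T n t (f t) = f t" if n: "real n \<ge> \<bar>t\<bar>" "real n \<ge> cmod (f t) + 1" for n
      proof -
        have "real n > 0" using n(2) norm_ge_zero[of "f t"] by linarith
        then have "P n (f t) = f t" unfolding P_def using n(2) by (simp add: max_def)
        moreover have "\<theta> n t = 1" unfolding \<theta>_def using n by auto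
        ultimately show ?thesis by simp
      qed
      moreover have "\<forall>\<^sub>F n in sequentially. real n \<ge> \<bar>t\<bar>" "\<forall>\<^sub>F n in sequentially. real n \<ge> cmod (f t) + 1"
        using filterlim_real_sequentially by (auto simp: filterlim_at_top)
      ultimately show "\<forall>\<^sub>F n in sequentially. ?T n t (f t) = f t"
        by (auto elim: eventually_elim2)
    qed
    show "(cmod (?T n t (f t) - f t))\<^sup>2 \<le> 4 * (cmod (f t))\<^sup>2" for n t
    proof -
      have "cmod (?T n t (f t) - f t) \<le> cmod (?T n t (f t)) + cmod (f t)"
        by (rule norm_triangle_ineq4)
      also have "cmod (?T n t (f t)) \<le> cmod (f t)"
        using \<theta>b[of n t] Pb(2)[of n "f t"]
        by (auto intro: order_trans[OF mult_left_le_one_le])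
      finally have "(cmod (?T n t (f t) - f t))\<^sup>2 \<le> (2 * cmod (f t))\<^sup>2"
        by (intro power_mono) auto
      then show ?thesis by (simp add: power_mult_distrib)
    qed
  qed measurable
  from LIMSEQ_D[OF l1, of "e/4"] \<open>e > 0\<close> obtain k0 where "\<And>k. k \<ge> k0 \<Longrightarrow> sqnorm (\<lambda>x. ?T k x (f x) - f x) < e / 4"
    by auto
  then obtain k where k: "k > 0" "sqnorm (\<lambda>x. ?T k x (f x) - f x) < e / 4"
    by (metis le_SucI order_refl zero_less_Suc)
  \<comment> \<open>This notion of measurability provides continuous \<open>g n\<close> that
    converge to \<open>f\<close> off a negligible set.\<close>
  have "f measurable_on UNIV"
    using measurable_completion[of f lborel borel]
    by (subst measurable_on_iff_borel_measurable) (auto simp: lebesgue_on_UNIV_eq)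
  then obtain N g where N: "negligible N" and g: "\<And>n. continuous_on UNIV (g n)"
    and lim: "\<And>x. x \<notin> N \<Longrightarrow> (\<lambda>n. g n x) \<longlonglongrightarrow> f x"
    by (auto simp: measurable_on_def)
  have [measurable]: "g n \<in> borel_measurable borel" for n using g by (rule borel_measurable_continuous_onI)
  have c: "continuous_on UNIV (\<lambda>x. ?T k x (g n x))" for n
    by (intro continuous_on_scaleR \<theta>c continuous_on_compose2[OF Pc[OF k(1)] g]) auto
  have bnd: "cmod (?T k x z) \<le> real k * indicator {- real k - 1..real k + 1} x" for x z
  proof (cases "\<bar>x\<bar> > real k + 1")
    case False
    then have "indicator {- real k - 1..real k + 1} x = (1::real)" by (auto simp: indicator_def)
    moreover have "cmod (?T k x z) \<le> 1 * real k"
      using \<theta>b[of k x] Pb(1)[of k z] by (simp only: norm_scaleR) (intro mult_mono, auto)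
    ultimately show ?thesis by simp
  qed (simp add: \<theta>s)
  have bnd2: "(cmod (?T k x z))\<^sup>2 \<le> (real k)\<^sup>2 * indicator {- real k - 1..real k + 1} x" for x z
    using power_mono[OF bnd[of x z], of 2] by (cases "x \<in> {- real k - 1..real k + 1}") (simp_all only: indicator_simps power_mult_distrib, simp_all)
  have cL: "(\<lambda>x. ?T k x (g n x)) \<in> L2" for n
    by (rule L2_bound[OF _ _ bnd2]) auto
  have fL: "(\<lambda>x. ?T k x (f x)) \<in> L2"
    by (rule L2_bound[OF _ _ bnd2]) auto
  have l2: "L2_lim (\<lambda>n x. ?T k x (g n x)) (\<lambda>x. ?T k x (f x))"
  proof (rule L2_lim_dominated)
    show "integrable lborel (\<lambda>x. 4 * ((real k)\<^sup>2 * indicator {- real k - 1..real k + 1} x))" by simp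
    have "AE x in lebesgue. x \<notin> N" using N by (intro AE_not_in) (simp add: negligible_iff_null_sets)
    then have "AE x in lborel. x \<notin> N" by (simp add: AE_completion_iff)
    then show "AE x in lborel. (\<lambda>n. ?T k x (g n x)) \<longlonglongrightarrow> ?T k x (f x)"
    proof eventually_elim
      case (elim x)
      have "isCont (P k) (f x)" using Pc[OF k(1)] by (simp add: continuous_on_eq_continuous_at)
      from isCont_tendsto_compose[OF this lim[OF elim]] show ?case by (intro tendsto_intros)
    qed
    show "(cmod (?T k x (g n x) - ?T k x (f x)))\<^sup>2 \<le> 4 * ((real k)\<^sup>2 * indicator {- real k - 1..real k + 1} x)" for n x
      using norm_add_sq_le[of "?T k x (g n x)" "- (?T k x (f x))"] bnd2[of x "g n x"] bnd2[of x "f x"]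
      by simp
  qed measurable
  from LIMSEQ_D[OF l2, of "e/4"] \<open>e > 0\<close> obtain n where
    n: "sqnorm (\<lambda>x. ?T k x (g n x) - ?T k x (f x)) < e / 4" by auto
  show thesis
  proof (rule that[of "\<lambda>x. ?T k x (g n x)"])
    show "bounded (range (\<lambda>x. ?T k x (g n x)))"
    proof (rule boundedI[of _ "real k"])
      fix z assume "z \<in> range (\<lambda>x. ?T k x (g n x))"
      then obtain x where z: "z = ?T k x (g n x)" by auto
      have "real k * indicator {- real k - 1..real k + 1} x \<le> real k" by (simp add: indicator_def)
      then show "cmod z \<le> real k" unfolding z by (rule order_trans[OF bnd])
    qed
    show "sqnorm (\<lambda>t. f t - ?T k t (g n t)) < e"
      using sqnorm_triangle[OF f fL cL[of n]] k(2) n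
        sqnorm_minus_commute[of f "\<lambda>x. ?T k x (f x)"]
        sqnorm_minus_commute[of "\<lambda>x. ?T k x (f x)" "\<lambda>x. ?T k x (g n x)"]
      by linarith
  qed (use c cL in auto)
qed

section \<open>Autocorrelation and Gaussian regularisation\<close>

definition autocorr :: "(real \<Rightarrow> complex) \<Rightarrow> real \<Rightarrow> complex" where
  "autocorr f t = (\<integral>y. f (y + t) * cnj (f y) \<partial>lborel)"

lemma autocorr_measurable [measurable]:
  assumes [measurable]: "f \<in> borel_measurable borel"
  shows "autocorr f \<in> borel_measurable borel"
  unfolding autocorr_def[abs_def] by measurable

lemma autocorr_0: "autocorr f 0 = complex_of_real (sqnorm f)"
  using L2_inner_self[of f] by (simp add: autocorr_def L2_inner_def)

lemma cmod_autocorr_le: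
  assumes "f \<in> L2" shows "cmod (autocorr f t) \<le> sqnorm f"
proof -
  have "(cmod (autocorr f t))\<^sup>2 \<le> sqnorm f * sqnorm f"
    unfolding autocorr_def
    using L2_Cauchy_Schwarz[OF L2_shift(1)[OF assms, of t] L2_cnj[OF assms]] L2_shift(2)[OF assms, of t] by simp
  then show ?thesis by (metis power2_eq_square power2_le_imp_le sqnorm_nonneg)
qed

text \<open>Continuity at 0. Only the translated factor is replaced by a bounded continuous
  \<open>c\<close>; the other one stays and, being integrable, provides the majorant
  \<open>B * cmod (f y)\<close>.\<close>

lemma autocorr_tendsto:
  assumes f: "f \<in> L2" "integrable lborel f" and s: "s \<longlonglongrightarrow> 0"
  shows "(\<lambda>n. autocorr f (s n)) \<longlonglongrightarrow> complex_of_real (sqnorm f)"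
proof (rule LIMSEQ_I)
  fix e :: real assume e: "e > 0"
  note [measurable] = L2_measurable[OF f(1)]
  \<comment> \<open>Chosen so that Cauchy-Schwarz keeps the square of the replacement error below
    \<open>(e / 3)\<^sup>2\<close>; the summand 1 covers \<open>sqnorm f = 0\<close>.\<close>
  define \<delta> where "\<delta> = (e / 3)\<^sup>2 / (sqnorm f + 1)"
  have p: "sqnorm f + 1 > 0" using sqnorm_nonneg[of f] by linarith
  then have \<delta>: "\<delta> > 0" unfolding \<delta>_def using e by (intro divide_pos_pos) auto
  obtain c where c: "continuous_on UNIV c" "bounded (range c)" "c \<in> L2" "sqnorm (\<lambda>t. f t - c t) < \<delta>"
    using L2_approx_continuous[OF f(1) \<delta>] .
  note [measurable] = L2_measurable[OF c(3)]
  obtain B where B: "\<And>x. cmod (c x) \<le> B" using c(2) by (auto simp: bounded_iff)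
  define T where "T t = (\<integral>y. c (y + t) * cnj (f y) \<partial>lborel)" for t
  have close: "cmod (autocorr f t - T t) < e / 3" for t
  proof -
    have d: "(\<lambda>y. f y - c y) \<in> L2" using f c by auto
    have "autocorr f t - T t = (\<integral>y. (f (y + t) - c (y + t)) * cnj (f y) \<partial>lborel)"
      unfolding autocorr_def T_def
      using L2_integrable_mult[OF L2_shift(1)[OF f(1), of t] L2_cnj[OF f(1)]]
        L2_integrable_mult[OF L2_shift(1)[OF c(3), of t] L2_cnj[OF f(1)]]
      by (simp add: left_diff_distrib)
    then have "(cmod (autocorr f t - T t))\<^sup>2 \<le> sqnorm (\<lambda>t. f t - c t) * sqnorm f"
      using L2_Cauchy_Schwarz[OF L2_shift(1)[OF d, of t] L2_cnj[OF f(1)]] L2_shift(2)[OF d, of t] by simp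
    also have "\<dots> \<le> \<delta> * sqnorm f" using c(4) by (intro mult_right_mono) auto
    also have "\<dots> < \<delta> * (sqnorm f + 1)" using \<delta> by simp
    also have "\<dots> = (e / 3)\<^sup>2" using p by (simp add: \<delta>_def)
    finally show ?thesis using e by (intro power2_less_imp_less[of _ "e/3"]) auto
  qed
  have "(\<lambda>n. T (s n)) \<longlonglongrightarrow> T 0"
    unfolding T_def
  proof (rule integral_dominated_convergence[where w = "\<lambda>y. B * cmod (f y)"])
    show "integrable lborel (\<lambda>y. B * cmod (f y))" using f(2) by simp
    show "AE y in lborel. (\<lambda>n. c (y + s n) * cnj (f y)) \<longlonglongrightarrow> c (y + 0) * cnj (f y)"
    proof (intro AE_I2 tendsto_mult tendsto_const)
      fix y
      have "isCont c (y + 0)" using c(1) by (simp add: continuous_on_eq_continuous_at)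
      then show "(\<lambda>n. c (y + s n)) \<longlonglongrightarrow> c (y + 0)"
        by (rule isCont_tendsto_compose) (intro tendsto_intros s)
    qed
    show "AE y in lborel. cmod (c (y + s n) * cnj (f y)) \<le> B * cmod (f y)" for n
      by (intro AE_I2) (auto simp: norm_mult intro!: mult_right_mono B)
  qed measurable
  from LIMSEQ_D[OF this, of "e/3"] e obtain M where M: "\<And>n. n \<ge> M \<Longrightarrow> cmod (T (s n) - T 0) < e / 3" by auto
  show "\<exists>no. \<forall>n\<ge>no. cmod (autocorr f (s n) - complex_of_real (sqnorm f)) < e"
  proof (intro exI[of _ M] allI impI)
    fix n assume n: "n \<ge> M"
    have "cmod (autocorr f (s n) - autocorr f 0) = cmod ((autocorr f (s n) - T (s n)) + (T (s n) - T 0) - (autocorr f 0 - T 0))" by simp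
    then have "cmod (autocorr f (s n) - autocorr f 0) \<le> cmod (autocorr f (s n) - T (s n)) + cmod (T (s n) - T 0) + cmod (autocorr f 0 - T 0)"
      using norm_triangle_ineq4[of "(autocorr f (s n) - T (s n)) + (T (s n) - T 0)" "autocorr f 0 - T 0"]
        norm_triangle_ineq[of "autocorr f (s n) - T (s n)" "T (s n) - T 0"] by linarith
    then show "cmod (autocorr f (s n) - complex_of_real (sqnorm f)) < e"
      using close[of "s n"] close[of 0] M[OF n] by (simp add: autocorr_0)
  qed
qed

text \<open>The autocorrelation is the convolution of \<open>f\<close> with its reflected conjugate,
  so its transform is a squared modulus. The bilinear multiplication formula, applied to it, yields
  a quadratic expression in \<open>fourier f\<close>.\<close>

lemma autocorr_fourier:
  assumes f: "integrable lborel f"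
  shows "integrable lborel (autocorr f)" "fourier (autocorr f) \<xi> = complex_of_real ((cmod (fourier f \<xi>))\<^sup>2)"
proof -
  have [measurable]: "f \<in> borel_measurable borel" using f by (auto dest: borel_measurable_integrable)
  have sh: "integrable lborel (\<lambda>t. f (y + t))" for y
    using lborel_integrable_real_affine[OF f, of 1 y] by simp
  have nsh: "(\<integral>t. cmod (f (y + t)) \<partial>lborel) = (\<integral>t. cmod (f t) \<partial>lborel)" for y
    using lborel_integral_real_affine[of 1 "\<lambda>t. cmod (f t)" y] by simp
  have I: "integrable (lborel \<Otimes>\<^sub>M lborel) (\<lambda>(y, t). f (y + t) * cnj (f y) * chi \<xi> t)" for \<xi>
  proof (rule lborel_pair.Fubini_integrable)
    show "integrable lborel (\<lambda>y. \<integral>t. cmod (case (y, t) of (y, t) \<Rightarrow> f (y + t) * cnj (f y) * chi \<xi> t) \<partial>lborel)"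
      using f by (simp add: norm_mult nsh)
    show "AE y in lborel. integrable lborel (\<lambda>t. case (y, t) of (y, t) \<Rightarrow> f (y + t) * cnj (f y) * chi \<xi> t)"
      using integrable_chi[OF sh] by (intro AE_I2) (simp add: mult.commute[of _ "cnj _"] mult.assoc)
  qed measurable
  \<comment> \<open>At frequency 0 the character is 1, so the integrability on the plane contains
    this claim.\<close>
  show "integrable lborel (autocorr f)"
    using lborel_pair.integrable_snd[of "\<lambda>y t. f (y + t) * cnj (f y) * chi 0 t"] I[of 0]
    by (simp add: autocorr_def[abs_def])
  have "fourier (autocorr f) \<xi> = (\<integral>t. (\<integral>y. f (y + t) * cnj (f y) * chi \<xi> t \<partial>lborel) \<partial>lborel)"
    by (simp add: fourier_chi autocorr_def)
  also have "\<dots> = (\<integral>y. (\<integral>t. f (y + t) * cnj (f y) * chi \<xi> t \<partial>lborel) \<partial>lborel)"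
    by (rule lborel_pair.Fubini_integral[OF I])
  also have "\<dots> = (\<integral>y. fourier f \<xi> * cnj (f y * chi \<xi> y) \<partial>lborel)"
  proof (intro Bochner_Integration.integral_cong refl)
    fix y
    have "fourier f \<xi> = (\<integral>t. f (y + t) * chi \<xi> (y + t) \<partial>lborel)"
      unfolding fourier_chi using lborel_integral_real_affine[of 1 "\<lambda>t. f t * chi \<xi> t" y] by simp
    also have "\<dots> = chi \<xi> y * (\<integral>t. f (y + t) * chi \<xi> t \<partial>lborel)"
      by (simp add: chi_add mult.left_commute)
    finally have "fourier f \<xi> * cnj (f y * chi \<xi> y)
        = (chi \<xi> y * chi \<xi> (- y)) * (cnj (f y) * (\<integral>t. f (y + t) * chi \<xi> t \<partial>lborel))"
      by (simp only: complex_cnj_mult cnj_chi mult_ac)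
    then have "fourier f \<xi> * cnj (f y * chi \<xi> y) = cnj (f y) * (\<integral>t. f (y + t) * chi \<xi> t \<partial>lborel)"
      by (simp only: chi_mult_uminus mult_1)
    moreover have "(\<integral>t. f (y + t) * cnj (f y) * chi \<xi> t \<partial>lborel) = (\<integral>t. cnj (f y) * (f (y + t) * chi \<xi> t) \<partial>lborel)"
      by (simp only: mult_ac)
    ultimately show "(\<integral>t. f (y + t) * cnj (f y) * chi \<xi> t \<partial>lborel) = fourier f \<xi> * cnj (f y * chi \<xi> y)"
      by (simp only: integral_mult_right_zero)
  qed
  also have "\<dots> = fourier f \<xi> * cnj (fourier f \<xi>)"
    unfolding fourier_chi[of f] by (simp del: complex_cnj_mult)
  finally show "fourier (autocorr f) \<xi> = complex_of_real ((cmod (fourier f \<xi>))\<^sup>2)"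
    by (simp only: complex_norm_square)
qed

text \<open>Not normalised by \<open>\<epsilon>\<close>: as \<open>\<epsilon>\<close> decreases to 0
  it increases to the constant \<open>std_normal_density 0\<close>, so it acts as a convergence
  factor rather than as an approximate identity.\<close>

definition gauss :: "real \<Rightarrow> real \<Rightarrow> complex" where
  "gauss \<epsilon> x = complex_of_real (std_normal_density (\<epsilon> * x))"

lemma gauss_measurable [measurable]: "gauss \<epsilon> \<in> borel_measurable borel"
  unfolding gauss_def[abs_def] by measurable

lemma integrable_gauss: "\<epsilon> \<noteq> 0 \<Longrightarrow> integrable lborel (gauss \<epsilon>)"
  unfolding gauss_def[abs_def]
  using lborel_integrable_real_affine[OF integrable_normal_density[of 1 0], of \<epsilon> 0] by simp

text \<open>The characteristic function of the standard normal law, read at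
  \<open>- (2 * pi * \<xi>)\<close>.\<close>

lemma fourier_gauss_1: "fourier (gauss 1) \<xi> = complex_of_real (sqrt (2 * pi)) * gauss (2 * pi) \<xi>"
proof -
  have "fourier (gauss 1) \<xi> = (\<integral>x. std_normal_density x *\<^sub>R iexp (- (2 * pi * \<xi>) * x) \<partial>lborel)"
    by (simp add: fourier_chi gauss_def chi_cis cis_conv_exp scaleR_conv_of_real)
  also have "\<dots> = char std_normal_distribution (- (2 * pi * \<xi>))"
    unfolding char_def by (subst integral_density) auto
  also have "\<dots> = complex_of_real (exp (- ((2 * pi * \<xi>)\<^sup>2) / 2))"
    by (simp add: char_std_normal_distribution)
  finally show ?thesis
    unfolding gauss_def std_normal_density_def of_real_mult[symmetric] of_real_eq_iff by simp
qed

lemma fourier_gauss: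
  assumes "\<epsilon> > 0" shows "fourier (gauss \<epsilon>) \<xi> = complex_of_real (1 / \<epsilon>) * fourier (gauss 1) (\<xi> / \<epsilon>)"
proof -
  have "fourier (gauss 1) (\<xi> / \<epsilon>) = \<bar>\<epsilon>\<bar> *\<^sub>R (\<integral>x. gauss 1 (0 + \<epsilon> * x) * chi (\<xi> / \<epsilon>) (0 + \<epsilon> * x) \<partial>lborel)"
    unfolding fourier_chi using assms by (intro lborel_integral_real_affine) auto
  also have "\<dots> = complex_of_real \<epsilon> * fourier (gauss \<epsilon>) \<xi>"
    using assms by (simp add: fourier_chi gauss_def chi_cis scaleR_conv_of_real mult.assoc)
  finally show ?thesis using assms by simp
qed

text \<open>Fourier inversion for the Gaussian at the point 0. It makes the constants on both sides
  of the Plancherel limit agree.\<close>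

lemma integral_fourier_gauss: "(\<integral>\<xi>. fourier (gauss 1) \<xi> \<partial>lborel) = gauss 1 0"
proof -
  have "(\<integral>\<xi>. gauss 1 \<xi> \<partial>lborel) = (2 * pi) *\<^sub>R (\<integral>\<xi>. gauss (2 * pi) \<xi> \<partial>lborel)"
    using lborel_integral_real_affine[of "2 * pi" "gauss 1" 0] by (simp add: gauss_def)
  moreover have "(\<integral>\<xi>. gauss 1 \<xi> \<partial>lborel) = 1"
    unfolding gauss_def using integral_normal_density[of 1 0] by simp
  ultimately have "(\<integral>\<xi>. gauss (2 * pi) \<xi> \<partial>lborel) = complex_of_real (1 / (2 * pi))"
    by (simp add: scaleR_conv_of_real field_simps)
  then have "(\<integral>\<xi>. fourier (gauss 1) \<xi> \<partial>lborel) = complex_of_real (sqrt (2 * pi) / (2 * pi))"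
    unfolding fourier_gauss_1[abs_def] by simp
  also have "sqrt (2 * pi) / (2 * pi) = 1 / sqrt (2 * pi)"
    by (simp add: divide_simps)
  also have "complex_of_real (1 / sqrt (2 * pi)) = gauss 1 0"
    by (simp add: gauss_def std_normal_density_def)
  finally show ?thesis .
qed

text \<open>Damped by a Gaussian, the integral of \<open>(cmod (fourier f \<xi>))\<^sup>2\<close>
  equals an average of \<open>autocorr f\<close> near 0. Removing the damping yields
  \<open>autocorr f 0\<close>, that is \<open>sqnorm f\<close>, by dominated convergence on one side
  and monotone convergence on the other.\<close>

theorem plancherel_L1:
  assumes f: "f \<in> L2" "integrable lborel f"
  shows "fourier f \<in> L2" "sqnorm (fourier f) = sqnorm f"
proof -
  note [measurable] = L2_measurable[OF f(1)]
  define \<epsilon> where "\<epsilon> n = inverse (real (Suc n))" for n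
  have \<epsilon>: "\<epsilon> n > 0" for n by (simp add: \<epsilon>_def)
  have \<epsilon>0: "\<epsilon> \<longlonglongrightarrow> 0" unfolding \<epsilon>_def[abs_def] by (rule LIMSEQ_inverse_real_of_nat)
  have \<epsilon>mono: "m \<le> n \<Longrightarrow> \<epsilon> n \<le> \<epsilon> m" for m n by (simp add: \<epsilon>_def)
  define w where "w n \<xi> = (cmod (fourier f \<xi>))\<^sup>2 * std_normal_density (\<epsilon> n * \<xi>)" for n \<xi>
  have wmeas [measurable]: "w n \<in> borel_measurable borel" for n unfolding w_def by measurable
  \<comment> \<open>The transform of an integrable function is bounded, so the Gaussian ensures
    integrability.\<close>
  have wint: "integrable lborel (w n)" for n
  proof -
    have "integrable lborel (\<lambda>\<xi>. gauss (\<epsilon> n) \<xi> * complex_of_real ((cmod (fourier f \<xi>))\<^sup>2))"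
    proof (rule integrable_mult_bounded[where B = "(\<integral>x. cmod (f x) \<partial>lborel)\<^sup>2"])
      show "cmod (complex_of_real ((cmod (fourier f x))\<^sup>2)) \<le> (\<integral>x. cmod (f x) \<partial>lborel)\<^sup>2" for x
        using cmod_fourier_le[OF f(2)] by (simp add: norm_power power_mono)
    qed (use \<epsilon>[of n] integrable_gauss[of "\<epsilon> n"] in auto)
    from integrable_Re[OF this] show ?thesis by (simp add: gauss_def w_def[abs_def] mult.commute)
  qed
  \<comment> \<open>The multiplication formula moves the transform onto the Gaussian, and rescaling
    by \<open>\<epsilon> n\<close> moves the parameter into the argument of
    \<open>autocorr f\<close>, where the limit can be taken.\<close>
  have step: "complex_of_real (\<integral>\<xi>. w n \<xi> \<partial>lborel) = (\<integral>t. fourier (gauss 1) t * autocorr f (\<epsilon> n * t) \<partial>lborel)" for n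
  proof -
    have "complex_of_real (\<integral>\<xi>. w n \<xi> \<partial>lborel) = (\<integral>\<xi>. fourier (autocorr f) \<xi> * gauss (\<epsilon> n) \<xi> \<partial>lborel)"
      by (simp add: autocorr_fourier(2)[OF f(2)] gauss_def w_def flip: integral_complex_of_real)
    also have "\<dots> = (\<integral>t. autocorr f t * fourier (gauss (\<epsilon> n)) t \<partial>lborel)"
      using \<epsilon>[of n] by (intro fourier_mult_formula autocorr_fourier f integrable_gauss) auto
    also have "\<dots> = \<bar>\<epsilon> n\<bar> *\<^sub>R (\<integral>t. autocorr f (0 + \<epsilon> n * t) * fourier (gauss (\<epsilon> n)) (0 + \<epsilon> n * t) \<partial>lborel)"
      using \<epsilon>[of n] by (intro lborel_integral_real_affine) auto
    also have "\<dots> = (\<integral>t. fourier (gauss 1) t * autocorr f (\<epsilon> n * t) \<partial>lborel)"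
      using \<epsilon>[of n] fourier_gauss[OF \<epsilon>[of n]]
      by (simp add: scaleR_conv_of_real mult.commute mult.left_commute)
    finally show ?thesis .
  qed
  have ifg: "integrable lborel (fourier (gauss 1))"
    unfolding fourier_gauss_1[abs_def] by (intro integrable_mult_right integrable_gauss) simp
  have "(\<lambda>n. complex_of_real (\<integral>\<xi>. w n \<xi> \<partial>lborel)) \<longlonglongrightarrow> (\<integral>t. fourier (gauss 1) t * complex_of_real (sqnorm f) \<partial>lborel)"
    unfolding step
  proof (rule integral_dominated_convergence[where w = "\<lambda>t. sqnorm f * cmod (fourier (gauss 1) t)"])
    show "integrable lborel (\<lambda>t. sqnorm f * cmod (fourier (gauss 1) t))" using ifg by simp
    show "AE t in lborel. (\<lambda>n. fourier (gauss 1) t * autocorr f (\<epsilon> n * t)) \<longlonglongrightarrow> fourier (gauss 1) t * complex_of_real (sqnorm f)"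
    proof (intro AE_I2 tendsto_mult tendsto_const autocorr_tendsto f)
      show "(\<lambda>n. \<epsilon> n * t) \<longlonglongrightarrow> 0" for t using tendsto_mult_right[OF \<epsilon>0, of t] by simp
    qed
    show "AE t in lborel. cmod (fourier (gauss 1) t * autocorr f (\<epsilon> n * t)) \<le> sqnorm f * cmod (fourier (gauss 1) t)" for n
      unfolding norm_mult mult.commute[of "cmod (fourier _ _)"]
      by (intro AE_I2 mult_right_mono cmod_autocorr_le f) simp
  qed measurable
  then have "(\<lambda>n. complex_of_real (\<integral>\<xi>. w n \<xi> \<partial>lborel)) \<longlonglongrightarrow> complex_of_real (std_normal_density 0 * sqnorm f)"
    by (simp add: integral_fourier_gauss gauss_def)
  then have lim1: "(\<lambda>n. ennreal (\<integral>\<xi>. w n \<xi> \<partial>lborel)) \<longlonglongrightarrow> ennreal (std_normal_density 0 * sqnorm f)"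
    by (intro tendsto_ennrealI) (simp only: tendsto_of_real_iff)
  \<comment> \<open>Monotone convergence with values in \<open>ennreal\<close>, because finiteness
    of the limit is part of the claim.\<close>
  have "(\<lambda>n. \<integral>\<^sup>+\<xi>. ennreal (w n \<xi>) \<partial>lborel) \<longlonglongrightarrow> (\<integral>\<^sup>+\<xi>. ennreal ((cmod (fourier f \<xi>))\<^sup>2 * std_normal_density 0) \<partial>lborel)"
  proof (rule nn_integral_LIMSEQ)
    show "incseq (\<lambda>n x. ennreal (w n x))"
    proof (intro incseq_SucI le_funI ennreal_leI)
      fix n \<xi>
      have "(\<epsilon> (Suc n) * \<xi>)\<^sup>2 \<le> (\<epsilon> n * \<xi>)\<^sup>2"
        using \<epsilon>mono[of n "Suc n"] \<epsilon>[of "Suc n"] unfolding power_mult_distrib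
        by (intro mult_right_mono power_mono) auto
      then have "std_normal_density (\<epsilon> n * \<xi>) \<le> std_normal_density (\<epsilon> (Suc n) * \<xi>)"
        unfolding std_normal_density_def by (intro mult_left_mono) auto
      then show "w n \<xi> \<le> w (Suc n) \<xi>" unfolding w_def by (intro mult_left_mono) auto
    qed
    show "(\<lambda>n. ennreal (w n x)) \<longlonglongrightarrow> ennreal ((cmod (fourier f x))\<^sup>2 * std_normal_density 0)" for x
    proof (intro tendsto_ennrealI)
      have "(\<lambda>n. (cmod (fourier f x))\<^sup>2 * (1 / sqrt (2 * pi) * exp (- (\<epsilon> n * x)\<^sup>2 / 2))) \<longlonglongrightarrow>
          (cmod (fourier f x))\<^sup>2 * (1 / sqrt (2 * pi) * exp (- (0 * x)\<^sup>2 / 2))"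
        by (intro tendsto_intros \<epsilon>0) auto
      then show "(\<lambda>n. w n x) \<longlonglongrightarrow> (cmod (fourier f x))\<^sup>2 * std_normal_density 0"
        by (simp add: w_def std_normal_density_def)
    qed
  qed measurable
  moreover have "(\<integral>\<^sup>+\<xi>. ennreal (w n \<xi>) \<partial>lborel) = ennreal (\<integral>\<xi>. w n \<xi> \<partial>lborel)" for n
    by (intro nn_integral_eq_integral wint) (simp add: w_def)
  ultimately have "(\<integral>\<^sup>+\<xi>. ennreal ((cmod (fourier f \<xi>))\<^sup>2 * std_normal_density 0) \<partial>lborel) = ennreal (std_normal_density 0 * sqnorm f)"
    using lim1 by (auto intro: LIMSEQ_unique)
  moreover have pos: "std_normal_density 0 > 0" by (simp add: normal_density_pos)
  moreover have "ennreal (std_normal_density 0) * (\<integral>\<^sup>+\<xi>. ennreal ((cmod (fourier f \<xi>))\<^sup>2) \<partial>lborel)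
      = (\<integral>\<^sup>+\<xi>. ennreal ((cmod (fourier f \<xi>))\<^sup>2 * std_normal_density 0) \<partial>lborel)"
    using pos by (subst nn_integral_cmult[symmetric]) (auto simp: ennreal_mult mult.commute)
  ultimately have "ennreal (std_normal_density 0) * (\<integral>\<^sup>+\<xi>. ennreal ((cmod (fourier f \<xi>))\<^sup>2) \<partial>lborel) = ennreal (std_normal_density 0) * ennreal (sqnorm f)"
    by (simp add: ennreal_mult)
  then have eq: "(\<integral>\<^sup>+\<xi>. ennreal ((cmod (fourier f \<xi>))\<^sup>2) \<partial>lborel) = ennreal (sqnorm f)"
    using pos by (simp add: ennreal_mult_cancel_left)
  show L: "fourier f \<in> L2" by (rule L2_nn_integral(1)[of _ "sqnorm f"]) (simp_all add: eq)
  show "sqnorm (fourier f) = sqnorm f" using eq by (simp add: sqnorm_nn_integral[OF L])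
qed

lemma polarization:
  assumes "f \<in> L2" "g \<in> L2" "F \<in> L2" "G \<in> L2"
    and "\<And>c. sqnorm (\<lambda>t. F t + c * G t) = sqnorm (\<lambda>t. f t + c * g t)"
  shows "L2_inner F G = L2_inner f g"
proof -
  have s: "sqnorm F + (cmod c)\<^sup>2 * sqnorm G + 2 * Re (cnj c * L2_inner F G)
      = sqnorm f + (cmod c)\<^sup>2 * sqnorm g + 2 * Re (cnj c * L2_inner f g)" for c
    using assms(5)[of c] sqnorm_expand[OF assms(1,2), of c] sqnorm_expand[OF assms(3,4), of c] by simp
  \<comment> \<open>\<open>c = 1\<close> against \<open>c = -1\<close> isolates the real part,
    \<open>c = \<i>\<close> against \<open>c = -\<i>\<close> the imaginary part.\<close>
  have "Re (L2_inner F G) = Re (L2_inner f g)" "Im (L2_inner F G) = Im (L2_inner f g)"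
    using s[of 0] s[of 1] s[of "-1"] s[of \<i>] s[of "-\<i>"] by simp_all
  then show ?thesis by (simp add: complex_eq_iff)
qed

corollary parseval_L1:
  assumes "f \<in> L2" "integrable lborel f" "g \<in> L2" "integrable lborel g"
  shows "L2_inner (fourier f) (fourier g) = L2_inner f g"
proof (rule polarization)
  fix c
  have "sqnorm (fourier (\<lambda>t. f t + c * g t)) = sqnorm (\<lambda>t. f t + c * g t)"
    using assms by (intro plancherel_L1) auto
  moreover have "fourier (\<lambda>t. f t + c * g t) = (\<lambda>t. fourier f t + c * fourier g t)"
    using assms by (intro ext fourier_add)
  ultimately show "sqnorm (\<lambda>t. fourier f t + c * fourier g t) = sqnorm (\<lambda>t. f t + c * g t)" by simp
qed (use assms plancherel_L1 in auto)

section \<open>Fourier--Plancherel transform\<close>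

lemma trunc_measurable [measurable]:
  "f \<in> borel_measurable borel \<Longrightarrow> trunc f n \<in> borel_measurable borel"
  unfolding trunc_def by measurable

lemma fourier_trunc_L2: "f \<in> L2 \<Longrightarrow> fourier (trunc f n) \<in> L2"
  by (intro plancherel_L1 trunc_L2 trunc_integrable)

lemma sqnorm_fourier_diff:
  assumes "f \<in> L2" "integrable lborel f" "g \<in> L2" "integrable lborel g"
  shows "sqnorm (\<lambda>\<xi>. fourier f \<xi> - fourier g \<xi>) = sqnorm (\<lambda>t. f t - g t)"
proof -
  have "sqnorm (fourier (\<lambda>t. f t - g t)) = sqnorm (\<lambda>t. f t - g t)"
    using assms by (intro plancherel_L1) auto
  moreover have "fourier (\<lambda>t. f t - g t) = (\<lambda>\<xi>. fourier f \<xi> - fourier g \<xi>)"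
    using assms by (intro ext fourier_diff)
  ultimately show ?thesis by simp
qed

text \<open>The definition measures distance by a nonnegative integral, which might be infinite.
  Plancherel on truncations makes it finite, and from here on the real-valued \<open>sqnorm\<close>
  takes over.\<close>

lemma has_fourier_L2_iff:
  "has_fourier_L2 f F \<longleftrightarrow> f \<in> L2 \<and> F \<in> L2 \<and> L2_lim (\<lambda>n. fourier (trunc f n)) F"
proof -
  have "(\<integral>\<^sup>+\<xi>. ennreal ((cmod (fourier (trunc f n) \<xi> - F \<xi>))\<^sup>2) \<partial>lborel) =
      ennreal (sqnorm (\<lambda>\<xi>. fourier (trunc f n) \<xi> - F \<xi>))" if "f \<in> L2" "F \<in> L2" for n
    using sqnorm_nn_integral[OF L2_diff[OF fourier_trunc_L2[OF that(1)] that(2)]] .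
  then show ?thesis
    unfolding has_fourier_L2_def trunc_def[symmetric]
    by (auto simp: tendsto_ennreal_iff[where x = 0, simplified])
qed

lemma has_fourier_L2_dest:
  assumes "has_fourier_L2 f F"
  shows "f \<in> L2" "F \<in> L2" "L2_lim (\<lambda>n. fourier (trunc f n)) F"
  using assms by (auto simp: has_fourier_L2_iff)

text \<open>The transform may be computed along any approximants that are integrable and square
  integrable. Atoms need this freedom: an atom built from a truncated window is not a truncation of
  the atom.\<close>

lemma has_fourier_L2_approx:
  assumes g: "\<And>n. g n \<in> L2" "\<And>n. integrable lborel (g n)" and f: "f \<in> L2" and F: "F \<in> L2"
    and lim: "L2_lim g f" "L2_lim (\<lambda>n. fourier (g n)) F"
  shows "has_fourier_L2 f F"
proof -
  have "(\<lambda>n. sqnorm (\<lambda>t. trunc f n t - g n t)) \<longlonglongrightarrow> 0"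
  proof (rule real_tendsto_sandwich[where f = "\<lambda>_. 0"])
    show "\<forall>\<^sub>F n in sequentially. sqnorm (\<lambda>t. trunc f n t - g n t) \<le> 2 * sqnorm (\<lambda>t. trunc f n t - f t) + 2 * sqnorm (\<lambda>t. g n t - f t)"
      using sqnorm_triangle[OF trunc_L2[OF f] f g(1)]
      by (intro always_eventually allI) (simp add: sqnorm_minus_commute[of f "g _"])
    show "(\<lambda>n. 2 * sqnorm (\<lambda>t. trunc f n t - f t) + 2 * sqnorm (\<lambda>t. g n t - f t)) \<longlonglongrightarrow> 0"
      using tendsto_add[OF tendsto_mult_left[OF trunc_lim[OF f], of 2] tendsto_mult_left[OF lim(1), of 2]] by simp
  qed auto
  then have "(\<lambda>n. sqnorm (\<lambda>\<xi>. fourier (trunc f n) \<xi> - fourier (g n) \<xi>)) \<longlonglongrightarrow> 0"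
    by (subst sqnorm_fourier_diff) (auto intro: trunc_L2 trunc_integrable f g)
  then have "L2_lim (\<lambda>n. fourier (trunc f n)) F"
    by (rule L2_lim_triangle[OF plancherel_L1(1)[OF g] F fourier_trunc_L2[OF f] lim(2)])
  then show ?thesis using f F by (simp add: has_fourier_L2_iff)
qed

text \<open>The truncations form a Cauchy sequence, the transform is isometric on them, and the
  space is complete.\<close>

lemma has_fourier_L2_exists:
  assumes f: "f \<in> L2" obtains F where "has_fourier_L2 f F"
proof (rule L2_complete[of "\<lambda>n. fourier (trunc f n)"])
  fix e :: real assume "e > 0"
  with LIMSEQ_D[OF trunc_lim[OF f], of "e/4"] obtain M where
    M: "\<And>n. n \<ge> M \<Longrightarrow> sqnorm (\<lambda>t. trunc f n t - f t) < e / 4" by auto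
  show "\<exists>M. \<forall>m\<ge>M. \<forall>n\<ge>M. sqnorm (\<lambda>t. fourier (trunc f m) t - fourier (trunc f n) t) < e"
  proof (intro exI[of _ M] allI impI)
    fix m n assume mn: "m \<ge> M" "n \<ge> M"
    show "sqnorm (\<lambda>t. fourier (trunc f m) t - fourier (trunc f n) t) < e"
      using sqnorm_triangle[OF trunc_L2[OF f, of m] f trunc_L2[OF f, of n]] M[OF mn(1)] M[OF mn(2)]
      by (subst sqnorm_fourier_diff)
         (auto intro: trunc_L2 trunc_integrable f simp: sqnorm_minus_commute[of f "trunc f n"])
  qed
next
  fix F assume "F \<in> L2" "L2_lim (\<lambda>n. fourier (trunc f n)) F"
  then show thesis using f by (intro that) (auto simp: has_fourier_L2_iff)
qed (rule fourier_trunc_L2[OF f])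

lemma has_fourier_L2_unique:
  assumes "has_fourier_L2 f F" "has_fourier_L2 f G" shows "AE \<xi> in lborel. F \<xi> = G \<xi>"
  using assms
  by (intro L2_lim_unique[of "\<lambda>n. fourier (trunc f n)"]) (auto simp: has_fourier_L2_iff fourier_trunc_L2)

lemma parseval_L2:
  assumes "has_fourier_L2 f F" "has_fourier_L2 g G" shows "L2_inner F G = L2_inner f g"
proof (rule LIMSEQ_unique)
  note f = has_fourier_L2_dest[OF assms(1)] and g = has_fourier_L2_dest[OF assms(2)]
  show "(\<lambda>n. L2_inner (fourier (trunc f n)) (fourier (trunc g n))) \<longlonglongrightarrow> L2_inner F G"
    by (intro L2_lim_inner fourier_trunc_L2 f g)
  show "(\<lambda>n. L2_inner (fourier (trunc f n)) (fourier (trunc g n))) \<longlonglongrightarrow> L2_inner f g"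
    using L2_lim_inner[OF trunc_L2 f(1) trunc_L2 g(1) trunc_lim trunc_lim] f g
    by (simp add: parseval_L1 trunc_L2 trunc_integrable)
qed

lemma plancherel_L2: "has_fourier_L2 f F \<Longrightarrow> sqnorm F = sqnorm f"
  using parseval_L2[of f F f F] by (simp add: L2_inner_self)

lemma has_fourier_L2_mult_formula:
  assumes "has_fourier_L2 f F" "has_fourier_L2 g G"
  shows "(\<integral>t. F t * g t \<partial>lborel) = (\<integral>t. f t * G t \<partial>lborel)"
proof (rule LIMSEQ_unique)
  note f = has_fourier_L2_dest[OF assms(1)] and g = has_fourier_L2_dest[OF assms(2)]
  show "(\<lambda>n. \<integral>t. fourier (trunc f n) t * trunc g n t \<partial>lborel) \<longlonglongrightarrow> (\<integral>t. F t * g t \<partial>lborel)"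
    by (intro L2_lim_bilinear fourier_trunc_L2 trunc_L2 trunc_lim f g)
  show "(\<lambda>n. \<integral>t. fourier (trunc f n) t * trunc g n t \<partial>lborel) \<longlonglongrightarrow> (\<integral>t. f t * G t \<partial>lborel)"
    using L2_lim_bilinear[OF trunc_L2 f(1) fourier_trunc_L2 g(2) trunc_lim g(3)] f g
    by (simp add: fourier_mult_formula trunc_integrable)
qed

lemma sqnorm_cong_AE:
  assumes "AE t in lborel. f t = g t" "f \<in> borel_measurable borel" "g \<in> borel_measurable borel"
  shows "sqnorm f = sqnorm g"
  unfolding sqnorm_def using assms by (intro integral_cong_AE) (auto elim: eventually_mono)

lemma L2_cong_AE:
  assumes "f \<in> L2" "g \<in> borel_measurable borel" "AE t in lborel. f t = g t"
  shows "g \<in> L2"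
proof (rule L2I[OF assms(2)])
  note [measurable] = assms(2) L2_measurable[OF assms(1)]
  show "integrable lborel (\<lambda>t. (cmod (g t))\<^sup>2)"
    using assms(3) by (intro integrable_cong_AE_imp[OF L2_integrable[OF assms(1)]]) (auto elim: eventually_mono)
qed

lemma has_fourier_L2_cong_AE:
  assumes "has_fourier_L2 f F" "AE t in lborel. F t = G t" "G \<in> borel_measurable borel"
  shows "has_fourier_L2 f G"
proof -
  note f = has_fourier_L2_dest[OF assms(1)]
  have G: "G \<in> L2" using f(2) assms(3,2) by (rule L2_cong_AE)
  note [measurable] = f(1,2)[THEN L2_measurable] assms(3) fourier_trunc_L2[OF f(1), THEN L2_measurable]
  have "sqnorm (\<lambda>\<xi>. fourier (trunc f n) \<xi> - F \<xi>) = sqnorm (\<lambda>\<xi>. fourier (trunc f n) \<xi> - G \<xi>)" for n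
    using assms(2) by (intro sqnorm_cong_AE) (auto elim: eventually_mono)
  then show ?thesis using f G by (simp add: has_fourier_L2_iff)
qed

lemma has_fourier_L2_cong_AE_left:
  assumes "has_fourier_L2 f F" "AE t in lborel. f t = g t" "g \<in> borel_measurable borel"
  shows "has_fourier_L2 g F"
proof -
  note f = has_fourier_L2_dest[OF assms(1)]
  note [measurable] = L2_measurable[OF f(1)] assms(3)
  have "fourier (trunc f n) \<xi> = fourier (trunc g n) \<xi>" for n \<xi>
    unfolding fourier_chi trunc_def using assms(2)
    by (intro integral_cong_AE) (auto elim: eventually_mono)
  then have "fourier (trunc f n) = fourier (trunc g n)" for n by blast
  then show ?thesis using f L2_cong_AE[OF f(1) assms(3,2)] by (simp add: has_fourier_L2_iff)
qed

text \<open>An isometry is injective. Expanding the norm of a difference with \<open>c = -1\<close>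
  reduces this to Plancherel and Parseval for the two functions themselves.\<close>

lemma has_fourier_L2_inj:
  assumes "has_fourier_L2 f F" "has_fourier_L2 g G" "AE \<xi> in lborel. F \<xi> = G \<xi>"
  shows "AE t in lborel. f t = g t"
proof -
  note f = has_fourier_L2_dest[OF assms(1)] and g = has_fourier_L2_dest[OF assms(2)]
  have "sqnorm (\<lambda>t. f t + (-1) * g t) = sqnorm (\<lambda>t. F t + (-1) * G t)"
    unfolding sqnorm_expand[OF f(1) g(1)] sqnorm_expand[OF f(2) g(2)]
    using parseval_L2[OF assms(1,2)] plancherel_L2[OF assms(1)] plancherel_L2[OF assms(2)] by simp
  also have "\<dots> = 0"
    using sqnorm_diff_eq_0_iff[OF f(2) g(2)] assms(3) by simp
  finally show ?thesis using sqnorm_diff_eq_0_iff[OF f(1) g(1)] by simp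
qed

text \<open>The adjoint of the Fourier--Plancherel transform is \<open>k \<mapsto> cnj (F (cnj k))\<close>, by the multiplication
  formula. An isometry with injective adjoint is surjective.\<close>

lemma has_fourier_L2_surj:
  assumes k: "k \<in> L2" obtains u where "has_fourier_L2 u k"
proof -
  have adj: "(\<integral>t. d t * cnj (G t) \<partial>lborel) = (\<integral>t. cnj (D t) * cnj (g t) \<partial>lborel)"
    if "has_fourier_L2 (\<lambda>t. cnj (d t)) D" "has_fourier_L2 g G" for d D g G
  proof -
    have "(\<integral>t. d t * cnj (G t) \<partial>lborel) = cnj (\<integral>t. cnj (d t) * G t \<partial>lborel)"
      by (subst Bochner_Integration.integral_cnj[symmetric]) simp
    also have "\<dots> = cnj (\<integral>t. D t * g t \<partial>lborel)" using has_fourier_L2_mult_formula[OF that] by simp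
    finally show ?thesis by (subst (asm) Bochner_Integration.integral_cnj[symmetric]) simp
  qed
  \<comment> \<open>The adjoint applied to \<open>k\<close> is \<open>cnj (H t)\<close>, the
    candidate for the preimage; \<open>U\<close> below is its transform, and the residual
    \<open>k - U\<close> has to vanish.\<close>
  obtain H where H: "has_fourier_L2 (\<lambda>t. cnj (k t)) H" using has_fourier_L2_exists L2_cnj[OF k] by blast
  have uL: "(\<lambda>t. cnj (H t)) \<in> L2" using has_fourier_L2_dest[OF H] by blast
  obtain U where U: "has_fourier_L2 (\<lambda>t. cnj (H t)) U" using has_fourier_L2_exists uL by blast
  have dL: "(\<lambda>t. k t - U t) \<in> L2" using k has_fourier_L2_dest[OF U] by blast
  obtain D where D: "has_fourier_L2 (\<lambda>t. cnj (k t - U t)) D" using has_fourier_L2_exists L2_cnj[OF dL] by blast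
  have gL: "(\<lambda>t. cnj (D t)) \<in> L2" using has_fourier_L2_dest[OF D] by blast
  obtain G where G: "has_fourier_L2 (\<lambda>t. cnj (D t)) G" using has_fourier_L2_exists gL by blast
  have GL: "G \<in> L2" and UL: "U \<in> L2" using has_fourier_L2_dest[OF G] has_fourier_L2_dest[OF U] by auto
  \<comment> \<open>\<open>cnj (D t)\<close> is the adjoint applied to the residual. Pairing the
    residual with \<open>G\<close> produces its squared norm, while the two terms of the residual
    contribute equal values: one by the adjoint relation, the other by Parseval.\<close>
  have "complex_of_real (sqnorm (\<lambda>t. cnj (D t))) = (\<integral>t. (k t - U t) * cnj (G t) \<partial>lborel)"
    unfolding L2_inner_self[symmetric] L2_inner_def using adj[OF D G] by simp
  also have "\<dots> = (\<integral>t. k t * cnj (G t) \<partial>lborel) - (\<integral>t. U t * cnj (G t) \<partial>lborel)"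
    using L2_integrable_mult[OF k L2_cnj[OF GL]] L2_integrable_mult[OF UL L2_cnj[OF GL]]
    by (simp add: left_diff_distrib)
  also have "(\<integral>t. U t * cnj (G t) \<partial>lborel) = (\<integral>t. cnj (H t) * cnj (cnj (D t)) \<partial>lborel)"
    using parseval_L2[OF U G] by (simp add: L2_inner_def)
  also have "(\<integral>t. k t * cnj (G t) \<partial>lborel) = (\<integral>t. cnj (H t) * cnj (cnj (D t)) \<partial>lborel)"
    by (rule adj[OF H G])
  finally have "sqnorm D = 0" by simp
  then have "sqnorm (\<lambda>t. cnj (k t - U t)) = 0" using plancherel_L2[OF D] by simp
  then have "AE t in lborel. k t = U t" unfolding sqnorm_cnj by (simp add: sqnorm_diff_eq_0_iff k UL)
  then have "has_fourier_L2 (\<lambda>t. cnj (H t)) k"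
    by (intro has_fourier_L2_cong_AE[OF U] L2_measurable[OF k]) (auto elim: eventually_mono)
  then show thesis by (rule that)
qed

section \<open>Time-frequency atoms and their transforms\<close>

lemma beta_pos [simp]: "0 < beta \<alpha> \<omega>"
  by (simp add: beta_def)

text \<open>The transform of an atom whose window has transform \<open>F\<close>: translation turns
  into the character, modulation into a shift by \<omega>, dilation into the inverse
  dilation.\<close>

definition fatom :: "real \<Rightarrow> (real \<Rightarrow> complex) \<Rightarrow> real \<Rightarrow> real \<Rightarrow> real \<Rightarrow> complex" where
  "fatom \<alpha> F x \<omega> \<xi> = chi \<xi> x * (complex_of_real (sqrt (beta \<alpha> \<omega>)) * F (beta \<alpha> \<omega> * (\<xi> - \<omega>)))"

lemma atom_eq:
  "atom \<alpha> f x \<omega> t = chi (- \<omega>) (t - x) * (complex_of_real (beta \<alpha> \<omega> powr (- 1 / 2)) * f (- x / beta \<alpha> \<omega> + 1 / beta \<alpha> \<omega> * t))"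
  by (simp add: atom_def translation_def modulation_def dilation_def chi_def diff_divide_distrib)

lemma fatom_eq:
  "fatom \<alpha> F x \<omega> \<xi> = chi \<xi> x * (complex_of_real (sqrt (beta \<alpha> \<omega>)) * F (- beta \<alpha> \<omega> * \<omega> + beta \<alpha> \<omega> * \<xi>))"
  by (simp add: fatom_def algebra_simps)

text \<open>Serves both \<open>atom\<close>, with \<open>c = 1 / beta \<alpha> \<omega>\<close>, and
  \<open>fatom\<close>, with \<open>c = beta \<alpha> \<omega>\<close>: amplitude and substitution
  compensate each other, and the phase has modulus 1.\<close>

lemma phase_affine_L2:
  fixes M :: "real \<Rightarrow> complex"
  assumes f: "f \<in> L2" and M: "M \<in> borel_measurable borel" "\<And>t. cmod (M t) = 1" and b: "a\<^sup>2 = \<bar>c\<bar>" "c \<noteq> 0"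
  shows "(\<lambda>t. M t * (complex_of_real a * f (d + c * t))) \<in> L2"
    and "sqnorm (\<lambda>t. M t * (complex_of_real a * f (d + c * t))) = sqnorm f"
proof -
  show "(\<lambda>t. M t * (complex_of_real a * f (d + c * t))) \<in> L2"
    by (rule L2_mult_bounded[OF _ M(1), where B = 1]) (use M L2_affine[OF f b(2)] in auto)
  have "sqnorm (\<lambda>t. M t * (complex_of_real a * f (d + c * t))) = a\<^sup>2 * sqnorm (\<lambda>t. f (d + c * t))"
    unfolding sqnorm_def by (simp add: norm_mult M power_mult_distrib)
  then show "sqnorm (\<lambda>t. M t * (complex_of_real a * f (d + c * t))) = sqnorm f"
    using L2_affine(2)[OF f b(2), of d] b by simp
qed

lemma beta_powr_half: "(beta \<alpha> \<omega> powr (- 1 / 2))\<^sup>2 = \<bar>1 / beta \<alpha> \<omega>\<bar>"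
proof -
  have "(beta \<alpha> \<omega> powr (- 1 / 2))\<^sup>2 = beta \<alpha> \<omega> powr (- 1 / 2 + - 1 / 2)"
    by (simp only: power2_eq_square powr_add)
  also have "\<dots> = 1 / beta \<alpha> \<omega>" by (simp add: powr_minus_divide less_imp_le)
  finally show ?thesis by (simp add: less_imp_le)
qed

lemma atom_L2:
  assumes "f \<in> L2" shows "atom \<alpha> f x \<omega> \<in> L2" "sqnorm (atom \<alpha> f x \<omega>) = sqnorm f"
  unfolding atom_eq[abs_def] using phase_affine_L2[OF assms, of "\<lambda>t. chi (- \<omega>) (t - x)" "beta \<alpha> \<omega> powr (- 1 / 2)" "1 / beta \<alpha> \<omega>" "- x / beta \<alpha> \<omega>"]
    beta_powr_half[of \<alpha> \<omega>] beta_pos[of \<alpha> \<omega>]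
  by (simp_all add: less_imp_neq[symmetric])

lemma fatom_L2:
  assumes "f \<in> L2" shows "fatom \<alpha> f x \<omega> \<in> L2" "sqnorm (fatom \<alpha> f x \<omega>) = sqnorm f"
  unfolding fatom_eq[abs_def]
  using phase_affine_L2[OF assms, of "\<lambda>\<xi>. chi \<xi> x" "sqrt (beta \<alpha> \<omega>)" "beta \<alpha> \<omega>" "- beta \<alpha> \<omega> * \<omega>"] beta_pos[of \<alpha> \<omega>]
  by (simp_all add: less_imp_le less_imp_neq[symmetric])

lemma atom_integrable:
  assumes "integrable lborel f" shows "integrable lborel (atom \<alpha> f x \<omega>)"
proof -
  have "integrable lborel (\<lambda>t. f (- x / beta \<alpha> \<omega> + 1 / beta \<alpha> \<omega> * t))"
    using lborel_integrable_real_affine[OF assms] beta_pos[of \<alpha> \<omega>] by (metis divide_eq_0_iff less_irrefl zero_neq_one)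
  then have "integrable lborel (\<lambda>t. (complex_of_real (beta \<alpha> \<omega> powr (- 1 / 2)) * f (- x / beta \<alpha> \<omega> + 1 / beta \<alpha> \<omega> * t)) * chi (- \<omega>) (t - x))"
    by (intro integrable_mult_bounded[where B = 1 and m = "\<lambda>t. chi (- \<omega>) (t - x)"] integrable_mult_right) auto
  then show ?thesis unfolding atom_eq[abs_def] by (simp only: mult.commute)
qed

lemma fourier_atom: "fourier (atom \<alpha> f x \<omega>) = fatom \<alpha> (fourier f) x \<omega>"
proof
  fix \<xi>
  define b where "b = beta \<alpha> \<omega>"
  have b: "b > 0" by (simp add: b_def)
  have b': "b * b powr (- 1 / 2) = sqrt b"
    using b powr_add[of b 1 "- 1 / 2"] by (simp add: powr_half_sqrt)
  have "fourier (atom \<alpha> f x \<omega>) \<xi> = \<bar>b\<bar> *\<^sub>R (\<integral>y. atom \<alpha> f x \<omega> (x + b * y) * chi \<xi> (x + b * y) \<partial>lborel)"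
    unfolding fourier_chi using b by (intro lborel_integral_real_affine) auto
  also have "\<dots> = b *\<^sub>R (\<integral>y. (complex_of_real (b powr (- 1 / 2)) * chi \<xi> x) * (f y * chi (b * (\<xi> - \<omega>)) y) \<partial>lborel)"
  proof -
    have "atom \<alpha> f x \<omega> (x + b * y) * chi \<xi> (x + b * y) = (complex_of_real (b powr (- 1 / 2)) * chi \<xi> x) * (f y * chi (b * (\<xi> - \<omega>)) y)" for y
    proof -
      have "chi (- \<omega>) (b * y) * chi \<xi> (b * y) = chi (b * (\<xi> - \<omega>)) y"
        by (simp add: chi_cis cis_mult algebra_simps)
      moreover have "- x / b + 1 / b * (x + b * y) = y" using b by (simp add: field_simps)
      ultimately show ?thesis
        unfolding atom_eq b_def[symmetric] by (simp add: chi_add algebra_simps)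
    qed
    then show ?thesis using b by simp
  qed
  also have "\<dots> = fatom \<alpha> (fourier f) x \<omega> \<xi>"
    unfolding fatom_def b_def[symmetric] fourier_chi
    unfolding integral_mult_right_zero scaleR_conv_of_real b'[symmetric] of_real_mult by (simp only: mult_ac)
  finally show "fourier (atom \<alpha> f x \<omega>) \<xi> = fatom \<alpha> (fourier f) x \<omega> \<xi>" .
qed

text \<open>The formula for integrable windows, applied to truncated windows. Both passages, from
  window to atom and from \<open>F\<close> to \<open>fatom\<close>, are linear isometries, so the
  two limits carry over.\<close>

lemma has_fourier_L2_atom:
  assumes "has_fourier_L2 f F" shows "has_fourier_L2 (atom \<alpha> f x \<omega>) (fatom \<alpha> F x \<omega>)"
proof (rule has_fourier_L2_approx[of "\<lambda>n. atom \<alpha> (trunc f n) x \<omega>"])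
  note f = has_fourier_L2_dest[OF assms]
  have "(\<lambda>t. atom \<alpha> (trunc f n) x \<omega> t - atom \<alpha> f x \<omega> t) = atom \<alpha> (\<lambda>t. trunc f n t - f t) x \<omega>" for n
    by (intro ext) (simp add: atom_eq right_diff_distrib)
  then show "L2_lim (\<lambda>n. atom \<alpha> (trunc f n) x \<omega>) (atom \<alpha> f x \<omega>)"
    using trunc_lim[OF f(1)] by (simp add: atom_L2 L2_diff[OF trunc_L2] f)
  have "(\<lambda>t. fatom \<alpha> (fourier (trunc f n)) x \<omega> t - fatom \<alpha> F x \<omega> t) = fatom \<alpha> (\<lambda>t. fourier (trunc f n) t - F t) x \<omega>" for n
    by (intro ext) (simp add: fatom_def right_diff_distrib)
  then show "L2_lim (\<lambda>n. fourier (atom \<alpha> (trunc f n) x \<omega>)) (fatom \<alpha> F x \<omega>)"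
    using f(3) by (simp add: fourier_atom fatom_L2 L2_diff[OF fourier_trunc_L2] f)
qed (use has_fourier_L2_dest[OF assms] in \<open>auto intro: atom_L2(1) fatom_L2(1) atom_integrable trunc_L2 trunc_integrable\<close>)

section \<open>Frequency-dependent dilation\<close>

lemma beta_le_1: "0 \<le> \<alpha> \<Longrightarrow> beta \<alpha> \<omega> \<le> 1"
  using powr_mono[of "- \<alpha>" 0 "1 + \<bar>\<omega>\<bar>"] by (auto simp: beta_def split: if_splits)

lemma beta_uminus [simp]: "beta \<alpha> (- \<omega>) = beta \<alpha> \<omega>"
  by (simp add: beta_def)

lemma beta_measurable [measurable]: "beta \<alpha> \<in> borel_measurable borel"
  unfolding beta_def by measurable

lemma continuous_beta: "continuous_on UNIV (beta \<alpha>)"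
  unfolding beta_def by (intro continuous_intros) auto

text \<open>The product \<open>(1 + \<bar>\<omega>\<bar>) * beta \<alpha> \<omega>\<close> is at
  least 1, so \<open>\<bar>\<xi> - \<omega>\<bar>\<close> is at most
  \<open>1 + \<bar>\<omega>\<bar>\<close> times the rescaled distance.\<close>

lemma frequency_ratio_upper:
  assumes "0 \<le> \<alpha>" "\<alpha> < 1"
  shows "1 + \<bar>\<xi>\<bar> \<le> (1 + \<bar>\<omega>\<bar>) * (1 + beta \<alpha> \<omega> * \<bar>\<xi> - \<omega>\<bar>)"
proof -
  have "(1 + \<bar>\<omega>\<bar>) * beta \<alpha> \<omega> = (1 + \<bar>\<omega>\<bar>) powr (1 - \<alpha>)"
    using powr_add[of "1 + \<bar>\<omega>\<bar>" 1 "- \<alpha>"] by (simp add: beta_def)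
  also have "\<dots> \<ge> 1" using assms by (intro ge_one_powr_ge_zero) auto
  finally have "1 * \<bar>\<xi> - \<omega>\<bar> \<le> ((1 + \<bar>\<omega>\<bar>) * beta \<alpha> \<omega>) * \<bar>\<xi> - \<omega>\<bar>" by (intro mult_right_mono) auto
  then show ?thesis by (simp add: algebra_simps)
qed

text \<open>This direction is more expensive, because the rescaling is measured at \<omega>, the
  very point to be estimated. The comparison is linear in the rescaled distance only for powers with
  exponent \<open>1 - \<alpha>\<close>, and taking the root yields
  \<open>1 / (1 - \<alpha>)\<close>.\<close>

lemma frequency_ratio_lower:
  assumes "0 \<le> \<alpha>" "\<alpha> < 1"
  shows "1 + \<bar>\<omega>\<bar> \<le> (1 + \<bar>\<xi>\<bar>) * (1 + beta \<alpha> \<omega> * \<bar>\<xi> - \<omega>\<bar>) powr (1 / (1 - \<alpha>))"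
proof -
  define N M u where "N = 1 + \<bar>\<omega>\<bar>" and "M = 1 + \<bar>\<xi>\<bar>" and "u = 1 + beta \<alpha> \<omega> * \<bar>\<xi> - \<omega>\<bar>"
  have N: "N \<ge> 1" and M: "M \<ge> 1" by (auto simp: N_def M_def)
  have u: "u \<ge> 1" by (simp add: u_def less_imp_le)
  have "N \<le> M * u powr (1 / (1 - \<alpha>))"
  proof (cases "N \<le> M")
    case True
    have "1 \<le> u powr (1 / (1 - \<alpha>))" using u assms by (intro ge_one_powr_ge_zero) auto
    then have "M * 1 \<le> M * u powr (1 / (1 - \<alpha>))" using M by (intro mult_left_mono) auto
    then show ?thesis using True by simp
  next
    case False
    have e: "x powr (1 - \<alpha>) = x * x powr (- \<alpha>)" if "x \<ge> 1" for x
      using powr_add[of x 1 "- \<alpha>"] that by simp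
    \<comment> \<open>Multiplied by \<open>N powr (- \<alpha>)\<close>, the distance becomes
      \<open>u - 1\<close>, and \<open>M < N\<close> allows
      \<open>N powr (- \<alpha>) \<le> M powr (- \<alpha>)\<close> in the other term.\<close>
    have "N \<le> M + \<bar>\<xi> - \<omega>\<bar>" by (simp add: N_def M_def)
    then have "N * N powr (- \<alpha>) \<le> (M + \<bar>\<xi> - \<omega>\<bar>) * N powr (- \<alpha>)" by (intro mult_right_mono) auto
    also have "\<dots> = M * N powr (- \<alpha>) + (u - 1)" by (simp add: u_def beta_def N_def algebra_simps)
    also have "M * N powr (- \<alpha>) \<le> M * M powr (- \<alpha>)"
      using False M assms by (intro mult_left_mono powr_mono2') auto
    finally have *: "N powr (1 - \<alpha>) \<le> M powr (1 - \<alpha>) + (u - 1)" using N M by (simp add: e)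
    have "1 \<le> M powr (1 - \<alpha>)" using M assms by (intro ge_one_powr_ge_zero) auto
    then have "1 * (u - 1) \<le> M powr (1 - \<alpha>) * (u - 1)" using u by (intro mult_right_mono) auto
    with * have "N powr (1 - \<alpha>) \<le> M powr (1 - \<alpha>) * u" by (simp add: algebra_simps)
    then have "(N powr (1 - \<alpha>)) powr (1 / (1 - \<alpha>)) \<le> (M powr (1 - \<alpha>) * u) powr (1 / (1 - \<alpha>))"
      using assms by (intro powr_mono2) auto
    then show ?thesis using N M u assms by (simp add: powr_powr powr_mult)
  qed
  then show ?thesis by (simp add: N_def M_def u_def)
qed

text \<open>The \<open>\<alpha>\<close>-th power of \<open>frequency_ratio_upper\<close>. Comparing
  in this direction costs the exponent \<open>\<alpha>\<close>, in the other direction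
  \<open>\<alpha> / (1 - \<alpha>)\<close>.\<close>

lemma beta_le_upper:
  assumes "0 \<le> \<alpha>" "\<alpha> < 1"
  shows "beta \<alpha> \<omega> \<le> beta \<alpha> \<xi> * (1 + beta \<alpha> \<omega> * \<bar>\<xi> - \<omega>\<bar>) powr \<alpha>"
proof -
  define u where "u = 1 + beta \<alpha> \<omega> * \<bar>\<xi> - \<omega>\<bar>"
  have u: "u \<ge> 1" by (simp add: u_def less_imp_le)
  have "(1 + \<bar>\<xi>\<bar>) powr \<alpha> \<le> ((1 + \<bar>\<omega>\<bar>) * u) powr \<alpha>"
    using frequency_ratio_upper[OF assms, of \<xi> \<omega>] assms by (intro powr_mono2) (auto simp: u_def)
  also have "\<dots> = (1 + \<bar>\<omega>\<bar>) powr \<alpha> * u powr \<alpha>" using u by (simp add: powr_mult)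
  finally show ?thesis
    unfolding u_def[symmetric] unfolding beta_def[of \<alpha> \<omega>] beta_def[of \<alpha> \<xi>]
    by (simp add: powr_minus field_simps)
qed

lemma beta_le_lower:
  assumes "0 \<le> \<alpha>" "\<alpha> < 1"
  shows "beta \<alpha> \<xi> \<le> beta \<alpha> \<omega> * (1 + beta \<alpha> \<omega> * \<bar>\<xi> - \<omega>\<bar>) powr (\<alpha> / (1 - \<alpha>))"
proof -
  define u where "u = 1 + beta \<alpha> \<omega> * \<bar>\<xi> - \<omega>\<bar>"
  have u: "u \<ge> 1" by (simp add: u_def less_imp_le)
  have "(1 + \<bar>\<omega>\<bar>) powr \<alpha> \<le> ((1 + \<bar>\<xi>\<bar>) * u powr (1 / (1 - \<alpha>))) powr \<alpha>"
    using frequency_ratio_lower[OF assms, of \<omega> \<xi>] assms by (intro powr_mono2) (auto simp: u_def)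
  also have "\<dots> = (1 + \<bar>\<xi>\<bar>) powr \<alpha> * u powr (\<alpha> / (1 - \<alpha>))" using u by (simp add: powr_mult powr_powr)
  finally show ?thesis
    unfolding u_def[symmetric] unfolding beta_def[of \<alpha> \<omega>] beta_def[of \<alpha> \<xi>]
    by (simp add: powr_minus field_simps)
qed

section \<open>Integrals of the decay profile\<close>

definition tail_integral :: "real \<Rightarrow> ennreal" where
  "tail_integral q = (\<integral>\<^sup>+y. ennreal ((1 + \<bar>y\<bar>) powr (- q)) \<partial>lborel)"

lemma tail_integral_finite:
  assumes "q > 1" shows "tail_integral q < \<infinity>"
proof -
  have half: "(\<integral>\<^sup>+y. ennreal ((1 + y) powr (- q)) * indicator {0..} y \<partial>lborel) = ennreal (0 - (1 + 0) powr (1 - q) / (1 - q))"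
  proof (rule nn_integral_FTC_atLeast)
    show "((\<lambda>y. (1 + y) powr (1 - q) / (1 - q)) has_real_derivative (1 + y) powr (- q)) (at y)" if "0 \<le> y" for y
    proof -
      have "((\<lambda>y. 1 + y) has_real_derivative 1) (at y)" by (auto intro!: derivative_eq_intros)
      from DERIV_cdivide[OF DERIV_fun_powr[OF this, of "1 - q"], of "1 - q"] show ?thesis
        using that assms by simp
    qed
    have "((\<lambda>y. (1 + y) powr (1 - q)) \<longlongrightarrow> 0) at_top"
    proof (rule tendsto_neg_powr)
      show "LIM y at_top. 1 + y :> (at_top :: real filter)" by (rule filterlim_tendsto_add_at_top[OF tendsto_const filterlim_ident])
    qed (use assms in auto)
    then show "((\<lambda>y. (1 + y) powr (1 - q) / (1 - q)) \<longlongrightarrow> 0) at_top"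
      by (rule tendsto_divide_zero)
  qed auto
  have "tail_integral q \<le> (\<integral>\<^sup>+y. ennreal ((1 + y) powr (- q)) * indicator {0..} y
      + ennreal ((1 + (- y)) powr (- q)) * indicator {0..} (- y) \<partial>lborel)"
    unfolding tail_integral_def by (intro nn_integral_mono) (auto simp: indicator_def)
  also have "\<dots> = (\<integral>\<^sup>+y. ennreal ((1 + y) powr (- q)) * indicator {0..} y \<partial>lborel)
      + (\<integral>\<^sup>+y. ennreal ((1 + (- y)) powr (- q)) * indicator {0..} (- y) \<partial>lborel)"
    by (intro nn_integral_add) auto
  also have "(\<integral>\<^sup>+y. ennreal ((1 + (- y)) powr (- q)) * indicator {0..} (- y) \<partial>lborel)
      = (\<integral>\<^sup>+y. ennreal ((1 + y) powr (- q)) * indicator {0..} y \<partial>lborel)"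
    using nn_integral_real_affine[of "\<lambda>y. ennreal ((1 + y) powr (- q)) * indicator {0..} y" "-1" 0] by simp
  also have "\<dots> + \<dots> < \<infinity>" unfolding half by simp
  finally show ?thesis .
qed

text \<open>The factor \<open>b\<close> is the Jacobian, so the value depends neither on
  \<open>b\<close> nor on \<omega>. This makes the later estimates uniform in centre and
  scale.\<close>

lemma tail_integral_affine:
  assumes "b > 0"
  shows "(\<integral>\<^sup>+\<xi>. ennreal (b * (1 + b * \<bar>\<xi> - \<omega>\<bar>) powr (- q)) \<partial>lborel) = tail_integral q"
proof -
  have "tail_integral q = \<bar>b\<bar> * (\<integral>\<^sup>+\<xi>. ennreal ((1 + \<bar>- b * \<omega> + b * \<xi>\<bar>) powr (- q)) \<partial>lborel)"
    unfolding tail_integral_def using assms by (intro nn_integral_real_affine) auto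
  also have "\<dots> = (\<integral>\<^sup>+\<xi>. ennreal (b * (1 + b * \<bar>\<xi> - \<omega>\<bar>) powr (- q)) \<partial>lborel)"
  proof -
    have "\<bar>- b * \<omega> + b * \<xi>\<bar> = b * \<bar>\<xi> - \<omega>\<bar>" for \<xi>
      using assms abs_mult[of b "\<xi> - \<omega>"] by (simp add: algebra_simps)
    then show ?thesis
      using assms by (subst nn_integral_cmult[symmetric]) (auto simp: ennreal_mult')
  qed
  finally show ?thesis by simp
qed

text \<open>On the half line on which \<open>\<omega>\<close> and \<open>\<xi>\<close> have the same sign, \<open>\<omega> \<mapsto> beta \<alpha> \<omega> * (\<omega> - \<xi>)\<close> is an
  increasing change of variables whose derivative is at least \<open>(1 - \<alpha>) * beta \<alpha> \<omega>\<close>.\<close>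

lemma beta_integral_half:
  assumes \<alpha>: "0 \<le> \<alpha>" "\<alpha> < 1" and \<xi>: "0 \<le> \<xi>"
  shows "(\<integral>\<^sup>+\<omega>. ennreal (beta \<alpha> \<omega> * (1 + beta \<alpha> \<omega> * \<bar>\<xi> - \<omega>\<bar>) powr (- q)) * indicator {0..} \<omega> \<partial>lborel)
    \<le> ennreal (1 / (1 - \<alpha>)) * tail_integral q"
proof -
  define h where "h \<omega> = (1 + \<omega>) powr (- \<alpha>) * (\<omega> - \<xi>)" for \<omega>
  define h' where "h' \<omega> = (1 + \<omega>) powr (- \<alpha>) - \<alpha> * (1 + \<omega>) powr (- \<alpha> - 1) * (\<omega> - \<xi>)" for \<omega>
  define f where "f y = (1 + \<bar>y\<bar>) powr (- q)" for y :: real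
  have [measurable]: "f \<in> borel_measurable borel" unfolding f_def by measurable
  define F where "F \<omega> = ennreal (beta \<alpha> \<omega> * (1 + beta \<alpha> \<omega> * \<bar>\<xi> - \<omega>\<bar>) powr (- q))" for \<omega>
  have [measurable]: "F \<in> borel_measurable borel" unfolding F_def by measurable
  have deriv: "(h has_real_derivative h' \<omega>) (at \<omega>)" if "\<omega> \<ge> 0" for \<omega>
    unfolding h_def h'_def using that by (auto intro!: derivative_eq_intros)
  \<comment> \<open>Since \<open>\<xi> \<ge> 0\<close>, the factor \<open>\<omega> - \<xi>\<close>
    of the subtracted term is at most \<open>1 + \<omega>\<close>; replacing it costs exactly the
    fraction \<open>\<alpha>\<close> of \<open>beta \<alpha> \<omega>\<close>.\<close>
  have lower: "(1 - \<alpha>) * beta \<alpha> \<omega> \<le> h' \<omega>" if "\<omega> \<ge> 0" for \<omega>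
  proof -
    have "\<alpha> * (1 + \<omega>) powr (- \<alpha> - 1) * (\<omega> - \<xi>) \<le> \<alpha> * (1 + \<omega>) powr (- \<alpha> - 1) * (1 + \<omega>)"
      using \<alpha> \<xi> by (intro mult_left_mono) auto
    also have "\<dots> = \<alpha> * (1 + \<omega>) powr (- \<alpha>)"
      using powr_add[of "1 + \<omega>" "- \<alpha> - 1" 1] that by simp
    finally show ?thesis using that by (simp add: h'_def beta_def algebra_simps)
  qed
  have h'nn: "0 \<le> h' \<omega>" if "\<omega> \<ge> 0" for \<omega>
    using lower[OF that] \<alpha> by (intro order_trans[OF _ lower[OF that]]) (auto simp: less_imp_le)
  have hc: "continuous_on {0..b} h'" for b
    unfolding h'_def by (intro continuous_intros) auto
  \<comment> \<open>The substitution rule is applied on bounded intervals. The bound does not depend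
    on \<open>n\<close>, so the half line follows by monotone convergence.\<close>
  have fin: "(\<integral>\<^sup>+\<omega>. F \<omega> * indicator {0..real n} \<omega> \<partial>lborel) \<le> ennreal (1 / (1 - \<alpha>)) * tail_integral q" for n
  proof -
    have pt: "F \<omega> * indicator {0..real n} \<omega> \<le> ennreal (1 / (1 - \<alpha>)) * (ennreal (f (h \<omega>) * h' \<omega> * indicator {0..real n} \<omega>))" for \<omega>
    proof (cases "\<omega> \<in> {0..real n}")
      case True
      then have \<omega>: "\<omega> \<ge> 0" by simp
      have "beta \<alpha> \<omega> * \<bar>\<xi> - \<omega>\<bar> = \<bar>h \<omega>\<bar>"
        using \<omega> by (simp add: h_def beta_def abs_mult abs_minus_commute)
      then have "beta \<alpha> \<omega> * (1 + beta \<alpha> \<omega> * \<bar>\<xi> - \<omega>\<bar>) powr (- q) = beta \<alpha> \<omega> * f (h \<omega>)" by (simp add: f_def)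
      also have "\<dots> \<le> (1 / (1 - \<alpha>) * h' \<omega>) * f (h \<omega>)"
        using lower[OF \<omega>] \<alpha> by (intro mult_right_mono) (auto simp: f_def field_simps)
      finally show ?thesis
        using True \<alpha> h'nn[OF \<omega>] unfolding F_def
        by (simp add: ennreal_mult'[symmetric] mult_ac ennreal_leI)
    qed auto
    have "(\<integral>\<^sup>+\<omega>. F \<omega> * indicator {0..real n} \<omega> \<partial>lborel)
        \<le> (\<integral>\<^sup>+\<omega>. ennreal (1 / (1 - \<alpha>)) * (ennreal (f (h \<omega>) * h' \<omega> * indicator {0..real n} \<omega>)) \<partial>lborel)"
      by (intro nn_integral_mono pt)
    also have "\<dots> = ennreal (1 / (1 - \<alpha>)) * (\<integral>\<^sup>+\<omega>. ennreal (f (h \<omega>) * h' \<omega> * indicator {0..real n} \<omega>) \<partial>lborel)"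
      unfolding h_def h'_def by (intro nn_integral_cmult) measurable
    also have "(\<integral>\<^sup>+\<omega>. ennreal (f (h \<omega>) * h' \<omega> * indicator {0..real n} \<omega>) \<partial>lborel)
        = (\<integral>\<^sup>+y. ennreal (f y * indicator {h 0..h (real n)} y) \<partial>lborel)"
      by (rule nn_integral_substitution[symmetric])
         (use deriv h'nn hc in \<open>auto simp: set_borel_measurable_def\<close>)
    also have "\<dots> \<le> tail_integral q"
      unfolding tail_integral_def by (intro nn_integral_mono) (auto simp: indicator_def f_def)
    finally show ?thesis by (simp add: mult_left_mono)
  qed
  have "(\<lambda>n. \<integral>\<^sup>+\<omega>. F \<omega> * indicator {0..real n} \<omega> \<partial>lborel) \<longlonglongrightarrow> (\<integral>\<^sup>+\<omega>. F \<omega> * indicator {0..} \<omega> \<partial>lborel)"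
  proof (rule nn_integral_LIMSEQ)
    show "incseq (\<lambda>n x. F x * indicator {0..real n} x)"
      by (intro incseq_SucI le_funI mult_left_mono) (auto simp: indicator_def)
    show "(\<lambda>n. F x * indicator {0..real n} x) \<longlonglongrightarrow> F x * indicator {0..} x" for x
    proof -
      obtain M :: nat where M: "x \<le> real M" using real_arch_simple by blast
      have "F x * indicator {0..real n} x = F x * indicator {0..} x" if "n \<ge> M" for n
      proof -
        have "x \<le> real n" using M that by linarith
        then show ?thesis by (auto simp: indicator_def)
      qed
      then show ?thesis by (intro tendsto_eventually) (auto simp: eventually_sequentially)
    qed
  qed measurable
  from LIMSEQ_le_const2[OF this] fin show ?thesis unfolding F_def by auto
qed

text \<open>Reduction to the half line: where \<omega> and \<xi> have opposite signs the distance is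
  at least \<open>\<bar>\<omega>\<bar>\<close>, which compares that part with the case
  \<open>\<xi> = 0\<close>. Negative \<xi> follow by reflection, as \<open>beta\<close> is
  even.\<close>

lemma beta_integral_bound:
  assumes \<alpha>: "0 \<le> \<alpha>" "\<alpha> < 1" and q: "q > 1"
  obtains D where "D \<ge> 0"
    "\<And>\<xi>. (\<integral>\<^sup>+\<omega>. ennreal (beta \<alpha> \<omega> * (1 + beta \<alpha> \<omega> * \<bar>\<xi> - \<omega>\<bar>) powr (- q)) \<partial>lborel) \<le> ennreal D"
proof -
  define F where "F \<xi> \<omega> = ennreal (beta \<alpha> \<omega> * (1 + beta \<alpha> \<omega> * \<bar>\<xi> - \<omega>\<bar>) powr (- q))" for \<xi> \<omega>
  have [measurable]: "F \<xi> \<in> borel_measurable borel" for \<xi> unfolding F_def by measurable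
  have flip: "(\<integral>\<^sup>+\<omega>. G (- \<omega>) \<partial>lborel) = (\<integral>\<^sup>+\<omega>. G \<omega> \<partial>lborel)" if "G \<in> borel_measurable borel" for G :: "real \<Rightarrow> ennreal"
    using nn_integral_real_affine[OF that, of "-1" 0] by simp
  define E where "E = ennreal (1 / (1 - \<alpha>)) * tail_integral q"
  have pos: "(\<integral>\<^sup>+\<omega>. F \<xi> \<omega> \<partial>lborel) \<le> E + E" if "\<xi> \<ge> 0" for \<xi>
  proof -
    have pt: "F \<xi> \<omega> \<le> F \<xi> \<omega> * indicator {0..} \<omega> + F 0 (- \<omega>) * indicator {0..} (- \<omega>)" for \<omega>
    proof (cases "\<omega> \<ge> 0")
      case False
      have "beta \<alpha> \<omega> * \<bar>\<omega>\<bar> \<le> beta \<alpha> \<omega> * \<bar>\<xi> - \<omega>\<bar>"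
        using False that by (intro mult_left_mono) (auto simp: less_imp_le)
      then have "(1 + beta \<alpha> \<omega> * \<bar>\<xi> - \<omega>\<bar>) powr (- q) \<le> (1 + beta \<alpha> \<omega> * \<bar>\<omega>\<bar>) powr (- q)"
        using q by (intro powr_mono2') (auto simp: less_imp_le add_pos_nonneg)
      then have "F \<xi> \<omega> \<le> F 0 (- \<omega>)"
        unfolding F_def by (intro ennreal_leI) (simp add: mult_left_mono less_imp_le)
      then show ?thesis using False by simp
    qed simp
    have "(\<integral>\<^sup>+\<omega>. F \<xi> \<omega> \<partial>lborel) \<le> (\<integral>\<^sup>+\<omega>. F \<xi> \<omega> * indicator {0..} \<omega> + F 0 (- \<omega>) * indicator {0..} (- \<omega>) \<partial>lborel)"
      by (intro nn_integral_mono pt)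
    also have "\<dots> = (\<integral>\<^sup>+\<omega>. F \<xi> \<omega> * indicator {0..} \<omega> \<partial>lborel) + (\<integral>\<^sup>+\<omega>. F 0 (- \<omega>) * indicator {0..} (- \<omega>) \<partial>lborel)"
      by (intro nn_integral_add) auto
    also have "(\<integral>\<^sup>+\<omega>. F 0 (- \<omega>) * indicator {0..} (- \<omega>) \<partial>lborel) = (\<integral>\<^sup>+\<omega>. F 0 \<omega> * indicator {0..} \<omega> \<partial>lborel)"
      by (rule flip) measurable
    also have "(\<integral>\<^sup>+\<omega>. F \<xi> \<omega> * indicator {0..} \<omega> \<partial>lborel) + \<dots> \<le> E + E"
      unfolding F_def E_def by (intro add_mono beta_integral_half \<alpha> that order_refl)
    finally show ?thesis .
  qed
  have all: "(\<integral>\<^sup>+\<omega>. F \<xi> \<omega> \<partial>lborel) \<le> E + E" for \<xi>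
  proof (cases "\<xi> \<ge> 0")
    case False
    have "(\<integral>\<^sup>+\<omega>. F \<xi> \<omega> \<partial>lborel) = (\<integral>\<^sup>+\<omega>. F \<xi> (- \<omega>) \<partial>lborel)" by (rule flip[symmetric]) measurable
    also have "\<dots> = (\<integral>\<^sup>+\<omega>. F (- \<xi>) \<omega> \<partial>lborel)"
      unfolding F_def by (intro nn_integral_cong) (simp add: abs_minus_commute add.commute)
    finally show ?thesis using pos[of "- \<xi>"] False by simp
  qed (rule pos)
  have "E + E < \<infinity>" using tail_integral_finite[OF q] by (simp add: E_def ennreal_mult_less_top)
  then obtain D where "D \<ge> 0" "E + E = ennreal D" by (cases "E + E") auto
  then show thesis using all by (intro that[of D]) (auto simp: F_def)
qed

section \<open>Bounded \<open>C\<^sup>2\<close> functions\<close>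

text \<open>\<open>E\<close> is an amplitude envelope and \<open>L\<close> a local inverse length scale.\<close>

definition C2_bounded :: "(real \<Rightarrow> complex) \<Rightarrow> (real \<Rightarrow> complex) \<Rightarrow> (real \<Rightarrow> complex) \<Rightarrow> (real \<Rightarrow> real) \<Rightarrow> (real \<Rightarrow> real) \<Rightarrow> bool" where
  "C2_bounded f f1 f2 E L \<longleftrightarrow> continuous_on UNIV f2 \<and> (\<forall>x. (f has_vector_derivative f1 x) (at x)
     \<and> (f1 has_vector_derivative f2 x) (at x) \<and> 0 \<le> L x
     \<and> cmod (f x) \<le> E x \<and> cmod (f1 x) \<le> E x * L x \<and> cmod (f2 x) \<le> E x * (L x)\<^sup>2)"

lemma C2_boundedD:
  assumes "C2_bounded f f1 f2 E L"
  shows "continuous_on UNIV f2" "(f has_vector_derivative f1 x) (at x)" "(f1 has_vector_derivative f2 x) (at x)"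
    "0 \<le> L x" "cmod (f x) \<le> E x" "cmod (f1 x) \<le> E x * L x" "cmod (f2 x) \<le> E x * (L x)\<^sup>2"
  using assms by (auto simp: C2_bounded_def)

lemma has_vector_derivative_imp_continuous_on:
  "(\<And>x. (f has_vector_derivative f' x) (at x)) \<Longrightarrow> continuous_on UNIV f"
  by (metis continuous_at_imp_continuous_on has_vector_derivative_continuous)

lemma C2_bounded_continuous:
  assumes "C2_bounded f f1 f2 E L"
  shows "continuous_on UNIV f" "continuous_on UNIV f1" "continuous_on UNIV f2"
  using C2_boundedD[OF assms] by (auto intro: has_vector_derivative_imp_continuous_on)

text \<open>Amplitudes multiply and rates add: the Leibniz terms of order two form the perfect
  square \<open>(L x + L' x)\<^sup>2\<close>, so the format is closed under products without further
  constants.\<close>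

lemma C2_bounded_mult:
  assumes f: "C2_bounded f f1 f2 E L" and g: "C2_bounded g g1 g2 E' L'"
  shows "C2_bounded (\<lambda>x. f x * g x) (\<lambda>x. f x * g1 x + f1 x * g x)
    (\<lambda>x. (f x * g2 x + f1 x * g1 x) + (f1 x * g1 x + f2 x * g x)) (\<lambda>x. E x * E' x) (\<lambda>x. L x + L' x)"
  unfolding C2_bounded_def
proof (intro conjI allI)
  note F = C2_boundedD[OF f] and G = C2_boundedD[OF g]
  show "continuous_on UNIV (\<lambda>x. (f x * g2 x + f1 x * g1 x) + (f1 x * g1 x + f2 x * g x))"
    by (intro continuous_intros C2_bounded_continuous[OF f] C2_bounded_continuous[OF g])
  fix x
  show "((\<lambda>x. f x * g x) has_vector_derivative (f x * g1 x + f1 x * g x)) (at x)"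
    by (intro has_vector_derivative_mult F G)
  show "((\<lambda>x. f x * g1 x + f1 x * g x) has_vector_derivative
      (f x * g2 x + f1 x * g1 x) + (f1 x * g1 x + f2 x * g x)) (at x)"
    by (intro has_vector_derivative_add has_vector_derivative_mult F G)
  show "0 \<le> L x + L' x" using F(4) G(4) by simp
  have E: "0 \<le> E x" "0 \<le> E' x" using norm_ge_zero F(5) G(5) order_trans by blast+
  note pos = E F(4)[of x] G(4)[of x]
  show "cmod (f x * g x) \<le> E x * E' x"
    unfolding norm_mult by (intro mult_mono F G E norm_ge_zero)
  have "cmod (f x * g1 x + f1 x * g x) \<le> E x * (E' x * L' x) + (E x * L x) * E' x"
    using pos by (intro norm_triangle_mono) (unfold norm_mult, (intro mult_mono F G mult_nonneg_nonneg norm_ge_zero | assumption)+)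
  then show "cmod (f x * g1 x + f1 x * g x) \<le> E x * E' x * (L x + L' x)"
    by (simp add: algebra_simps)
  have "cmod ((f x * g2 x + f1 x * g1 x) + (f1 x * g1 x + f2 x * g x)) \<le>
      (E x * (E' x * (L' x)\<^sup>2) + (E x * L x) * (E' x * L' x)) + ((E x * L x) * (E' x * L' x) + (E x * (L x)\<^sup>2) * E' x)"
    using pos by (intro norm_triangle_mono) (unfold norm_mult, (intro mult_mono F G mult_nonneg_nonneg norm_ge_zero zero_le_power2 | assumption)+)
  then show "cmod ((f x * g2 x + f1 x * g1 x) + (f1 x * g1 x + f2 x * g x)) \<le> E x * E' x * (L x + L' x)\<^sup>2"
    by (simp add: algebra_simps power2_eq_square)
qed

lemma C2_bounded_cnj:
  assumes "C2_bounded f f1 f2 E L"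
  shows "C2_bounded (\<lambda>x. cnj (f x)) (\<lambda>x. cnj (f1 x)) (\<lambda>x. cnj (f2 x)) E L"
  using assms unfolding C2_bounded_def by (auto intro: has_vector_derivative_cnj continuous_on_cnj)

lemma C2_bounded_const: "C2_bounded (\<lambda>_. 1) (\<lambda>_. 0) (\<lambda>_. 0) (\<lambda>_. 1) (\<lambda>_. 0)"
  unfolding C2_bounded_def by auto

text \<open>Each derivative brings out one factor \<open>b\<close>, so the dilated window has the
  constant rate \<open>b\<close>.\<close>

lemma C2_bounded_affine:
  assumes f: "C2_bounded f f1 f2 E (\<lambda>_. 1)" and b: "b \<ge> 0" and c: "c \<ge> 0"
  shows "C2_bounded (\<lambda>x. complex_of_real c * f (b * (x - \<omega>))) (\<lambda>x. complex_of_real (c * b) * f1 (b * (x - \<omega>)))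
    (\<lambda>x. complex_of_real (c * b\<^sup>2) * f2 (b * (x - \<omega>))) (\<lambda>x. c * E (b * (x - \<omega>))) (\<lambda>_. b)"
proof -
  note F = C2_boundedD[OF f]
  have inner: "((\<lambda>x. b * (x - \<omega>)) has_vector_derivative b) (at x)" for x
    by (auto intro!: derivative_eq_intros simp: has_real_derivative_iff_has_vector_derivative[symmetric])
  have ch: "((\<lambda>x. complex_of_real a * h (b * (x - \<omega>))) has_vector_derivative complex_of_real (a * b) * h' (b * (x - \<omega>))) (at x)"
    if "\<And>x. (h has_vector_derivative h' x) (at x)" for a h h' x
    using has_vector_derivative_mult_right[OF vector_diff_chain_at[OF inner that], of "complex_of_real a" x]
    by (simp add: o_def scaleR_conv_of_real mult_ac)
  show ?thesis
    unfolding C2_bounded_def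
  proof (intro conjI allI)
    show "continuous_on UNIV (\<lambda>x. complex_of_real (c * b\<^sup>2) * f2 (b * (x - \<omega>)))"
      by (intro continuous_intros continuous_on_compose2[OF F(1)]) auto
    fix x
    show "((\<lambda>x. complex_of_real c * f (b * (x - \<omega>))) has_vector_derivative complex_of_real (c * b) * f1 (b * (x - \<omega>))) (at x)"
      by (rule ch) (rule F)
    show "((\<lambda>x. complex_of_real (c * b) * f1 (b * (x - \<omega>))) has_vector_derivative complex_of_real (c * b\<^sup>2) * f2 (b * (x - \<omega>))) (at x)"
      using ch[of f1 f2 "c * b" x] F(3) by (simp add: power2_eq_square mult.assoc)
    show "cmod (complex_of_real c * f (b * (x - \<omega>))) \<le> c * E (b * (x - \<omega>))"
      using F(5) c by (simp add: norm_mult mult_left_mono)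
    show "cmod (complex_of_real (c * b) * f1 (b * (x - \<omega>))) \<le> c * E (b * (x - \<omega>)) * b"
      using mult_left_mono[OF F(6), of "c * b" "b * (x - \<omega>)"] c b by (simp add: norm_mult mult_ac)
    show "cmod (complex_of_real (c * b\<^sup>2) * f2 (b * (x - \<omega>))) \<le> c * E (b * (x - \<omega>)) * b\<^sup>2"
      using mult_left_mono[OF F(7), of "c * b\<^sup>2" "b * (x - \<omega>)"] c b by (simp add: norm_mult norm_power mult_ac)
  qed (use b in auto)
qed

text \<open>The derivatives of the reciprocal consist of \<open>f1 / f\<^sup>2\<close>,
  \<open>f1\<^sup>2 / f^3\<close> and \<open>f2 / f\<^sup>2\<close>; they keep the rate
  \<open>L\<close> up to a factor built from the quotient \<open>B / c\<close> of upper and lower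
  bound.\<close>

lemma C2_bounded_inverse:
  assumes f: "C2_bounded f f1 f2 (\<lambda>_. B) L" and c: "c > 0" "\<And>x. c \<le> cmod (f x)"
  obtains g1 g2 where "C2_bounded (\<lambda>x. 1 / f x) g1 g2 (\<lambda>_. 1 / c) (\<lambda>x. 2 * B / c * L x)"
proof -
  note F = C2_boundedD[OF f]
  have nz: "f x \<noteq> 0" for x using c(2)[of x] c(1) by auto
  have cB: "c \<le> B" using c(2) F(5) order_trans by blast
  define h where "h x = 1 / f x" for x
  have hb: "cmod (h x) \<le> 1 / c" for x
    using c(2)[of x] c(1) by (simp add: h_def norm_divide frac_le)
  have h: "(h has_vector_derivative - (f1 x * (h x * h x))) (at x)" for x
  proof -
    have "(inverse has_field_derivative - (inverse (f x) ^ Suc (Suc 0))) (at (f x))"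
      by (rule DERIV_inverse[OF nz])
    from field_vector_diff_chain_at[OF F(2) this]
    show ?thesis by (simp add: h_def[abs_def] o_def inverse_eq_divide mult_ac)
  qed
  define h2 where "h2 x = - (f1 x * (h x * - (f1 x * (h x * h x)) + - (f1 x * (h x * h x)) * h x) + f2 x * (h x * h x))" for x
  have h2: "((\<lambda>x. - (f1 x * (h x * h x))) has_vector_derivative h2 x) (at x)" for x
    unfolding h2_def by (intro has_vector_derivative_minus has_vector_derivative_mult F h)
  have hc: "continuous_on UNIV h" using h by (rule has_vector_derivative_imp_continuous_on)
  \<comment> \<open>Since \<open>B / c\<close> is at least 1, it is absorbed into its square; the
    factor 2 in the rate then covers both terms of the second derivative.\<close>
  have k: "2 * B / c \<ge> B / c" "2 * B / c \<ge> 0" and k2: "2 * (B / c)\<^sup>2 + B / c \<le> (2 * B / c)\<^sup>2"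
  proof -
    have q: "B / c \<ge> 1" using cB c by simp
    then show "2 * B / c \<ge> B / c" "2 * B / c \<ge> 0" by auto
    have "1 * (B / c) \<le> (B / c) * (B / c)" using q by (intro mult_right_mono) auto
    then have "B / c \<le> (B / c)\<^sup>2" by (simp add: power2_eq_square)
    moreover have "0 \<le> (B / c)\<^sup>2" by simp
    ultimately have "2 * (B / c)\<^sup>2 + B / c \<le> 4 * (B / c)\<^sup>2" by linarith
    then show "2 * (B / c)\<^sup>2 + B / c \<le> (2 * B / c)\<^sup>2" by (simp add: power2_eq_square)
  qed
  have B0: "0 \<le> B" using cB c by simp
  have c0: "0 \<le> 1 / c" using c by simp
  have "C2_bounded h (\<lambda>x. - (f1 x * (h x * h x))) h2 (\<lambda>_. 1 / c) (\<lambda>x. 2 * B / c * L x)"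
    unfolding C2_bounded_def
  proof (intro conjI allI h h2 hb)
    show "continuous_on UNIV h2"
      unfolding h2_def[abs_def] by (intro continuous_intros hc C2_bounded_continuous[OF f])
    fix x
    have L0: "0 \<le> L x" by (rule F)
    show "0 \<le> 2 * B / c * L x" using L0 k(2) by (rule mult_nonneg_nonneg[rotated])
    have hh: "cmod (h x * h x) \<le> 1 / c * (1 / c)"
      unfolding norm_mult by (intro mult_mono hb c0 norm_ge_zero)
    have a: "cmod (f1 x * (h x * h x)) \<le> (B * L x) * (1 / c * (1 / c))"
      unfolding norm_mult[of "f1 x"] using B0 L0 by (intro mult_mono F hh norm_ge_zero) auto
    also have "\<dots> = 1 / c * (B / c * L x)" using c by (simp add: field_simps)
    also have "\<dots> \<le> 1 / c * (2 * B / c * L x)"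
      using k L0 c0 by (intro mult_left_mono mult_right_mono) auto
    finally show "cmod (- (f1 x * (h x * h x))) \<le> 1 / c * (2 * B / c * L x)" by simp
    have "cmod (f1 x * (h x * - (f1 x * (h x * h x)) + - (f1 x * (h x * h x)) * h x))
        = cmod (f1 x) * (2 * cmod (h x * (f1 x * (h x * h x))))"
    proof -
      have "h x * - (f1 x * (h x * h x)) + - (f1 x * (h x * h x)) * h x = (- 2) * (h x * (f1 x * (h x * h x)))"
        by (simp add: algebra_simps)
      then show ?thesis by (simp only: norm_mult) simp
    qed
    also have "\<dots> \<le> (B * L x) * (2 * (1 / c * ((B * L x) * (1 / c * (1 / c)))))"
      unfolding norm_mult[of "h x"  "f1 x * (h x * h x)"] using B0 L0 c0
      by (intro mult_mono F a hb mult_nonneg_nonneg norm_ge_zero order_refl) auto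
    finally have b: "cmod (f1 x * (h x * - (f1 x * (h x * h x)) + - (f1 x * (h x * h x)) * h x)) \<le>
      (B * L x) * (2 * (1 / c * ((B * L x) * (1 / c * (1 / c)))))" .
    have d: "cmod (f2 x * (h x * h x)) \<le> (B * (L x)\<^sup>2) * (1 / c * (1 / c))"
      unfolding norm_mult[of "f2 x"] using B0 L0 by (intro mult_mono F hh norm_ge_zero) auto
    have "cmod (h2 x) \<le> (B * L x) * (2 * (1 / c * ((B * L x) * (1 / c * (1 / c))))) + (B * (L x)\<^sup>2) * (1 / c * (1 / c))"
      unfolding h2_def norm_minus_cancel by (intro norm_triangle_mono b d)
    also have "\<dots> = 1 / c * ((2 * (B / c)\<^sup>2 + B / c) * (L x)\<^sup>2)"
      using c by (simp add: field_simps power2_eq_square)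
    also have "\<dots> \<le> 1 / c * ((2 * B / c)\<^sup>2 * (L x)\<^sup>2)"
      using k2 c0 by (intro mult_left_mono mult_right_mono) auto
    finally show "cmod (h2 x)
       \<le> 1 / c * (2 * B / c * L x)\<^sup>2" by (simp only: power_mult_distrib)
  qed
  then show thesis unfolding h_def by (rule that)
qed

lemma C2_vderiv:
  assumes "C2 f"
  shows "(f has_vector_derivative vderiv f x) (at x)" "(vderiv f has_vector_derivative vderiv (vderiv f) x) (at x)"
    "continuous_on UNIV (vderiv (vderiv f))"
proof -
  have *: "(\<forall>x. (g has_vector_derivative vderiv g x) (at x)) \<and> continuous_on UNIV (vderiv g)"
    if "g C1_differentiable_on UNIV" for g
  proof -
    obtain D where D: "\<And>x. (g has_vector_derivative D x) (at x)" "continuous_on UNIV D"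
      using \<open>g C1_differentiable_on UNIV\<close> by (auto simp: C1_differentiable_on_def)
    have "vderiv g = D" unfolding vderiv_def using D(1) by (intro ext vector_derivative_at)
    then show ?thesis using D by simp
  qed
  show "(f has_vector_derivative vderiv f x) (at x)" "(vderiv f has_vector_derivative vderiv (vderiv f) x) (at x)"
    "continuous_on UNIV (vderiv (vderiv f))"
    using assms * unfolding C2_def by blast+
qed

lemma C2_decay_bounded:
  assumes "C2 f" and d: "\<And>l x. l \<in> {0, 1, 2::nat} \<Longrightarrow> cmod ((vderiv ^^ l) f x) \<le> C * (1 + \<bar>x\<bar>) powr (- r)"
  shows "C2_bounded f (vderiv f) (vderiv (vderiv f)) (\<lambda>x. C * (1 + \<bar>x\<bar>) powr (- r)) (\<lambda>_. 1)"
  unfolding C2_bounded_def using C2_vderiv[OF assms(1)] d[of 0] d[of 1] d[of 2]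
  by (auto simp: numeral_2_eq_2)

section \<open>The symbol\<close>

text \<open>The factor \<open>beta \<alpha> \<omega>\<close> normalises it in both variables: for
  \<open>q > 1\<close> the integral over \<xi> is a constant, and that over \<omega> is
  bounded.\<close>

definition envelope :: "real \<Rightarrow> real \<Rightarrow> real \<Rightarrow> real \<Rightarrow> real" where
  "envelope \<alpha> q \<xi> \<omega> = beta \<alpha> \<omega> * (1 + beta \<alpha> \<omega> * \<bar>\<xi> - \<omega>\<bar>) powr (- q)"

lemma envelope_nonneg [simp]: "0 \<le> envelope \<alpha> q \<xi> \<omega>"
  by (simp add: envelope_def less_imp_le)

lemma envelope_measurable [measurable (raw)]:
  assumes "f \<in> borel_measurable M" "g \<in> borel_measurable M"
  shows "(\<lambda>x. envelope \<alpha> q (f x) (g x)) \<in> borel_measurable M"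
  unfolding envelope_def using assms by measurable

lemma envelope_bound:
  assumes \<alpha>: "0 \<le> \<alpha>" "\<alpha> < 1" and q: "q > 1"
  obtains D where "D \<ge> 0" "\<And>\<xi>. integrable lborel (envelope \<alpha> q \<xi>)" "\<And>\<xi>. (\<integral>\<omega>. envelope \<alpha> q \<xi> \<omega> \<partial>lborel) \<le> D"
    "\<And>\<xi>. (\<integral>\<^sup>+\<omega>. ennreal (envelope \<alpha> q \<xi> \<omega>) \<partial>lborel) \<le> ennreal D"
proof -
  obtain D where D: "D \<ge> 0" "\<And>\<xi>. (\<integral>\<^sup>+\<omega>. ennreal (envelope \<alpha> q \<xi> \<omega>) \<partial>lborel) \<le> ennreal D"
    using beta_integral_bound[OF assms] unfolding envelope_def by blast
  have i: "integrable lborel (envelope \<alpha> q \<xi>)" for \<xi>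
    using D(2)[of \<xi>] by (auto simp: integrable_iff_bounded intro: le_less_trans)
  have "ennreal (\<integral>\<omega>. envelope \<alpha> q \<xi> \<omega> \<partial>lborel) \<le> ennreal D" for \<xi>
    using D(2)[of \<xi>] by (subst nn_integral_eq_integral[symmetric, OF i]) auto
  then show thesis using D i by (intro that[of D]) auto
qed

text \<open>\<open>k = 1\<close> covers the symbol itself; the chain rule contributes one more
  \<open>beta \<alpha> \<omega>\<close> per derivative in \<xi>, which the exponent \<open>k\<close>
  records.\<close>

definition beta_avg :: "real \<Rightarrow> nat \<Rightarrow> (real \<Rightarrow> complex) \<Rightarrow> real \<Rightarrow> complex" where
  "beta_avg \<alpha> k g \<xi> = (\<integral>\<omega>. complex_of_real (beta \<alpha> \<omega> ^ k) * g (beta \<alpha> \<omega> * (\<xi> - \<omega>)) \<partial>lborel)"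

lemma beta_avg_integrand_le:
  assumes \<alpha>: "0 \<le> \<alpha>" and g: "\<And>y. cmod (g y) \<le> B * (1 + \<bar>y\<bar>) powr (- t)"
  shows "cmod (complex_of_real (beta \<alpha> \<omega> ^ Suc j) * g (beta \<alpha> \<omega> * (\<xi> - \<omega>))) \<le> B * beta \<alpha> \<omega> ^ j * envelope \<alpha> t \<xi> \<omega>"
proof -
  let ?f = "\<lambda>\<omega>. complex_of_real (beta \<alpha> \<omega> ^ Suc j) * g (beta \<alpha> \<omega> * (\<xi> - \<omega>))"
  have "cmod (?f \<omega>)
      \<le> beta \<alpha> \<omega> ^ Suc j * (B * (1 + \<bar>beta \<alpha> \<omega> * (\<xi> - \<omega>)\<bar>) powr (- t))"
    unfolding norm_mult norm_of_real
    by (intro mult_mono g) (auto simp: less_imp_le)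
  also have "\<dots> = B * beta \<alpha> \<omega> ^ j * envelope \<alpha> t \<xi> \<omega>"
    by (simp add: envelope_def abs_mult less_imp_le)
  finally show ?thesis .
qed

lemma beta_avg_integrable:
  assumes \<alpha>: "0 \<le> \<alpha>" "\<alpha> < 1" and t: "t > 1"
    and [measurable]: "g \<in> borel_measurable borel" and g: "\<And>y. cmod (g y) \<le> B * (1 + \<bar>y\<bar>) powr (- t)"
  shows "integrable lborel (\<lambda>\<omega>. complex_of_real (beta \<alpha> \<omega> ^ Suc j) * g (beta \<alpha> \<omega> * (\<xi> - \<omega>)))"
proof (rule Bochner_Integration.integrable_bound)
  let ?f = "\<lambda>\<omega>. complex_of_real (beta \<alpha> \<omega> ^ Suc j) * g (beta \<alpha> \<omega> * (\<xi> - \<omega>))"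
  have B: "0 \<le> B" using order_trans[OF norm_ge_zero g[of 0]] by simp
  show "integrable lborel (\<lambda>\<omega>. B * envelope \<alpha> t \<xi> \<omega>)"
    using envelope_bound[OF \<alpha> t] by (metis integrable_mult_right)
  show "AE \<omega> in lborel. cmod (?f \<omega>) \<le> norm (B * envelope \<alpha> t \<xi> \<omega>)"
  proof (intro AE_I2)
    fix \<omega>
    have "B * beta \<alpha> \<omega> ^ j * envelope \<alpha> t \<xi> \<omega> \<le> B * 1 * envelope \<alpha> t \<xi> \<omega>"
      using B beta_le_1[OF \<alpha>(1)] by (intro mult_right_mono mult_left_mono power_le_one) (auto simp: less_imp_le)
    then show "cmod (?f \<omega>) \<le> norm (B * envelope \<alpha> t \<xi> \<omega>)"
      using beta_avg_integrand_le[OF \<alpha>(1) g, of \<omega> j \<xi>] B by simp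
  qed
qed measurable

text \<open>The surplus \<open>beta \<alpha> \<omega> ^ j\<close> is exchanged for
  \<open>beta \<alpha> \<xi> ^ j\<close> at the price of \<open>u powr (j * \<alpha>)\<close>. For
  \<open>j \<le> 2\<close> this uses up at most \<open>2 * \<alpha>\<close> of the decay, whence the
  condition on \<open>t\<close>. One \<open>D\<close> serves all \<open>g\<close>.\<close>

lemma beta_avg_bound:
  assumes \<alpha>: "0 \<le> \<alpha>" "\<alpha> < 1" and t: "t > 1 + 2 * \<alpha>"
  obtains D where "D \<ge> 0" and "\<And>g B \<xi> j. j \<le> 2 \<Longrightarrow> g \<in> borel_measurable borel \<Longrightarrow>
      (\<And>y. cmod (g y) \<le> B * (1 + \<bar>y\<bar>) powr (- t)) \<Longrightarrow> cmod (beta_avg \<alpha> (Suc j) g \<xi>) \<le> B * D * beta \<alpha> \<xi> ^ j"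
proof -
  have t': "t - 2 * \<alpha> > 1" "t > 1" using t \<alpha> by auto
  obtain D where D: "D \<ge> 0" "\<And>\<xi>. integrable lborel (envelope \<alpha> (t - 2 * \<alpha>) \<xi>)"
     "\<And>\<xi>. (\<integral>\<omega>. envelope \<alpha> (t - 2 * \<alpha>) \<xi> \<omega> \<partial>lborel) \<le> D"
    using envelope_bound[OF \<alpha> t'(1)] by metis
  show thesis
  proof (rule that[OF D(1)])
    fix g :: "real \<Rightarrow> complex" and B \<xi> and j :: nat
    assume j: "j \<le> 2" and [measurable]: "g \<in> borel_measurable borel" and g: "\<And>y. cmod (g y) \<le> B * (1 + \<bar>y\<bar>) powr (- t)"
    have B: "0 \<le> B" using order_trans[OF norm_ge_zero g[of 0]] by simp
    have pt: "cmod (complex_of_real (beta \<alpha> \<omega> ^ Suc j) * g (beta \<alpha> \<omega> * (\<xi> - \<omega>))) \<le> (B * beta \<alpha> \<xi> ^ j) * envelope \<alpha> (t - 2 * \<alpha>) \<xi> \<omega>" for \<omega>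
    proof -
      define u where "u = 1 + beta \<alpha> \<omega> * \<bar>\<xi> - \<omega>\<bar>"
      have u: "u \<ge> 1" by (simp add: u_def less_imp_le)
      have "beta \<alpha> \<omega> ^ j \<le> (beta \<alpha> \<xi> * u powr \<alpha>) ^ j"
        unfolding u_def by (intro power_mono beta_le_upper \<alpha>) (simp add: less_imp_le)
      also have "\<dots> = beta \<alpha> \<xi> ^ j * u powr (real j * \<alpha>)"
        using u by (simp add: power_mult_distrib powr_power mult.commute)
      also have "\<dots> \<le> beta \<alpha> \<xi> ^ j * u powr (2 * \<alpha>)"
        using u j \<alpha> by (intro mult_left_mono powr_mono mult_right_mono) (auto simp: less_imp_le)
      finally have "B * beta \<alpha> \<omega> ^ j * envelope \<alpha> t \<xi> \<omega> \<le> B * (beta \<alpha> \<xi> ^ j * u powr (2 * \<alpha>)) * envelope \<alpha> t \<xi> \<omega>"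
        using B by (intro mult_right_mono mult_left_mono) auto
      also have "\<dots> = (B * beta \<alpha> \<xi> ^ j) * envelope \<alpha> (t - 2 * \<alpha>) \<xi> \<omega>"
        using u powr_add[of u "2 * \<alpha>" "- t"] by (simp add: envelope_def u_def[symmetric])
      finally show ?thesis using beta_avg_integrand_le[OF \<alpha>(1) g, of \<omega> j \<xi>] by linarith
    qed
    have "cmod (beta_avg \<alpha> (Suc j) g \<xi>) \<le> (\<integral>\<omega>. (B * beta \<alpha> \<xi> ^ j) * envelope \<alpha> (t - 2 * \<alpha>) \<xi> \<omega> \<partial>lborel)"
      unfolding beta_avg_def
      by (intro Bochner_Integration.integral_norm_bound_integral beta_avg_integrable[OF \<alpha> t'(2) _ g] integrable_mult_right D pt) auto
    also have "\<dots> \<le> (B * beta \<alpha> \<xi> ^ j) * D"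
      using D(3)[of \<xi>] B by (simp add: mult_left_mono less_imp_le)
    finally show "cmod (beta_avg \<alpha> (Suc j) g \<xi>) \<le> B * D * beta \<alpha> \<xi> ^ j" by (simp add: mult_ac)
  qed
qed

text \<open>Moving the centre by at most \<open>R\<close> costs a constant independent of \<omega>,
  because \<open>b \<le> 1\<close>. This yields integrable majorants for convergent sequences of
  frequencies.\<close>

lemma decay_shift:
  fixes b R t :: real
  assumes b: "0 \<le> b" "b \<le> 1" and R: "\<bar>s - \<xi>\<bar> \<le> R" and t: "0 \<le> t"
  shows "(1 + b * \<bar>s - \<omega>\<bar>) powr (- t) \<le> (1 + R) powr t * (1 + b * \<bar>\<xi> - \<omega>\<bar>) powr (- t)"
proof -
  have R0: "0 \<le> R" using R by linarith
  have "b * \<bar>\<xi> - \<omega>\<bar> \<le> b * (\<bar>s - \<omega>\<bar> + R)" using R b by (intro mult_left_mono) auto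
  also have "\<dots> \<le> b * \<bar>s - \<omega>\<bar> + R" using b R0 by (simp add: distrib_left mult_left_le_one_le)
  also have "1 + \<dots> \<le> (1 + R) * (1 + b * \<bar>s - \<omega>\<bar>)" using b R0 by (simp add: algebra_simps)
  finally have "(1 + b * \<bar>\<xi> - \<omega>\<bar>) powr t \<le> ((1 + R) * (1 + b * \<bar>s - \<omega>\<bar>)) powr t"
    using b t by (intro powr_mono2) auto
  also have "\<dots> = (1 + R) powr t * (1 + b * \<bar>s - \<omega>\<bar>) powr t"
    using b R0 by (simp add: powr_mult)
  finally have le: "(1 + b * \<bar>\<xi> - \<omega>\<bar>) powr t \<le> (1 + R) powr t * (1 + b * \<bar>s - \<omega>\<bar>) powr t" .
  have "1 + b * \<bar>s - \<omega>\<bar> > 0" "1 + b * \<bar>\<xi> - \<omega>\<bar> > 0" using b by (auto intro: add_pos_nonneg)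
  then have "(1 + b * \<bar>s - \<omega>\<bar>) powr t > 0" "(1 + b * \<bar>\<xi> - \<omega>\<bar>) powr t > 0" by auto
  with le show ?thesis unfolding powr_minus by (simp add: field_simps)
qed

lemma convergent_bounded_distance:
  fixes X :: "nat \<Rightarrow> real"
  assumes "X \<longlonglongrightarrow> \<xi>" obtains R where "R > 0" "\<And>i. \<bar>X i - \<xi>\<bar> \<le> R"
proof -
  have "(\<lambda>i. X i - \<xi>) \<longlonglongrightarrow> \<xi> - \<xi>" using assms by (intro tendsto_diff) auto
  then have "Bseq (\<lambda>i. X i - \<xi>)" using convergentI convergent_imp_Bseq by blast
  then show thesis using that by (auto simp: Bseq_def)
qed

lemma beta_avg_continuous:
  assumes \<alpha>: "0 \<le> \<alpha>" "\<alpha> < 1" and t: "t > 1" and c: "continuous_on UNIV g"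
    and g: "\<And>y. cmod (g y) \<le> B * (1 + \<bar>y\<bar>) powr (- t)"
  shows "continuous_on UNIV (beta_avg \<alpha> (Suc j) g)"
  unfolding continuous_on_sequentially
proof (intro allI ballI impI)
  let ?f = "\<lambda>\<omega> y. complex_of_real (beta \<alpha> \<omega> ^ Suc j) * g (beta \<alpha> \<omega> * (y - \<omega>))"
  fix X :: "nat \<Rightarrow> real" and \<xi> assume X: "(\<forall>n. X n \<in> UNIV) \<and> X \<longlonglongrightarrow> \<xi>"
  have B: "0 \<le> B" using order_trans[OF norm_ge_zero g[of 0]] by simp
  have [measurable]: "g \<in> borel_measurable borel" using c by (rule borel_measurable_continuous_onI)
  have gc: "isCont g y" for y using c by (simp add: continuous_on_eq_continuous_at)
  obtain R where R: "R > 0" "\<And>i. \<bar>X i - \<xi>\<bar> \<le> R" using convergent_bounded_distance X by blast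
  have "(\<lambda>n. beta_avg \<alpha> (Suc j) g (X n)) \<longlonglongrightarrow> beta_avg \<alpha> (Suc j) g \<xi>"
    unfolding beta_avg_def
  proof (rule integral_dominated_convergence[where w = "\<lambda>\<omega>. B * (1 + R) powr t * envelope \<alpha> t \<xi> \<omega>"])
    show "integrable lborel (\<lambda>\<omega>. B * (1 + R) powr t * envelope \<alpha> t \<xi> \<omega>)"
      using envelope_bound[OF \<alpha> t] by (metis integrable_mult_right)
    show "AE \<omega> in lborel. (\<lambda>n. ?f \<omega> (X n))
        \<longlonglongrightarrow> ?f \<omega> \<xi>"
      using X by (intro AE_I2 tendsto_mult tendsto_const isCont_tendsto_compose[OF gc] tendsto_diff) auto
    fix n
    show "AE \<omega> in lborel. cmod (?f \<omega> (X n))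
       \<le> B * (1 + R) powr t * envelope \<alpha> t \<xi> \<omega>"
    proof (intro AE_I2)
      fix \<omega>
      have b: "0 \<le> beta \<alpha> \<omega>" "beta \<alpha> \<omega> \<le> 1" using beta_le_1[OF \<alpha>(1)] by (auto simp: less_imp_le)
      note beta_avg_integrand_le[OF \<alpha>(1) g, of \<omega> j "X n"]
      also have "B * beta \<alpha> \<omega> ^ j * envelope \<alpha> t (X n) \<omega> \<le> B * 1 * envelope \<alpha> t (X n) \<omega>"
        using B b by (intro mult_right_mono mult_left_mono power_le_one) auto
      also have "\<dots> \<le> B * 1 * (beta \<alpha> \<omega> * ((1 + R) powr t * (1 + beta \<alpha> \<omega> * \<bar>\<xi> - \<omega>\<bar>) powr (- t)))"
        unfolding envelope_def using B b R(2)[of n] t by (intro mult_left_mono decay_shift) auto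
      finally show "cmod (?f \<omega> (X n))
        \<le> B * (1 + R) powr t * envelope \<alpha> t \<xi> \<omega>"
        by (simp add: envelope_def mult_ac)
    qed
  qed measurable
  then show "(beta_avg \<alpha> (Suc j) g \<circ> X) \<longlonglongrightarrow> beta_avg \<alpha> (Suc j) g \<xi>" by (simp add: o_def)
qed

text \<open>Differentiation under the integral sign: the remainder of the difference quotient is
  integrated by dominated convergence, along sequences tending to \<xi>.\<close>

lemma beta_avg_derivative:
  assumes \<alpha>: "0 \<le> \<alpha>" "\<alpha> < 1" and t: "t > 1"
    and d: "\<And>y. (g has_vector_derivative g' y) (at y)" and [measurable]: "g' \<in> borel_measurable borel"
    and g: "\<And>y. cmod (g y) \<le> B * (1 + \<bar>y\<bar>) powr (- t)" and g': "\<And>y. cmod (g' y) \<le> B * (1 + \<bar>y\<bar>) powr (- t)"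
  shows "(beta_avg \<alpha> (Suc j) g has_vector_derivative beta_avg \<alpha> (Suc (Suc j)) g' \<xi>) (at \<xi>)"
proof -
  have B: "0 \<le> B" using order_trans[OF norm_ge_zero g[of 0]] by simp
  have [measurable]: "g \<in> borel_measurable borel"
    using has_vector_derivative_imp_continuous_on[OF d] by (rule borel_measurable_continuous_onI)
  define b where "b \<omega> = beta \<alpha> \<omega>" for \<omega>
  have b: "0 < b \<omega>" "b \<omega> \<le> 1" for \<omega> using beta_le_1[OF \<alpha>(1)] by (auto simp: b_def)
  have [measurable]: "b \<in> borel_measurable borel" unfolding b_def by measurable
  define \<phi> where "\<phi> \<omega> s = g (b \<omega> * (s - \<omega>))" for \<omega> s
  define \<phi>' where "\<phi>' \<omega> s = b \<omega> *\<^sub>R g' (b \<omega> * (s - \<omega>))" for \<omega> s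
  have d\<phi>: "(\<phi> \<omega> has_vector_derivative \<phi>' \<omega> s) (at s)" for \<omega> s
  proof -
    have "((\<lambda>s. b \<omega> * (s - \<omega>)) has_vector_derivative b \<omega>) (at s)"
      by (auto intro!: derivative_eq_intros simp: has_real_derivative_iff_has_vector_derivative[symmetric])
    from vector_diff_chain_at[OF this d] show ?thesis by (simp add: \<phi>_def[abs_def] \<phi>'_def o_def)
  qed
  have int1: "integrable lborel (\<lambda>\<omega>. complex_of_real (b \<omega> ^ Suc j) * \<phi> \<omega> s)" for s
    unfolding \<phi>_def b_def by (rule beta_avg_integrable[OF \<alpha> t _ g]) measurable
  have eq2: "complex_of_real (b \<omega> ^ Suc j) * \<phi>' \<omega> s = complex_of_real (b \<omega> ^ Suc (Suc j)) * g' (b \<omega> * (s - \<omega>))" for \<omega> s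
    by (simp add: \<phi>'_def scaleR_conv_of_real)
  have int2: "integrable lborel (\<lambda>\<omega>. complex_of_real (b \<omega> ^ Suc j) * \<phi>' \<omega> s)" for s
    unfolding eq2 unfolding b_def by (rule beta_avg_integrable[OF \<alpha> t _ g']) measurable
  let ?q = "\<lambda>y. ((beta_avg \<alpha> (Suc j) g y - beta_avg \<alpha> (Suc j) g \<xi>) - (y - \<xi>) *\<^sub>R beta_avg \<alpha> (Suc (Suc j)) g' \<xi>) /\<^sub>R norm (y - \<xi>)"
  have "(?q \<longlongrightarrow> 0) (at \<xi>)"
    unfolding tendsto_at_iff_sequentially
  proof (intro allI impI)
    fix X :: "nat \<Rightarrow> real" assume X: "\<forall>i. X i \<in> UNIV - {\<xi>}" "X \<longlonglongrightarrow> \<xi>"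
    obtain R where R: "R > 0" "\<And>i. \<bar>X i - \<xi>\<bar> \<le> R" using convergent_bounded_distance[OF X(2)] by blast
    \<comment> \<open>The first-order remainder of the integrand. By linearity its integral is the
      remainder quotient of the average.\<close>
    define Q where "Q i \<omega> = complex_of_real (b \<omega> ^ Suc j) * (((\<phi> \<omega> (X i) - \<phi> \<omega> \<xi>) - (X i - \<xi>) *\<^sub>R \<phi>' \<omega> \<xi>) /\<^sub>R norm (X i - \<xi>))" for i \<omega>
    have Qint: "?q (X i)
        = (\<integral>\<omega>. Q i \<omega> \<partial>lborel)" for i
    proof -
      have avg: "beta_avg \<alpha> (Suc j) g s = (\<integral>\<omega>. complex_of_real (b \<omega> ^ Suc j) * \<phi> \<omega> s \<partial>lborel)"
        "beta_avg \<alpha> (Suc (Suc j)) g' s = (\<integral>\<omega>. complex_of_real (b \<omega> ^ Suc j) * \<phi>' \<omega> s \<partial>lborel)" for s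
        unfolding beta_avg_def eq2 by (simp_all add: \<phi>_def b_def)
      have "(\<integral>\<omega>. Q i \<omega> \<partial>lborel) = (\<integral>\<omega>. ((complex_of_real (b \<omega> ^ Suc j) * \<phi> \<omega> (X i) - complex_of_real (b \<omega> ^ Suc j) * \<phi> \<omega> \<xi>)
          - (X i - \<xi>) *\<^sub>R (complex_of_real (b \<omega> ^ Suc j) * \<phi>' \<omega> \<xi>)) /\<^sub>R norm (X i - \<xi>) \<partial>lborel)"
        unfolding Q_def
        by (intro Bochner_Integration.integral_cong refl)
           (simp add: mult_scaleR_right right_diff_distrib)
      also have "\<dots> = ?q (X i)"
        unfolding avg using int1[of "X i"] int1[of \<xi>] int2[of \<xi>]
        by (simp only: integral_scaleR_right Bochner_Integration.integral_diff Bochner_Integration.integrable_diff integrable_scaleR_right)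
      finally show ?thesis by simp
    qed
    have "(\<lambda>i. \<integral>\<omega>. Q i \<omega> \<partial>lborel) \<longlonglongrightarrow> (\<integral>(\<omega>::real). 0 \<partial>lborel)"
    proof (rule integral_dominated_convergence[where w = "\<lambda>\<omega>. (2 * B * (1 + R) powr t) * envelope \<alpha> t \<xi> \<omega>"])
      show "Q i \<in> borel_measurable lborel" for i unfolding Q_def \<phi>_def \<phi>'_def by measurable
      show "integrable lborel (\<lambda>\<omega>. (2 * B * (1 + R) powr t) * envelope \<alpha> t \<xi> \<omega>)"
        using envelope_bound[OF \<alpha> t] by (metis integrable_mult_right)
      show "AE \<omega> in lborel. (\<lambda>i. Q i \<omega>) \<longlonglongrightarrow> 0"
      proof (intro AE_I2)
        fix \<omega>
        have "((\<lambda>y. ((\<phi> \<omega> y - \<phi> \<omega> \<xi>) - (y - \<xi>) *\<^sub>R \<phi>' \<omega> \<xi>) /\<^sub>R norm (y - \<xi>)) \<longlongrightarrow> 0) (at \<xi>)"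
          using d\<phi>[of \<omega> \<xi>] unfolding has_vector_derivative_def has_derivative_at_within by simp
        then have "(\<lambda>i. ((\<phi> \<omega> (X i) - \<phi> \<omega> \<xi>) - (X i - \<xi>) *\<^sub>R \<phi>' \<omega> \<xi>) /\<^sub>R norm (X i - \<xi>)) \<longlonglongrightarrow> 0"
          using X unfolding tendsto_at_iff_sequentially o_def by blast
        then show "(\<lambda>i. Q i \<omega>) \<longlonglongrightarrow> 0" unfolding Q_def by (rule tendsto_mult_right_zero)
      qed
      show "AE \<omega> in lborel. cmod (Q i \<omega>) \<le> (2 * B * (1 + R) powr t) * envelope \<alpha> t \<xi> \<omega>" for i
      proof (intro AE_I2)
        fix \<omega>
        \<comment> \<open>Bounds \<open>\<phi>' \<omega>\<close> on the whole interval of radius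
          \<open>R\<close> about \<xi>. The mean value inequality then bounds the remainder by
          \<open>2 * M\<close> times the step, uniformly in \<open>i\<close>.\<close>
        define M where "M = b \<omega> * (B * ((1 + R) powr t * (1 + b \<omega> * \<bar>\<xi> - \<omega>\<bar>) powr (- t)))"
        have M0: "M \<ge> 0" unfolding M_def using B b[of \<omega>] by (simp add: less_imp_le)
        have near: "cmod (\<phi>' \<omega> s) \<le> M" if "\<bar>s - \<xi>\<bar> \<le> R" for s
        proof -
          have *: "(1 + b \<omega> * \<bar>s - \<omega>\<bar>) powr (- t) \<le> (1 + R) powr t * (1 + b \<omega> * \<bar>\<xi> - \<omega>\<bar>) powr (- t)"
            using b[of \<omega>] t that by (intro decay_shift) (auto simp: less_imp_le)
          have "cmod (\<phi>' \<omega> s) \<le> b \<omega> * (B * (1 + \<bar>b \<omega> * (s - \<omega>)\<bar>) powr (- t))"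
            unfolding \<phi>'_def using b[of \<omega>] g'[of "b \<omega> * (s - \<omega>)"] by (simp add: mult_left_mono)
          also have "\<dots> = b \<omega> * (B * (1 + b \<omega> * \<bar>s - \<omega>\<bar>) powr (- t))" using b[of \<omega>] by (simp add: abs_mult)
          also have "\<dots> \<le> M" unfolding M_def using b[of \<omega>] B * by (intro mult_left_mono) auto
          finally show ?thesis .
        qed
        have "norm (\<phi> \<omega> (X i) - \<phi> \<omega> \<xi> - (X i - \<xi>) *\<^sub>R \<phi>' \<omega> \<xi>) \<le> norm (X i - \<xi>) * (2 * M)"
        proof (rule vector_differentiable_bound_linearization[where S = "closed_segment \<xi> (X i)"])
          show "(\<phi> \<omega> has_vector_derivative \<phi>' \<omega> x) (at x within closed_segment \<xi> (X i))" for x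
            by (rule has_vector_derivative_at_within[OF d\<phi>])
          fix x assume "x \<in> closed_segment \<xi> (X i)"
          then have "\<bar>x - \<xi>\<bar> \<le> R" using R(2)[of i] by (auto simp: closed_segment_eq_real_ivl split: if_splits)
          then show "cmod (\<phi>' \<omega> x - \<phi>' \<omega> \<xi>) \<le> 2 * M"
            using norm_triangle_ineq4[of "\<phi>' \<omega> x" "\<phi>' \<omega> \<xi>"] near[of x] near[of \<xi>] R(1) by simp
        qed auto
        moreover have "norm (X i - \<xi>) > 0" using X(1) by auto
        moreover have "norm (v /\<^sub>R n) \<le> K" if "norm v \<le> n * K" "n > 0" for v :: complex and n K
          using that by (simp add: field_simps)
        ultimately have *: "norm ((\<phi> \<omega> (X i) - \<phi> \<omega> \<xi> - (X i - \<xi>) *\<^sub>R \<phi>' \<omega> \<xi>) /\<^sub>R norm (X i - \<xi>)) \<le> 2 * M"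
          by blast
        have "cmod (Q i \<omega>) \<le> b \<omega> ^ Suc j * (2 * M)"
          unfolding Q_def norm_mult[of "complex_of_real _"] norm_of_real
          using b[of \<omega>] by (intro mult_mono *) (auto simp: abs_mult)
        also have "\<dots> \<le> 1 * (2 * M)" using b[of \<omega>] M0 by (intro mult_right_mono power_le_one) (auto simp: less_imp_le)
        also have "\<dots> = (2 * B * (1 + R) powr t) * envelope \<alpha> t \<xi> \<omega>"
          by (simp add: M_def envelope_def b_def)
        finally show "cmod (Q i \<omega>) \<le> (2 * B * (1 + R) powr t) * envelope \<alpha> t \<xi> \<omega>" .
      qed
    qed auto
    then show "(?q \<circ> X) \<longlonglongrightarrow> 0"
      unfolding o_def Qint by simp
  qed
  then show ?thesis
    unfolding has_vector_derivative_def has_derivative_at_within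
    by (simp add: bounded_linear_scaleR_left)
qed

section \<open>Smoothness and positivity of the symbol\<close>

definition symbol :: "real \<Rightarrow> (real \<Rightarrow> complex) \<Rightarrow> real \<Rightarrow> real" where
  "symbol \<alpha> F \<xi> = (\<integral>\<omega>. beta \<alpha> \<omega> * (cmod (F (beta \<alpha> \<omega> * (\<xi> - \<omega>))))\<^sup>2 \<partial>lborel)"

lemma symbol_beta_avg: "complex_of_real (symbol \<alpha> F \<xi>) = beta_avg \<alpha> 1 (\<lambda>y. F y * cnj (F y)) \<xi>"
  unfolding symbol_def beta_avg_def
  by (simp flip: integral_complex_of_real add: complex_norm_square[symmetric])

lemma symbol_nonneg [simp]: "0 \<le> symbol \<alpha> F \<xi>"
  unfolding symbol_def by (intro integral_nonneg_AE AE_I2 mult_nonneg_nonneg) (auto simp: less_imp_le)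

text \<open>The squared modulus is treated as a product with the conjugate, which keeps it
  differentiable and doubles the decay to \<open>2 * r\<close>. Each derivative of the average then
  gains a factor \<open>beta \<alpha> \<xi>\<close>.\<close>

lemma symbol_C2_bounded:
  assumes \<alpha>: "0 \<le> \<alpha>" "\<alpha> < 1" and r: "2 * r > 1 + 2 * \<alpha>"
    and F: "C2_bounded F F1 F2 (\<lambda>\<xi>. C * (1 + \<bar>\<xi>\<bar>) powr (- r)) (\<lambda>_. 1)"
  obtains B m1 m2 where "C2_bounded (\<lambda>\<xi>. complex_of_real (symbol \<alpha> F \<xi>)) m1 m2 (\<lambda>_. B) (beta \<alpha>)"
proof -
  obtain g1 g2 where g: "C2_bounded (\<lambda>y. F y * cnj (F y)) g1 g2
      (\<lambda>\<xi>. (C * (1 + \<bar>\<xi>\<bar>) powr (- r)) * (C * (1 + \<bar>\<xi>\<bar>) powr (- r))) (\<lambda>_. 1 + 1)"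
    using C2_bounded_mult[OF F C2_bounded_cnj[OF F]] by blast
  \<comment> \<open>The 4 is the square of the rate \<open>1 + 1\<close> of the product, as it
    occurs in the second derivative.\<close>
  define B where "B = 4 * C\<^sup>2"
  have env: "(C * (1 + \<bar>\<xi>\<bar>) powr (- r)) * (C * (1 + \<bar>\<xi>\<bar>) powr (- r)) = C\<^sup>2 * (1 + \<bar>\<xi>\<bar>) powr (- (2 * r))" for \<xi> :: real
    using powr_add[of "1 + \<bar>\<xi>\<bar>" "-r" "-r"] by (simp add: power2_eq_square mult_ac)
  note G = C2_boundedD[OF g, unfolded env]
  have b: "cmod (F y * cnj (F y)) \<le> B * (1 + \<bar>y\<bar>) powr (- (2 * r))" "cmod (g1 y) \<le> B * (1 + \<bar>y\<bar>) powr (- (2 * r))"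
    "cmod (g2 y) \<le> B * (1 + \<bar>y\<bar>) powr (- (2 * r))" for y
  proof -
    have "0 \<le> C\<^sup>2 * (1 + \<bar>y\<bar>) powr (- (2 * r))" by simp
    then show "cmod (F y * cnj (F y)) \<le> B * (1 + \<bar>y\<bar>) powr (- (2 * r))" "cmod (g1 y) \<le> B * (1 + \<bar>y\<bar>) powr (- (2 * r))"
      "cmod (g2 y) \<le> B * (1 + \<bar>y\<bar>) powr (- (2 * r))"
      using G(5,6,7)[of y] unfolding B_def mult.assoc by (simp_all, linarith+)
  qed
  have t: "2 * r > 1" using r \<alpha> by simp
  note meas = C2_bounded_continuous[OF g, THEN borel_measurable_continuous_onI]
  have d1: "(beta_avg \<alpha> (Suc 0) (\<lambda>y. F y * cnj (F y)) has_vector_derivative beta_avg \<alpha> (Suc (Suc 0)) g1 \<xi>) (at \<xi>)" for \<xi>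
    by (rule beta_avg_derivative[OF \<alpha> t G(2) meas(2) b(1,2)])
  have d2: "(beta_avg \<alpha> (Suc (Suc 0)) g1 has_vector_derivative beta_avg \<alpha> (Suc (Suc (Suc 0))) g2 \<xi>) (at \<xi>)" for \<xi>
    by (rule beta_avg_derivative[OF \<alpha> t G(3) meas(3) b(2,3)])
  have d3: "continuous_on UNIV (beta_avg \<alpha> (Suc (Suc (Suc 0))) g2)"
    by (rule beta_avg_continuous[OF \<alpha> t G(1) b(3)])
  obtain D where D: "D \<ge> 0" "\<And>g B \<xi> j. j \<le> 2 \<Longrightarrow> g \<in> borel_measurable borel \<Longrightarrow>
      (\<And>y. cmod (g y) \<le> B * (1 + \<bar>y\<bar>) powr (- (2 * r))) \<Longrightarrow> cmod (beta_avg \<alpha> (Suc j) g \<xi>) \<le> B * D * beta \<alpha> \<xi> ^ j"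
    using beta_avg_bound[OF \<alpha> r] by metis
  have "C2_bounded (beta_avg \<alpha> (Suc 0) (\<lambda>y. F y * cnj (F y))) (beta_avg \<alpha> (Suc (Suc 0)) g1) (beta_avg \<alpha> (Suc (Suc (Suc 0))) g2)
      (\<lambda>_. B * D) (beta \<alpha>)"
    unfolding C2_bounded_def
  proof (intro conjI allI d1 d2 d3)
    fix \<xi>
    show "cmod (beta_avg \<alpha> (Suc 0) (\<lambda>y. F y * cnj (F y)) \<xi>) \<le> B * D" using D(2)[OF _ meas(1) b(1), of 0 \<xi>] by simp
    show "cmod (beta_avg \<alpha> (Suc (Suc 0)) g1 \<xi>) \<le> B * D * beta \<alpha> \<xi>" using D(2)[OF _ meas(2) b(2), of 1 \<xi>] by simp
    show "cmod (beta_avg \<alpha> (Suc (Suc (Suc 0))) g2 \<xi>) \<le> B * D * (beta \<alpha> \<xi>)\<^sup>2"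
      using D(2)[OF _ meas(3) b(3), of 2 \<xi>] by (simp add: numeral_2_eq_2)
  qed (simp add: less_imp_le)
  then show thesis by (intro that) (simp add: symbol_beta_avg)
qed

lemma symbol_integrable:
  assumes \<alpha>: "0 \<le> \<alpha>" "\<alpha> < 1" and r: "2 * r > 1" and [measurable]: "F \<in> borel_measurable borel"
    and F: "\<And>y. cmod (F y) \<le> C * (1 + \<bar>y\<bar>) powr (- r)"
  shows "integrable lborel (\<lambda>\<omega>. beta \<alpha> \<omega> * (cmod (F (beta \<alpha> \<omega> * (\<xi> - \<omega>))))\<^sup>2)"
proof -
  have "cmod (F y * cnj (F y)) \<le> C\<^sup>2 * (1 + \<bar>y\<bar>) powr (- (2 * r))" for y
  proof -
    have "cmod (F y * cnj (F y)) = (cmod (F y))\<^sup>2" by (simp add: norm_mult power2_eq_square)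
    also have "\<dots> \<le> (C * (1 + \<bar>y\<bar>) powr (- r))\<^sup>2" by (intro power_mono F) simp
    also have "\<dots> = C\<^sup>2 * (1 + \<bar>y\<bar>) powr (- (2 * r))" by (simp add: power_mult_distrib powr_power)
    finally show ?thesis .
  qed
  from integrable_Re[OF beta_avg_integrable[OF \<alpha> r _ this, of 0 \<xi>]]
  have "integrable lborel (\<lambda>\<omega>. Re (complex_of_real (beta \<alpha> \<omega> ^ Suc 0) * (F (beta \<alpha> \<omega> * (\<xi> - \<omega>)) * cnj (F (beta \<alpha> \<omega> * (\<xi> - \<omega>))))))"
    by simp
  moreover have "Re (complex_of_real (beta \<alpha> \<omega> ^ Suc 0) * (z * cnj z)) = beta \<alpha> \<omega> * (cmod z)\<^sup>2" for \<omega> z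
    unfolding complex_norm_square[symmetric] by (simp flip: of_real_power of_real_mult)
  ultimately show ?thesis by (simp only:)
qed

lemma symbol_measurable [measurable]:
  assumes [measurable]: "F \<in> borel_measurable borel"
  shows "symbol \<alpha> F \<in> borel_measurable borel"
  unfolding symbol_def[abs_def] by measurable

text \<open>As \<open>\<alpha> < 1\<close>, the phase is unbounded on both sides;
  \<open>frequency_ratio_lower\<close> says how far out to go, and the intermediate value theorem
  does the rest.\<close>

lemma beta_phase_surj:
  assumes \<alpha>: "0 \<le> \<alpha>" "\<alpha> < 1"
  obtains \<omega> where "beta \<alpha> \<omega> * (\<xi> - \<omega>) = y"
proof -
  \<comment> \<open>If the phase at \<omega> were smaller than \<open>\<bar>y\<bar>\<close> in
    modulus, the ratio estimate would give \<open>1 + \<bar>\<omega>\<bar> \<le> W\<close>, which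
    excludes \<open>\<bar>\<omega>\<bar> = W\<close>.\<close>
  define W where "W = (1 + \<bar>\<xi>\<bar>) * (1 + \<bar>y\<bar>) powr (1 / (1 - \<alpha>))"
  have "1 \<le> (1 + \<bar>y\<bar>) powr (1 / (1 - \<alpha>))" using \<alpha> by (intro ge_one_powr_ge_zero) auto
  then have "(1 + \<bar>\<xi>\<bar>) * 1 \<le> W" unfolding W_def by (intro mult_left_mono) auto
  then have W: "1 + \<bar>\<xi>\<bar> \<le> W" by simp
  have far: "\<bar>y\<bar> \<le> beta \<alpha> \<omega> * \<bar>\<xi> - \<omega>\<bar>" if "\<bar>\<omega>\<bar> = W" for \<omega>
  proof (rule ccontr)
    assume "\<not> ?thesis"
    then have "(1 + beta \<alpha> \<omega> * \<bar>\<xi> - \<omega>\<bar>) powr (1 / (1 - \<alpha>)) \<le> (1 + \<bar>y\<bar>) powr (1 / (1 - \<alpha>))"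
      using \<alpha> by (intro powr_mono2) (auto simp: less_imp_le)
    then have "(1 + \<bar>\<xi>\<bar>) * (1 + beta \<alpha> \<omega> * \<bar>\<xi> - \<omega>\<bar>) powr (1 / (1 - \<alpha>)) \<le> W"
      unfolding W_def by (intro mult_left_mono) auto
    with frequency_ratio_lower[OF \<alpha>, of \<omega> \<xi>] that show False by linarith
  qed
  \<comment> \<open>Signs are reversed because the phase is nonnegative at \<open>- W\<close> and
    nonpositive at \<open>W\<close>.\<close>
  have "\<exists>\<omega>\<ge>- W. \<omega> \<le> W \<and> - (beta \<alpha> \<omega> * (\<xi> - \<omega>)) = - y"
  proof (rule IVT')
    show "- (beta \<alpha> (- W) * (\<xi> - (- W))) \<le> - y"
      using far[of "- W"] W by (simp add: abs_if split: if_splits)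
    show "- y \<le> - (beta \<alpha> W * (\<xi> - W))"
      using far[of W] W by (simp add: abs_if algebra_simps split: if_splits)
    show "continuous_on {- W..W} (\<lambda>\<omega>. - (beta \<alpha> \<omega> * (\<xi> - \<omega>)))"
      by (intro continuous_intros continuous_on_subset[OF continuous_beta]) auto
  qed (use W in auto)
  then show thesis using that by auto
qed

lemma symbol_lower_bound:
  assumes \<alpha>: "0 \<le> \<alpha>" "\<alpha> < 1" and r: "2 * r > 1" and Fc: "continuous_on UNIV F"
    and F: "\<And>y. cmod (F y) \<le> C * (1 + \<bar>y\<bar>) powr (- r)" and nz: "F y0 \<noteq> 0"
  obtains c where "c > 0" "\<And>\<xi>. c \<le> symbol \<alpha> F \<xi>"
proof -
  define c0 where "c0 = cmod (F y0) / 2"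
  have c0: "c0 > 0" using nz by (simp add: c0_def)
  have "isCont F y0" using Fc by (simp add: continuous_on_eq_continuous_at)
  then obtain \<eta> where \<eta>: "\<eta> > 0" "\<And>y. \<bar>y - y0\<bar> < \<eta> \<Longrightarrow> cmod (F y - F y0) < c0"
    using c0 unfolding continuous_at_eps_delta dist_norm by (metis real_norm_def)
  have near: "c0 \<le> cmod (F y)" if "\<bar>y - y0\<bar> < \<eta>" for y
    using \<eta>(2)[OF that] norm_triangle_ineq3[of "F y" "F y0"] unfolding c0_def by linarith
  \<comment> \<open>On the interval \<open>I\<close> of half-width \<open>\<delta> / b\<close> the
    ratio of the two \<open>beta\<close> values stays within \<open>2 * \<delta>\<close> of 1, and
    the phase moves by at most \<open>2 * \<delta> * (\<bar>y0\<bar> + 1)\<close>. The denominator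
    keeps this below \<open>\<eta>\<close>.\<close>
  define \<delta> where "\<delta> = min (1/2) (\<eta> / (4 * (\<bar>y0\<bar> + 1)))"
  have \<delta>: "\<delta> > 0" "\<delta> \<le> 1/2"
    using \<eta> unfolding \<delta>_def by (simp add: add_nonneg_pos) (rule min.cobounded1)
  have "\<delta> \<le> \<eta> / (4 * (\<bar>y0\<bar> + 1))" by (simp add: \<delta>_def)
  then have \<delta>\<eta>: "4 * (\<delta> * (\<bar>y0\<bar> + 1)) \<le> \<eta>" by (simp add: field_simps)
  have [measurable]: "F \<in> borel_measurable borel" using Fc by (rule borel_measurable_continuous_onI)
  show thesis
  proof (rule that)
    show "0 < \<delta> * c0\<^sup>2" using \<delta> c0 by simp
    fix \<xi>
    obtain \<omega>0 where \<omega>0: "beta \<alpha> \<omega>0 * (\<xi> - \<omega>0) = y0" using beta_phase_surj[OF \<alpha>] .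
    define b where "b = beta \<alpha> \<omega>0"
    have b: "b > 0" by (simp add: b_def)
    define I where "I = {\<omega>0 - \<delta> / b..\<omega>0 + \<delta> / b}"
    have mI: "measure lborel I = 2 * \<delta> / b" using b \<delta> by (simp add: I_def)
    have pt: "b / (1 + \<delta>) * c0\<^sup>2 \<le> beta \<alpha> \<omega> * (cmod (F (beta \<alpha> \<omega> * (\<xi> - \<omega>))))\<^sup>2" if "\<omega> \<in> I" for \<omega>
    proof -
      define N0 where "N0 = 1 + \<bar>\<omega>0\<bar>"
      have N0: "N0 \<ge> 1" by (simp add: N0_def)
      have d: "\<bar>\<omega> - \<omega>0\<bar> \<le> \<delta> / b" using that by (auto simp: I_def)
      \<comment> \<open>As \<open>1 / b\<close> is at most \<open>N0\<close>, passing from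
        \<open>\<omega>0\<close> to \<omega> changes \<open>N0\<close> by a factor between
        \<open>1 - \<delta>\<close> and \<open>1 + \<delta>\<close>.\<close>
      have "1 / b = N0 powr \<alpha>" by (simp add: b_def beta_def N0_def powr_minus_divide)
      also have "\<dots> \<le> N0 powr 1" using N0 \<alpha> by (intro powr_mono) auto
      finally have "\<delta> * (1 / b) \<le> \<delta> * N0" using \<delta> N0 by (intro mult_left_mono) auto
      with d have d': "\<bar>\<omega> - \<omega>0\<bar> \<le> \<delta> * N0" by simp
      have up: "1 + \<bar>\<omega>\<bar> \<le> (1 + \<delta>) * N0" and lo: "(1 - \<delta>) * N0 \<le> 1 + \<bar>\<omega>\<bar>"
        using d' by (auto simp: N0_def algebra_simps)
      have p1: "1 / (1 + \<delta>) \<le> (1 + \<delta>) powr (- \<alpha>)"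
        using powr_mono[of "-1" "- \<alpha>" "1 + \<delta>"] \<alpha> \<delta> by (simp add: powr_minus_divide)
      have p2: "(1 - \<delta>) powr (- \<alpha>) \<le> 1 / (1 - \<delta>)"
      proof -
        have "(1 - \<delta>) powr 1 \<le> (1 - \<delta>) powr \<alpha>" using \<alpha> \<delta> by (intro powr_mono') auto
        then show ?thesis using \<delta> unfolding powr_minus_divide by (intro divide_left_mono) auto
      qed
      have "b / (1 + \<delta>) \<le> (1 + \<delta>) powr (- \<alpha>) * N0 powr (- \<alpha>)"
        using mult_right_mono[OF p1, of b] b by (simp add: b_def beta_def N0_def)
      also have "\<dots> = ((1 + \<delta>) * N0) powr (- \<alpha>)" using N0 \<delta> by (simp add: powr_mult)
      also have "\<dots> \<le> (1 + \<bar>\<omega>\<bar>) powr (- \<alpha>)" using up \<alpha> by (intro powr_mono2') auto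
      finally have blo: "b / (1 + \<delta>) \<le> beta \<alpha> \<omega>" by (simp add: beta_def)
      have "beta \<alpha> \<omega> \<le> ((1 - \<delta>) * N0) powr (- \<alpha>)" unfolding beta_def using lo \<alpha> \<delta> N0 by (intro powr_mono2') auto
      also have "\<dots> = (1 - \<delta>) powr (- \<alpha>) * b" using N0 \<delta> by (simp add: powr_mult b_def beta_def N0_def)
      also have "\<dots> \<le> 1 / (1 - \<delta>) * b" using p2 b by (intro mult_right_mono) auto
      finally have bup: "beta \<alpha> \<omega> / b \<le> 1 / (1 - \<delta>)" using b by (simp add: field_simps)
      have blo': "1 / (1 + \<delta>) \<le> beta \<alpha> \<omega> / b" using blo b \<delta> by (simp add: field_simps)
      define \<rho> where "\<rho> = beta \<alpha> \<omega> / b"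
      have "1 / (1 - \<delta>) \<le> 1 + 2 * \<delta>"
      proof -
        have "\<delta> * \<delta> \<le> \<delta> * (1/2)" using \<delta> by (intro mult_left_mono) auto
        then show ?thesis using \<delta> by (simp add: field_simps)
      qed
      moreover have "1 - 2 * \<delta> \<le> 1 / (1 + \<delta>)"
      proof -
        have "0 \<le> \<delta> * \<delta>" by simp
        then show ?thesis using \<delta> by (simp add: field_simps)
      qed
      ultimately have \<rho>: "\<bar>\<rho> - 1\<bar> \<le> 2 * \<delta>" "0 \<le> \<rho>" "\<rho> \<le> 2"
        using bup blo' \<delta> b unfolding \<rho>_def abs_le_iff by (auto simp: less_imp_le)
      have "beta \<alpha> \<omega> * (\<xi> - \<omega>) = \<rho> * (y0 + b * (\<omega>0 - \<omega>))"
      proof -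
        have "y0 + b * (\<omega>0 - \<omega>) = b * (\<xi> - \<omega>)" unfolding \<omega>0[symmetric] b_def by (simp add: algebra_simps)
        then show ?thesis using b by (simp add: \<rho>_def)
      qed
      then have "beta \<alpha> \<omega> * (\<xi> - \<omega>) - y0 = (\<rho> - 1) * y0 + \<rho> * (b * (\<omega>0 - \<omega>))" by (simp add: algebra_simps)
      then have "\<bar>beta \<alpha> \<omega> * (\<xi> - \<omega>) - y0\<bar> \<le> \<bar>\<rho> - 1\<bar> * \<bar>y0\<bar> + \<rho> * (b * \<bar>\<omega>0 - \<omega>\<bar>)"
        using abs_triangle_ineq[of "(\<rho> - 1) * y0" "\<rho> * (b * (\<omega>0 - \<omega>))"] \<rho> b by (simp add: abs_mult)
      also have "\<dots> \<le> 2 * \<delta> * \<bar>y0\<bar> + 2 * \<delta>"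
      proof -
        have "b * \<bar>\<omega>0 - \<omega>\<bar> \<le> \<delta>" using d b by (simp add: field_simps abs_minus_commute)
        then show ?thesis using \<rho> b by (intro add_mono mult_right_mono mult_mono) auto
      qed
      also have "\<dots> < 4 * (\<delta> * (\<bar>y0\<bar> + 1))"
      proof -
        have "0 \<le> \<delta> * \<bar>y0\<bar>" using \<delta> by simp
        then have "0 < 2 * \<delta> + 2 * (\<delta> * \<bar>y0\<bar>)" using \<delta> by linarith
        then show ?thesis by (simp add: algebra_simps)
      qed
      also note \<delta>\<eta>
      finally have "c0 \<le> cmod (F (beta \<alpha> \<omega> * (\<xi> - \<omega>)))" by (rule near)
      then have "c0\<^sup>2 \<le> (cmod (F (beta \<alpha> \<omega> * (\<xi> - \<omega>))))\<^sup>2" using c0 by (intro power_mono) auto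
      then show ?thesis using blo b \<delta> by (intro mult_mono) (auto simp: less_imp_le)
    qed
    \<comment> \<open>The length \<open>2 * \<delta> / b\<close> of the interval cancels the factor
      \<open>b\<close> of the integrand, which leaves a bound that does not depend on \<xi>.\<close>
    have "\<delta> * c0\<^sup>2 \<le> (2 * \<delta> / (1 + \<delta>)) * c0\<^sup>2"
    proof (intro mult_right_mono)
      have "\<delta> * \<delta> \<le> \<delta> * 1" using \<delta> by (intro mult_left_mono) auto
      then show "\<delta> \<le> 2 * \<delta> / (1 + \<delta>)" using \<delta> by (simp add: field_simps)
    qed simp
    also have "\<dots> = (\<integral>\<omega>. (b / (1 + \<delta>) * c0\<^sup>2) * indicator I \<omega> \<partial>lborel)"
      using b \<delta> by (simp add: mI)
    also have "\<dots> \<le> symbol \<alpha> F \<xi>"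
      unfolding symbol_def
    proof (rule integral_mono)
      show "integrable lborel (\<lambda>\<omega>. (b / (1 + \<delta>) * c0\<^sup>2) * indicator I \<omega>)"
        unfolding I_def by (intro integrable_mult_right integrable_real_indicator) (auto simp: emeasure_lborel_Icc_eq)
      show "integrable lborel (\<lambda>\<omega>. beta \<alpha> \<omega> * (cmod (F (beta \<alpha> \<omega> * (\<xi> - \<omega>))))\<^sup>2)"
        by (rule symbol_integrable[OF \<alpha> r _ F]) measurable
      show "b / (1 + \<delta>) * c0\<^sup>2 * indicator I \<omega> \<le> beta \<alpha> \<omega> * (cmod (F (beta \<alpha> \<omega> * (\<xi> - \<omega>))))\<^sup>2" for \<omega>
        using pt[of \<omega>] by (cases "\<omega> \<in> I") (auto simp: less_imp_le)
    qed
    finally show "\<delta> * c0\<^sup>2 \<le> symbol \<alpha> F \<xi>" .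
  qed
qed

section \<open>The frame operator as a Fourier multiplier\<close>

text \<open>For fixed \<omega>, the coefficient as a function of \<open>x\<close> is the transform
  of \<open>U * cnj P\<close> at \<open>- x\<close>, so Parseval carries out the integration over
  \<open>x\<close>. The bound on \<open>F\<close> keeps this product square integrable.\<close>

lemma fourier_pairing:
  assumes \<alpha>: "0 \<le> \<alpha>" and u: "has_fourier_L2 u U" and g: "has_fourier_L2 g G" and \<psi>: "has_fourier_L2 \<psi> F"
    and bd: "\<And>y. cmod (F y) \<le> B"
  shows "(\<integral>x. L2_inner u (atom \<alpha> \<psi> x \<omega>) * L2_inner (atom \<alpha> \<psi> x \<omega>) g \<partial>lborel)
    = (\<integral>\<xi>. U \<xi> * cnj (G \<xi>) * complex_of_real (beta \<alpha> \<omega> * (cmod (F (beta \<alpha> \<omega> * (\<xi> - \<omega>))))\<^sup>2) \<partial>lborel)"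
proof -
  define P where "P \<xi> = complex_of_real (sqrt (beta \<alpha> \<omega>)) * F (beta \<alpha> \<omega> * (\<xi> - \<omega>))" for \<xi>
  note U = has_fourier_L2_dest(2)[OF u] and G = has_fourier_L2_dest(2)[OF g]
  note [measurable] = L2_measurable[OF has_fourier_L2_dest(2)[OF \<psi>]] L2_measurable[OF U] L2_measurable[OF G]
  have Pf: "fatom \<alpha> F x \<omega> = (\<lambda>\<xi>. chi \<xi> x * P \<xi>)" for x by (rule ext) (simp add: fatom_def P_def)
  have PL: "P \<in> L2" using fatom_L2(1)[OF has_fourier_L2_dest(2)[OF \<psi>], of \<alpha> 0 \<omega>] unfolding Pf by simp
  have "cmod (P \<xi>) \<le> sqrt (beta \<alpha> \<omega>) * B" for \<xi>
    unfolding P_def norm_mult by (intro mult_mono bd) (auto simp: less_imp_le)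
  note Pb = this
  have q: "(\<lambda>\<xi>. V \<xi> * cnj (P \<xi>)) \<in> L2 \<and> integrable lborel (\<lambda>\<xi>. V \<xi> * cnj (P \<xi>))" if "V \<in> L2" for V
  proof
    have "(\<lambda>\<xi>. cnj (P \<xi>) * V \<xi>) \<in> L2"
      by (rule L2_mult_bounded[OF that, where B = "sqrt (beta \<alpha> \<omega>) * B"]) (use Pb PL in \<open>auto dest: L2_measurable\<close>)
    then show "(\<lambda>\<xi>. V \<xi> * cnj (P \<xi>)) \<in> L2" by (simp only: mult.commute)
    show "integrable lborel (\<lambda>\<xi>. V \<xi> * cnj (P \<xi>))" by (intro L2_integrable_mult that L2_cnj PL)
  qed
  have inner: "L2_inner v (atom \<alpha> \<psi> x \<omega>) = fourier (\<lambda>\<xi>. V \<xi> * cnj (P \<xi>)) (- x)" if "has_fourier_L2 v V" for v V x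
  proof -
    have "L2_inner v (atom \<alpha> \<psi> x \<omega>) = L2_inner V (fatom \<alpha> F x \<omega>)"
      using parseval_L2[OF that has_fourier_L2_atom[OF \<psi>]] by simp
    also have "\<dots> = fourier (\<lambda>\<xi>. V \<xi> * cnj (P \<xi>)) (- x)"
      unfolding L2_inner_def Pf fourier_chi
      by (intro Bochner_Integration.integral_cong refl) (simp add: cnj_chi chi_commute[of "- x"])
    finally show ?thesis .
  qed
  have flip: "L2_inner (atom \<alpha> \<psi> x \<omega>) g = cnj (L2_inner g (atom \<alpha> \<psi> x \<omega>))" for x
    unfolding L2_inner_def by (subst Bochner_Integration.integral_cnj[symmetric]) (simp add: mult.commute)
  let ?U = "\<lambda>\<xi>. U \<xi> * cnj (P \<xi>)" and ?G = "\<lambda>\<xi>. G \<xi> * cnj (P \<xi>)"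
    and ?w = "\<lambda>\<xi>. complex_of_real (beta \<alpha> \<omega> * (cmod (F (beta \<alpha> \<omega> * (\<xi> - \<omega>))))\<^sup>2)"
  have "(\<integral>x. L2_inner u (atom \<alpha> \<psi> x \<omega>) * L2_inner (atom \<alpha> \<psi> x \<omega>) g \<partial>lborel)
      = (\<integral>x. fourier ?U (- x) * cnj (fourier ?G (- x)) \<partial>lborel)"
    unfolding flip inner[OF u] inner[OF g] ..
  also have "\<dots> = L2_inner (fourier ?U) (fourier ?G)"
    unfolding L2_inner_def
    using lborel_integral_real_affine[of "-1" "\<lambda>x. fourier ?U x * cnj (fourier ?G x)" 0]
    by simp
  also have "\<dots> = L2_inner ?U ?G"
    using q[OF U] q[OF G] by (intro parseval_L1) auto
  also have "\<dots> = (\<integral>\<xi>. U \<xi> * cnj (G \<xi>) * ?w \<xi> \<partial>lborel)"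
    unfolding L2_inner_def
  proof (intro Bochner_Integration.integral_cong refl)
    fix \<xi>
    have "P \<xi> * cnj (P \<xi>) = complex_of_real ((cmod (P \<xi>))\<^sup>2)" by (simp only: complex_norm_square)
    also have "(cmod (P \<xi>))\<^sup>2 = beta \<alpha> \<omega> * (cmod (F (beta \<alpha> \<omega> * (\<xi> - \<omega>))))\<^sup>2"
      by (simp add: P_def norm_mult power_mult_distrib less_imp_le)
    finally have e: "P \<xi> * cnj (P \<xi>) = ?w \<xi>" .
    show "U \<xi> * cnj (P \<xi>) * cnj (G \<xi> * cnj (P \<xi>)) = U \<xi> * cnj (G \<xi>) * ?w \<xi>"
      unfolding e[symmetric] by (simp add: mult_ac)
  qed
  finally show ?thesis .
qed

text \<open>The bounds on the symbol are assumed here and discharged in the final proof from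
  smoothness and decay of \<open>F\<close>, so that this part is free of derivative
  estimates.\<close>

locale admissible_window =
  fixes \<alpha> r C B c :: real and \<psi> F :: "real \<Rightarrow> complex"
  assumes \<alpha>: "0 \<le> \<alpha>" "\<alpha> < 1" and r: "2 * r > 1"
    and window: "has_fourier_L2 \<psi> F"
    and decay: "\<And>y. cmod (F y) \<le> C * (1 + \<bar>y\<bar>) powr (- r)"
    and symbol_le: "\<And>\<xi>. symbol \<alpha> F \<xi> \<le> B"
    and c_pos: "0 < c" and symbol_ge: "\<And>\<xi>. c \<le> symbol \<alpha> F \<xi>"
begin

lemma F_measurable [measurable]: "F \<in> borel_measurable borel"
  using has_fourier_L2_dest(2)[OF window] by (rule L2_measurable)

lemma C_nonneg: "0 \<le> C"
  using order_trans[OF norm_ge_zero decay[of 0]] by simp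

lemma F_bounded: "cmod (F y) \<le> C"
proof -
  have "(1 + \<bar>y\<bar>) powr (- r) \<le> (1 + \<bar>y\<bar>) powr 0" using r by (intro powr_mono) auto
  then have "C * (1 + \<bar>y\<bar>) powr (- r) \<le> C * 1" using C_nonneg by (intro mult_left_mono) (auto split: if_splits)
  then show ?thesis using decay[of y] by simp
qed

lemma symbol_neq_0: "symbol \<alpha> F \<xi> \<noteq> 0"
  using symbol_ge[of \<xi>] c_pos by linarith

lemma symbol_mult_L2: "U \<in> L2 \<Longrightarrow> (\<lambda>\<xi>. complex_of_real (symbol \<alpha> F \<xi>) * U \<xi>) \<in> L2"
  using symbol_le by (intro L2_mult_bounded[where B = B]) auto

lemma symbol_divide_L2: 
  assumes "U \<in> L2" shows "(\<lambda>\<xi>. U \<xi> / complex_of_real (symbol \<alpha> F \<xi>)) \<in> L2"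
proof -
  have "(\<lambda>\<xi>. complex_of_real (1 / symbol \<alpha> F \<xi>) * U \<xi>) \<in> L2"
    by (rule L2_mult_bounded[OF assms, where B = "1 / c"])
       (use symbol_ge c_pos in \<open>auto simp: norm_divide intro!: frac_le\<close>)
  then show ?thesis by simp
qed

definition weak_form :: "(real \<Rightarrow> complex) \<Rightarrow> (real \<Rightarrow> complex) \<Rightarrow> complex" where
  "weak_form u g = (\<integral>\<omega>. (\<integral>x. L2_inner u (atom \<alpha> \<psi> x \<omega>) * L2_inner (atom \<alpha> \<psi> x \<omega>) g \<partial>lborel) \<partial>lborel)"

text \<open>Integrating \<open>fourier_pairing\<close> over \<omega> and exchanging the integrals
  assembles the symbol. Absolute integrability holds because the symbol is bounded and
  \<open>U * cnj G\<close> is integrable.\<close>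

lemma weak_form_multiplier:
  assumes u: "has_fourier_L2 u U" and g: "has_fourier_L2 g G"
  shows "weak_form u g = L2_inner (\<lambda>\<xi>. complex_of_real (symbol \<alpha> F \<xi>) * U \<xi>) G"
proof -
  note U = has_fourier_L2_dest(2)[OF u] and G = has_fourier_L2_dest(2)[OF g]
  note [measurable] = L2_measurable[OF U] L2_measurable[OF G]
  define w where "w \<xi> \<omega> = beta \<alpha> \<omega> * (cmod (F (beta \<alpha> \<omega> * (\<xi> - \<omega>))))\<^sup>2" for \<xi> \<omega>
  have w0: "0 \<le> w \<xi> \<omega>" for \<xi> \<omega> by (simp add: w_def less_imp_le)
  have wi: "integrable lborel (w \<xi>)" for \<xi>
    unfolding w_def by (rule symbol_integrable[OF \<alpha> r _ decay]) measurable
  have ws: "(\<integral>\<omega>. w \<xi> \<omega> \<partial>lborel) = symbol \<alpha> F \<xi>" for \<xi> by (simp add: w_def symbol_def)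
  have UG: "integrable lborel (\<lambda>\<xi>. U \<xi> * cnj (G \<xi>))" by (intro L2_integrable_mult U G L2_cnj)
  have I: "integrable (lborel \<Otimes>\<^sub>M lborel) (\<lambda>(\<xi>, \<omega>). U \<xi> * cnj (G \<xi>) * complex_of_real (w \<xi> \<omega>))"
  proof (rule lborel_pair.Fubini_integrable)
    show "(\<lambda>(\<xi>, \<omega>). U \<xi> * cnj (G \<xi>) * complex_of_real (w \<xi> \<omega>)) \<in> borel_measurable (lborel \<Otimes>\<^sub>M lborel)"
      unfolding w_def by measurable
    have "integrable lborel (\<lambda>\<xi>. U \<xi> * cnj (G \<xi>) * complex_of_real (symbol \<alpha> F \<xi>))"
      using symbol_le by (intro integrable_mult_bounded[OF UG, where B = B]) auto
    from integrable_norm[OF this]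
    show "integrable lborel (\<lambda>\<xi>. \<integral>\<omega>. norm (case (\<xi>, \<omega>) of (\<xi>, \<omega>) \<Rightarrow> U \<xi> * cnj (G \<xi>) * complex_of_real (w \<xi> \<omega>)) \<partial>lborel)"
      by (simp add: norm_mult w0 ws)
    show "AE \<xi> in lborel. integrable lborel (\<lambda>\<omega>. case (\<xi>, \<omega>) of (\<xi>, \<omega>) \<Rightarrow> U \<xi> * cnj (G \<xi>) * complex_of_real (w \<xi> \<omega>))"
      using wi by (intro AE_I2) simp
  qed
  have "weak_form u g = (\<integral>\<omega>. (\<integral>\<xi>. U \<xi> * cnj (G \<xi>) * complex_of_real (w \<xi> \<omega>) \<partial>lborel) \<partial>lborel)"
    unfolding weak_form_def w_def by (simp only: fourier_pairing[OF \<alpha>(1) u g window F_bounded])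
  also have "\<dots> = (\<integral>\<xi>. (\<integral>\<omega>. U \<xi> * cnj (G \<xi>) * complex_of_real (w \<xi> \<omega>) \<partial>lborel) \<partial>lborel)"
    by (rule lborel_pair.Fubini_integral[OF I])
  also have "\<dots> = L2_inner (\<lambda>\<xi>. complex_of_real (symbol \<alpha> F \<xi>) * U \<xi>) G"
    unfolding L2_inner_def by (intro Bochner_Integration.integral_cong refl) (simp add: ws mult_ac)
  finally show ?thesis .
qed

text \<open>The choice is harmless: surjectivity of the transform yields a vector with the required
  inner products, and testing against the difference shows that any such vector has the stated
  transform.\<close>

lemma has_fourier_A_sigma:
  assumes u: "has_fourier_L2 u U"
  shows "has_fourier_L2 (A_sigma \<alpha> \<psi> u) (\<lambda>\<xi>. complex_of_real (symbol \<alpha> F \<xi>) * U \<xi>)"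
proof -
  let ?mU = "\<lambda>\<xi>. complex_of_real (symbol \<alpha> F \<xi>) * U \<xi>"
  have mU: "?mU \<in> L2" by (intro symbol_mult_L2 has_fourier_L2_dest[OF u])
  obtain h where h: "has_fourier_L2 h ?mU" using has_fourier_L2_surj[OF mU] .
  have "h \<in> L2 \<and> (\<forall>g\<in>L2. L2_inner h g = weak_form u g)"
  proof (intro conjI ballI)
    show "h \<in> L2" using has_fourier_L2_dest[OF h] by blast
    fix g assume "g \<in> L2"
    then obtain G where G: "has_fourier_L2 g G" by (rule has_fourier_L2_exists)
    show "L2_inner h g = weak_form u g" using weak_form_multiplier[OF u G] parseval_L2[OF h G] by simp
  qed
  then have A: "A_sigma \<alpha> \<psi> u \<in> L2 \<and> (\<forall>g\<in>L2. L2_inner (A_sigma \<alpha> \<psi> u) g = weak_form u g)"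
    unfolding A_sigma_def weak_form_def[symmetric]
    by (rule someI[where P = "\<lambda>h. h \<in> L2 \<and> (\<forall>g\<in>L2. L2_inner h g = weak_form u g)"])
  then obtain H where H: "has_fourier_L2 (A_sigma \<alpha> \<psi> u) H" using has_fourier_L2_exists by blast
  have HL: "H \<in> L2" using has_fourier_L2_dest[OF H] by blast
  define D where "D \<xi> = H \<xi> - ?mU \<xi>" for \<xi>
  have DL: "D \<in> L2" unfolding D_def using HL mU by (rule L2_diff)
  \<comment> \<open>The test vector is the one whose transform is the difference \<open>D\<close>;
    equal pairings with it give \<open>sqnorm D = 0\<close>.\<close>
  obtain d where d: "has_fourier_L2 d D" using has_fourier_L2_surj[OF DL] .
  have "L2_inner H D = L2_inner ?mU D"
    using A has_fourier_L2_dest(1)[OF d] weak_form_multiplier[OF u d] parseval_L2[OF H d] by simp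
  then have "L2_inner D D = 0"
    using L2_integrable_mult[OF HL L2_cnj[OF DL]] L2_integrable_mult[OF mU L2_cnj[OF DL]]
    unfolding L2_inner_def D_def by (simp add: left_diff_distrib)
  then have "sqnorm D = 0" by (simp add: L2_inner_self)
  then have "AE \<xi> in lborel. H \<xi> = ?mU \<xi>"
    unfolding D_def using sqnorm_diff_eq_0_iff[OF HL mU] by simp
  then show ?thesis using H L2_measurable[OF mU] by (intro has_fourier_L2_cong_AE[OF H]) auto
qed

text \<open>Division by the symbol, which stays away from 0, gives a preimage. Hence the chosen
  vector does solve the equation, and comparing transforms determines its own almost
  everywhere.\<close>

lemma has_fourier_A_sigma_inv:
  assumes h: "has_fourier_L2 h H"
  shows "has_fourier_L2 (A_sigma_inv \<alpha> \<psi> h) (\<lambda>\<xi>. H \<xi> / complex_of_real (symbol \<alpha> F \<xi>))"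
proof -
  let ?U = "\<lambda>\<xi>. H \<xi> / complex_of_real (symbol \<alpha> F \<xi>)"
  have UL: "?U \<in> L2" by (intro symbol_divide_L2 has_fourier_L2_dest[OF h])
  obtain u where u: "has_fourier_L2 u ?U" using has_fourier_L2_surj[OF UL] .
  have "has_fourier_L2 (A_sigma \<alpha> \<psi> u) H"
    using has_fourier_A_sigma[OF u] by (simp add: symbol_neq_0)
  from has_fourier_L2_inj[OF this h] have "u \<in> L2 \<and> (AE t in lborel. A_sigma \<alpha> \<psi> u t = h t)"
    using has_fourier_L2_dest[OF u] by simp
  then have V: "A_sigma_inv \<alpha> \<psi> h \<in> L2 \<and> (AE t in lborel. A_sigma \<alpha> \<psi> (A_sigma_inv \<alpha> \<psi> h) t = h t)"
    unfolding A_sigma_inv_def by (rule someI[where P = "\<lambda>u. u \<in> L2 \<and> (AE t in lborel. A_sigma \<alpha> \<psi> u t = h t)"])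
  then obtain V where V': "has_fourier_L2 (A_sigma_inv \<alpha> \<psi> h) V" using has_fourier_L2_exists by blast
  have "has_fourier_L2 h (\<lambda>\<xi>. complex_of_real (symbol \<alpha> F \<xi>) * V \<xi>)"
    using V has_fourier_L2_dest(1)[OF h]
    by (intro has_fourier_L2_cong_AE_left[OF has_fourier_A_sigma[OF V']]) (auto dest: L2_measurable)
  from has_fourier_L2_unique[OF this h] have "AE \<xi> in lborel. V \<xi> = ?U \<xi>"
    by eventually_elim (use symbol_neq_0 in \<open>simp add: field_simps\<close>)
  then show ?thesis by (intro has_fourier_L2_cong_AE[OF V'] L2_measurable[OF UL])
qed

lemma has_fourier_A_sigma_inv_power:
  assumes h: "has_fourier_L2 h H"
  shows "has_fourier_L2 ((A_sigma_inv \<alpha> \<psi> ^^ \<kappa>) h) (\<lambda>\<xi>. H \<xi> / complex_of_real (symbol \<alpha> F \<xi>) ^ \<kappa>)"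
proof (induction \<kappa>)
  case (Suc \<kappa>)
  from has_fourier_A_sigma_inv[OF this] show ?case by (simp add: mult.commute)
qed (use h in simp)

text \<open>By Parseval the kernel is an integral over frequency in which \<open>x\<close> and
  \<open>x'\<close> occur only in characters. These combine to one at \<open>x - x'\<close>, and the
  symbol is real, hence unaffected by the conjugation.\<close>

lemma atom_kernel_fourier:
  assumes \<phi>: "has_fourier_L2 \<phi> \<Phi>"
  shows "atom_kernel \<alpha> \<kappa> \<psi> \<phi> x \<omega> x' \<omega>' = fourier (\<lambda>\<xi>. complex_of_real (sqrt (beta \<alpha> \<omega>)) * F (beta \<alpha> \<omega> * (\<xi> - \<omega>))
     * cnj (complex_of_real (sqrt (beta \<alpha> \<omega>')) * \<Phi> (beta \<alpha> \<omega>' * (\<xi> - \<omega>')))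
     * (1 / complex_of_real (symbol \<alpha> F \<xi>)) ^ \<kappa>) (x - x')" (is "_ = fourier ?G _")
proof -
  have ch: "chi \<xi> x * chi \<xi> (- x') = chi (x - x') \<xi>" for \<xi>
    by (simp add: chi_commute[of _ \<xi>] flip: chi_add)
  have "atom_kernel \<alpha> \<kappa> \<psi> \<phi> x \<omega> x' \<omega>'
      = L2_inner (fatom \<alpha> F x \<omega>) (\<lambda>\<xi>. fatom \<alpha> \<Phi> x' \<omega>' \<xi> / complex_of_real (symbol \<alpha> F \<xi>) ^ \<kappa>)"
    unfolding atom_kernel_def
    using parseval_L2[OF has_fourier_L2_atom[OF window] has_fourier_A_sigma_inv_power[OF has_fourier_L2_atom[OF \<phi>]]] by simp
  also have "\<dots> = fourier ?G (x - x')"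
    unfolding L2_inner_def fourier_chi
    by (intro Bochner_Integration.integral_cong refl)
       (simp add: fatom_def cnj_chi power_one_over ch[symmetric] mult_ac)
  finally show ?thesis .
qed

end

section \<open>Kernel estimates\<close>

lemma integrable_decay:
  fixes f :: "real \<Rightarrow> complex"
  assumes b: "b > 0" and q: "q > 1" and [measurable]: "f \<in> borel_measurable borel"
    and f: "\<And>x. cmod (f x) \<le> K * (1 + b * \<bar>x - \<omega>\<bar>) powr (- q)"
  shows "integrable lborel f"
proof -
  have "integrable lborel (\<lambda>x. b * (1 + b * \<bar>x - \<omega>\<bar>) powr (- q))"
    using tail_integral_affine[OF b, of \<omega> q] tail_integral_finite[OF q] b
    by (intro integrableI_nonneg) auto
  then have i: "integrable lborel (\<lambda>x. K / b * (b * (1 + b * \<bar>x - \<omega>\<bar>) powr (- q)))" by (rule integrable_mult_right)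
  show ?thesis
  proof (rule Bochner_Integration.integrable_bound[OF i])
    show "AE x in lborel. cmod (f x) \<le> norm (K / b * (b * (1 + b * \<bar>x - \<omega>\<bar>) powr (- q)))"
      using f b by (intro AE_I2) (auto intro: order_trans[OF _ abs_ge_self])
  qed measurable
qed

lemma tendsto_decay:
  fixes f :: "real \<Rightarrow> complex"
  assumes b: "b > 0" and q: "q > 0"
    and f: "\<And>x. cmod (f x) \<le> K * (1 + b * \<bar>x - \<omega>\<bar>) powr (- q)"
  shows "(f \<longlongrightarrow> 0) at_top" "(f \<longlongrightarrow> 0) at_bot"
proof -
  have t: "(f \<longlongrightarrow> 0) G" if g: "filterlim (\<lambda>x. \<bar>x - \<omega>\<bar>) at_top G" for G
  proof (rule Lim_null_comparison[OF always_eventually])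
    show "\<forall>x. cmod (f x) \<le> K * (1 + b * \<bar>x - \<omega>\<bar>) powr (- q)" using f by blast
    have "filterlim (\<lambda>x. 1 + b * \<bar>x - \<omega>\<bar>) at_top G"
      by (intro filterlim_tendsto_add_at_top[OF tendsto_const] filterlim_tendsto_pos_mult_at_top[OF tendsto_const b g])
    then have "((\<lambda>x. (1 + b * \<bar>x - \<omega>\<bar>) powr (- q)) \<longlongrightarrow> 0) G" using q by (intro tendsto_neg_powr) auto
    then show "((\<lambda>x. K * (1 + b * \<bar>x - \<omega>\<bar>) powr (- q)) \<longlongrightarrow> 0) G" by (rule tendsto_mult_right_zero)
  qed
  show "(f \<longlongrightarrow> 0) at_top"
    by (rule t, rule filterlim_at_top_mono[OF filterlim_tendsto_add_at_top[OF tendsto_const[of "- \<omega>"] filterlim_ident]])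
       (intro always_eventually, auto)
  show "(f \<longlongrightarrow> 0) at_bot"
    by (rule t, rule filterlim_at_top_mono[OF filterlim_tendsto_add_at_top[OF tendsto_const[of \<omega>] filterlim_uminus_at_top_at_bot]])
       (intro always_eventually, auto)
qed

text \<open>Integration by parts, phrased as vanishing of the integral of the derivative of
  \<open>f * chi \<xi>\<close>, whose boundary values are 0.\<close>

lemma fourier_derivative:
  assumes d: "\<And>x. (f has_vector_derivative f1 x) (at x)" and c: "continuous_on UNIV f1"
    and i: "integrable lborel f" "integrable lborel f1"
    and l: "(f \<longlongrightarrow> 0) at_top" "(f \<longlongrightarrow> 0) at_bot"
  shows "fourier f1 \<xi> = 2 * complex_of_real pi * \<i> * complex_of_real \<xi> * fourier f \<xi>"
proof -
  define k where "k = 2 * complex_of_real pi * \<i> * complex_of_real \<xi>"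
  define h where "h x = f x * (- k * chi \<xi> x) + f1 x * chi \<xi> x" for x
  have dchi: "(chi \<xi> has_vector_derivative - k * chi \<xi> x) (at x)" for x
  proof -
    have "((\<lambda>x. - (k * complex_of_real x)) has_vector_derivative - (k * 1)) (at x)"
      by (intro has_vector_derivative_minus has_vector_derivative_mult_right has_vector_derivative_of_real has_vector_derivative_id)
         (auto intro!: derivative_eq_intros)
    from field_vector_diff_chain_at[OF this DERIV_exp]
    show ?thesis by (simp add: o_def k_def chi_def[abs_def] mult_ac)
  qed
  have dh: "((\<lambda>x. f x * chi \<xi> x) has_vector_derivative h x) (at x)" for x
    unfolding h_def by (intro has_vector_derivative_mult d dchi)
  have cchi: "continuous_on UNIV (chi \<xi>)" using dchi by (rule has_vector_derivative_imp_continuous_on)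
  have cf: "continuous_on UNIV f" using d by (rule has_vector_derivative_imp_continuous_on)
  have ch: "continuous_on UNIV h" unfolding h_def by (intro continuous_intros cf c cchi)
  have ih1: "integrable lborel (\<lambda>x. - k * (f x * chi \<xi> x))" by (intro integrable_mult_right integrable_chi i)
  have ih: "integrable lborel h"
    unfolding h_def using Bochner_Integration.integrable_add[OF ih1 integrable_chi[OF i(2), of \<xi>]] by (simp add: mult_ac)
  have lim: "((\<lambda>x. f x * chi \<xi> x) \<longlongrightarrow> 0) G" if "(f \<longlongrightarrow> 0) G" for G
    by (rule tendsto_norm_zero_cancel) (use tendsto_norm_zero[OF that] in \<open>simp add: norm_mult\<close>)
  have "(LBINT x=-\<infinity>..\<infinity>. h x) = 0 - 0"
  proof (rule interval_integral_FTC_integrable[where F = "\<lambda>x. f x * chi \<xi> x"])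
    show "isCont h x" for x using ch by (simp add: continuous_on_eq_continuous_at)
    show "set_integrable lborel (einterval (- \<infinity>) \<infinity>) h" using ih by (simp add: set_integrable_def)
    show "(((\<lambda>x. f x * chi \<xi> x) \<circ> real_of_ereal) \<longlongrightarrow> 0) (at_right (- \<infinity>))"
      "(((\<lambda>x. f x * chi \<xi> x) \<circ> real_of_ereal) \<longlongrightarrow> 0) (at_left \<infinity>)"
      unfolding ereal_tendsto_simps by (intro lim l)+
  qed (use dh in auto)
  then have "(\<integral>x. h x \<partial>lborel) = 0" by (simp add: interval_lebesgue_integral_def set_lebesgue_integral_def)
  moreover have "(\<integral>x. h x \<partial>lborel) = - k * fourier f \<xi> + fourier f1 \<xi>"
  proof -
    have "(\<integral>x. h x \<partial>lborel) = (\<integral>x. - k * (f x * chi \<xi> x) + f1 x * chi \<xi> x \<partial>lborel)"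
      by (simp add: h_def mult_ac)
    also have "\<dots> = (\<integral>x. - k * (f x * chi \<xi> x) \<partial>lborel) + (\<integral>x. f1 x * chi \<xi> x \<partial>lborel)"
      by (rule Bochner_Integration.integral_add[OF ih1 integrable_chi[OF i(2)]])
    also have "(\<integral>x. - k * (f x * chi \<xi> x) \<partial>lborel) = - k * fourier f \<xi>"
      unfolding fourier_chi by (rule integral_mult_right_zero)
    finally show ?thesis by (simp add: fourier_chi)
  qed
  ultimately show ?thesis by (simp add: k_def add_eq_0_iff)
qed

text \<open>The scale \<open>l\<close> is a free parameter to be matched to the width of the frequency envelope.\<close>

lemma fourier_L1_bound:
  assumes f: "C2_bounded f f1 f2 E L" and L: "\<And>\<xi>. L \<xi> \<le> L0"
    and E: "\<And>\<xi>. E \<xi> \<le> K * (1 + b * \<bar>\<xi> - \<omega>\<bar>) powr (- q)" and b: "b > 0" and q: "q > 1" and l: "l > 0"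
  shows "(\<integral>\<^sup>+x. ennreal (cmod (fourier f (x - x'))) \<partial>lborel)
    \<le> 2 * tail_integral 2 * (\<integral>\<^sup>+\<xi>. ennreal (E \<xi> * (l * (1 + (L \<xi> / l)\<^sup>2))) \<partial>lborel)"
proof -
  note F = C2_boundedD[OF f]
  note meas [measurable] = C2_bounded_continuous[OF f, THEN borel_measurable_continuous_onI]
  have E0: "0 \<le> E \<xi>" for \<xi> using norm_ge_zero F(5) order_trans by blast
  \<comment> \<open>This envelope, with the global rate \<open>L0\<close>, secures integrability and
    vanishing boundary terms; the quantitative bound comes from \<open>E\<close> and
    \<open>L\<close>.\<close>
  define X where "X \<xi> = (1 + b * \<bar>\<xi> - \<omega>\<bar>) powr (- q)" for \<xi>
  have L00: "0 \<le> L0" using F(4)[of 0] L[of 0] by simp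
  have EK: "E \<xi> \<le> K * X \<xi>" for \<xi> using E by (simp add: X_def)
  have b0: "cmod (f \<xi>) \<le> K * X \<xi>" for \<xi> using F(5) EK order_trans by blast
  have KX: "0 \<le> K * X \<xi>" for \<xi> using E0 EK order_trans by blast
  have b1: "cmod (f1 \<xi>) \<le> (K * L0) * X \<xi>" for \<xi>
    using order_trans[OF F(6)[of \<xi>] mult_mono[OF EK[of \<xi>] L[of \<xi>] KX F(4)]] by (simp add: mult_ac)
  have b2: "cmod (f2 \<xi>) \<le> (K * L0\<^sup>2) * X \<xi>" for \<xi>
    using order_trans[OF F(7)[of \<xi>] mult_mono[OF EK[of \<xi>] power_mono[OF L[of \<xi>] F(4)] KX zero_le_power2]] by (simp add: mult_ac)
  note bds = b0[unfolded X_def] b1[unfolded X_def] b2[unfolded X_def]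
  have q0: "q > 0" using q by simp
  have i: "integrable lborel f" "integrable lborel f1" "integrable lborel f2"
    using bds by (auto intro!: integrable_decay[OF b q] simp: meas)
  have F1: "fourier f1 x = 2 * complex_of_real pi * \<i> * complex_of_real x * fourier f x" for x
    by (rule fourier_derivative[OF F(2) C2_bounded_continuous(2)[OF f] i(1,2) tendsto_decay[OF b q0 bds(1)]])
  have F2: "fourier f2 x = 2 * complex_of_real pi * \<i> * complex_of_real x * fourier f1 x" for x
    by (rule fourier_derivative[OF F(3,1) i(2,3) tendsto_decay[OF b q0 bds(2)]])
  define n0 n2 where "n0 = (\<integral>x. cmod (f x) \<partial>lborel)" and "n2 = (\<integral>x. cmod (f2 x) \<partial>lborel)"
  have n: "0 \<le> n0" "0 \<le> n2" by (auto simp: n0_def n2_def)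
  \<comment> \<open>The bounds of order 0 and 2 combine to \<open>2 * M / l\<close> as a bound for
    \<open>(1 + \<bar>x\<bar> / l)\<^sup>2 * cmod (fourier f x)\<close>; integrating in
    \<open>x\<close> cancels the \<open>1 / l\<close>.\<close>
  define M where "M = n0 * l + n2 / l"
  have M0: "0 \<le> M" using n l by (simp add: M_def)
  have pt: "cmod (fourier f x) \<le> 2 * M * (1 / l * (1 + 1 / l * \<bar>x - 0\<bar>) powr (- 2))" for x
  proof -
    have "cmod (fourier f2 x) = (2 * pi * \<bar>x\<bar>)\<^sup>2 * cmod (fourier f x)"
      unfolding F2 F1 by (simp add: norm_mult power2_eq_square)
    then have "(2 * pi * \<bar>x\<bar>)\<^sup>2 * cmod (fourier f x) \<le> n2" using cmod_fourier_le[OF i(3), of x] by (simp add: n2_def)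
    moreover have "\<bar>x\<bar>\<^sup>2 * cmod (fourier f x) \<le> (2 * pi * \<bar>x\<bar>)\<^sup>2 * cmod (fourier f x)"
    proof (intro mult_right_mono power_mono)
      have "1 * \<bar>x\<bar> \<le> (2 * pi) * \<bar>x\<bar>" using pi_ge_two by (intro mult_right_mono) auto
      then show "\<bar>x\<bar> \<le> 2 * pi * \<bar>x\<bar>" by simp
    qed auto
    ultimately have a: "\<bar>x\<bar>\<^sup>2 * cmod (fourier f x) \<le> n2" by linarith
    have a0: "cmod (fourier f x) \<le> n0" using cmod_fourier_le[OF i(1), of x] by (simp add: n0_def)
    define y where "y = 1 / l * \<bar>x\<bar>"
    have y0: "y \<ge> 0" using l by (simp add: y_def)
    have "(1 + y)\<^sup>2 \<le> 2 * (1 + y\<^sup>2)" using sum_squares_bound[of 1 y] by (simp add: power2_sum)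
    then have "cmod (fourier f x) * (1 + y)\<^sup>2 \<le> cmod (fourier f x) * (2 * (1 + y\<^sup>2))" by (intro mult_left_mono) auto
    also have "\<dots> = 2 * (cmod (fourier f x) + (\<bar>x\<bar>\<^sup>2 * cmod (fourier f x)) / l\<^sup>2)"
      by (simp add: y_def power_divide algebra_simps)
    also have "\<dots> \<le> 2 * (n0 + n2 / l\<^sup>2)" using a a0 l by (intro mult_left_mono add_mono divide_right_mono) auto
    also have "\<dots> = 2 * M * (1 / l)" using l by (simp add: M_def power2_eq_square field_simps)
    finally have "cmod (fourier f x) * (1 + y)\<^sup>2 \<le> 2 * M * (1 / l)" .
    moreover have "0 < (1 + y)\<^sup>2" using y0 by (intro zero_less_power) auto
    ultimately have "cmod (fourier f x) \<le> 2 * M * (1 / l) / (1 + y)\<^sup>2" by (subst pos_le_divide_eq)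
    moreover have "(1 + 1 / l * \<bar>x - 0\<bar>) powr (- 2) = 1 / (1 + y)\<^sup>2"
      unfolding powr_minus_divide y_def[symmetric] diff_zero using y0 by (subst powr_numeral) auto
    ultimately show ?thesis by simp
  qed
  have "(\<integral>\<^sup>+x. ennreal (cmod (fourier f (x - x'))) \<partial>lborel) \<le> (\<integral>\<^sup>+x. ennreal (2 * M) * ennreal (1 / l * (1 + 1 / l * \<bar>x - x'\<bar>) powr (- 2)) \<partial>lborel)"
    using pt[unfolded diff_zero] M0 by (intro nn_integral_mono) (simp add: ennreal_mult'[symmetric] ennreal_leI del: ennreal_le_iff times_divide_eq_left)
  also have "\<dots> = ennreal (2 * M) * tail_integral 2"
    using tail_integral_affine[of "1 / l" x' 2] l by (subst nn_integral_cmult) auto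
  also have "ennreal (2 * M) = 2 * ennreal M" using M0 by (simp add: ennreal_mult')
  also have "ennreal M \<le> (\<integral>\<^sup>+\<xi>. ennreal (E \<xi> * (l * (1 + (L \<xi> / l)\<^sup>2))) \<partial>lborel)"
  proof -
    have "M = (\<integral>\<xi>. cmod (f \<xi>) * l + cmod (f2 \<xi>) / l \<partial>lborel)"
      using i by (simp add: M_def n0_def n2_def)
    also have "ennreal \<dots> = (\<integral>\<^sup>+\<xi>. ennreal (cmod (f \<xi>) * l + cmod (f2 \<xi>) / l) \<partial>lborel)"
      using i l by (intro nn_integral_eq_integral[symmetric]) auto
    also have "\<dots> \<le> (\<integral>\<^sup>+\<xi>. ennreal (E \<xi> * (l * (1 + (L \<xi> / l)\<^sup>2))) \<partial>lborel)"
    proof (intro nn_integral_mono ennreal_leI)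
      fix \<xi>
      have "cmod (f \<xi>) * l + cmod (f2 \<xi>) / l \<le> E \<xi> * l + E \<xi> * (L \<xi>)\<^sup>2 / l"
        using F(5,7)[of \<xi>] l by (intro add_mono mult_right_mono divide_right_mono) auto
      also have "\<dots> = E \<xi> * (l * (1 + (L \<xi> / l)\<^sup>2))" using l by (simp add: field_simps power2_eq_square)
      finally show "cmod (f \<xi>) * l + cmod (f2 \<xi>) / l \<le> E \<xi> * (l * (1 + (L \<xi> / l)\<^sup>2))" .
    qed
    finally show ?thesis .
  qed
  finally show ?thesis by (simp add: mult_ac mult_left_mono mult_right_mono)
qed

section \<open>Rates and exponents of the frequency profile\<close>

lemma C2_bounded_inverse_power:
  assumes "C2_bounded f f1 f2 (\<lambda>_. B) L" and "c > 0" "\<And>\<xi>. c \<le> cmod (f \<xi>)"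
  obtains A k g1 g2 where "k \<ge> 0" "C2_bounded (\<lambda>\<xi>. (1 / f \<xi>) ^ \<kappa>) g1 g2 (\<lambda>_. A) (\<lambda>\<xi>. k * L \<xi>)"
proof -
  obtain h1 h2 where h: "C2_bounded (\<lambda>\<xi>. 1 / f \<xi>) h1 h2 (\<lambda>_. 1 / c) (\<lambda>\<xi>. 2 * B / c * L \<xi>)"
    using C2_bounded_inverse[OF assms] .
  have "0 \<le> B" using order_trans[OF norm_ge_zero C2_boundedD(5)[OF assms(1)]] .
  then have k: "0 \<le> 2 * B / c" using assms(2) by simp
  have "\<exists>A k g1 g2. k \<ge> 0 \<and> C2_bounded (\<lambda>\<xi>. (1 / f \<xi>) ^ \<kappa>) g1 g2 (\<lambda>_. A) (\<lambda>\<xi>. k * L \<xi>)"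
  proof (induction \<kappa>)
    case 0
    show ?case using C2_bounded_const by (intro exI[of _ 1] exI[of _ 0] exI[of _ "\<lambda>_. 0"]) simp
  next
    case (Suc \<kappa>)
    then obtain A k' g1 g2 where k': "k' \<ge> 0" and g: "C2_bounded (\<lambda>\<xi>. (1 / f \<xi>) ^ \<kappa>) g1 g2 (\<lambda>_. A) (\<lambda>\<xi>. k' * L \<xi>)" by blast
    \<comment> \<open>Each factor multiplies the amplitude by \<open>1 / c\<close> and adds
      \<open>2 * B / c\<close> to the rate, which therefore remains a multiple of
      \<open>L\<close>.\<close>
    have "C2_bounded (\<lambda>\<xi>. (1 / f \<xi>) ^ Suc \<kappa>)
       (\<lambda>\<xi>. 1 / f \<xi> * g1 \<xi> + h1 \<xi> * (1 / f \<xi>) ^ \<kappa>)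
       (\<lambda>\<xi>. (1 / f \<xi> * g2 \<xi> + h1 \<xi> * g1 \<xi>) + (h1 \<xi> * g1 \<xi> + h2 \<xi> * (1 / f \<xi>) ^ \<kappa>))
       (\<lambda>_. 1 / c * A) (\<lambda>\<xi>. (2 * B / c + k') * L \<xi>)"
      using C2_bounded_mult[OF h g] by (simp only: power_Suc distrib_right)
    moreover have "2 * B / c + k' \<ge> 0" using k k' by simp
    ultimately show ?case by blast
  qed
  then show thesis using that by blast
qed

text \<open>Everything is measured by \<open>z = u * v\<close>. The weight costs
  \<open>z powr (s / (1 - \<alpha>))\<close>, the squared ratio of rate to scale costs
  \<open>z powr (\<alpha> / (1 - \<alpha>))\<close>, the amplitude supplies
  \<open>z powr (- r)\<close>, and \<open>z powr (- q)\<close> is what remains.\<close>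

lemma product_rate_bound:
  fixes r s \<alpha> :: real
  assumes \<alpha>: "0 \<le> \<alpha>" "\<alpha> < 1" and s: "0 \<le> s" and k: "0 \<le> k"
  defines "q \<equiv> r - (s + \<alpha>) / (1 - \<alpha>)"
  shows "weight s \<omega> \<omega>' * ((sqrt (beta \<alpha> \<omega>) * (1 + beta \<alpha> \<omega> * \<bar>\<xi> - \<omega>\<bar>) powr (- r)) *
      (sqrt (beta \<alpha> \<omega>') * (1 + beta \<alpha> \<omega>' * \<bar>\<xi> - \<omega>'\<bar>) powr (- r)) *
      (sqrt (beta \<alpha> \<omega> * beta \<alpha> \<omega>') * (1 + ((beta \<alpha> \<omega> + beta \<alpha> \<omega>' + k * beta \<alpha> \<xi>) / sqrt (beta \<alpha> \<omega> * beta \<alpha> \<omega>'))\<^sup>2)))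
    \<le> (7 + 3 * k\<^sup>2) * (envelope \<alpha> q \<xi> \<omega> * envelope \<alpha> q \<xi> \<omega>')"
proof -
  define a b m u v p z where "a = beta \<alpha> \<omega>" and "b = beta \<alpha> \<omega>'" and "m = beta \<alpha> \<xi>"
    and "u = 1 + beta \<alpha> \<omega> * \<bar>\<xi> - \<omega>\<bar>" and "v = 1 + beta \<alpha> \<omega>' * \<bar>\<xi> - \<omega>'\<bar>"
    and "p = 1 / (1 - \<alpha>)" and "z = u * v"
  have pos: "a > 0" "b > 0" "m > 0" by (auto simp: a_def b_def m_def)
  have u: "u \<ge> 1" and v: "v \<ge> 1" by (auto simp: u_def v_def less_imp_le)
  have p: "p \<ge> 1" using \<alpha> by (simp add: p_def)
  have z: "z \<ge> 1" unfolding z_def using mult_mono[of 1 u 1 v] u v by simp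
  have up: "u \<le> u powr p" "v \<le> v powr p" "1 \<le> u powr p" "1 \<le> v powr p"
    using powr_mono[of 1 p u] powr_mono[of 1 p v] p u v ge_one_powr_ge_zero[of u p] ge_one_powr_ge_zero[of v p] by auto
  have zp: "z powr p = u powr p * v powr p" using u v by (simp add: z_def powr_mult)
  define N N' M where "N = 1 + \<bar>\<omega>\<bar>" and "N' = 1 + \<bar>\<omega>'\<bar>" and "M = 1 + \<bar>\<xi>\<bar>"
  have N: "N \<ge> 1" "N' \<ge> 1" "M \<ge> 1" by (auto simp: N_def N'_def M_def)
  have M1: "M \<le> N * u powr p" "M \<le> N' * v powr p"
    using frequency_ratio_upper[OF \<alpha>, of \<xi> \<omega>] frequency_ratio_upper[OF \<alpha>, of \<xi> \<omega>'] up N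
      mult_left_mono[of u "u powr p" N] mult_left_mono[of v "v powr p" N']
    by (auto simp: N_def N'_def M_def u_def v_def)
  have M2: "N \<le> M * u powr p" "N' \<le> M * v powr p"
    using frequency_ratio_lower[OF \<alpha>, of \<omega> \<xi>] frequency_ratio_lower[OF \<alpha>, of \<omega>' \<xi>]
    by (auto simp: N_def N'_def M_def u_def v_def p_def)
  \<comment> \<open>The two frequencies are compared through \<open>M\<close>, at the price of one
    \<open>u powr p\<close> and one \<open>v powr p\<close> in either direction.\<close>
  have "N' \<le> N * z powr p" "N \<le> N' * z powr p"
    using order_trans[OF M2(2) mult_right_mono[OF M1(1)]] order_trans[OF M2(1) mult_right_mono[OF M1(2)]] up
    by (auto simp: zp mult_ac)
  then have "max (N' / N) (N / N') \<le> z powr p" using N by (simp add: pos_divide_le_eq mult_ac)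
  then have "weight s \<omega> \<omega>' \<le> (z powr p) powr s"
    unfolding weight_def abs_of_nonneg[OF s] N_def[symmetric] N'_def[symmetric]
    using s N by (intro powr_mono2) (auto simp: le_max_iff_disj)
  then have w: "weight s \<omega> \<omega>' \<le> z powr (p * s)" by (simp add: powr_powr)
  have w0: "0 \<le> weight s \<omega> \<omega>'" by (simp add: weight_def)
  define e where "e = \<alpha> * p"
  have e0: "0 \<le> e" using \<alpha> p by (simp add: e_def)
  have \<alpha>e: "\<alpha> \<le> e" using mult_left_mono[OF p \<alpha>(1)] by (simp add: e_def)
  have ue: "u powr \<alpha> \<le> u powr e" "v powr \<alpha> \<le> v powr e" using u v \<alpha>e by (auto intro: powr_mono)
  have ze: "z powr e = u powr e * v powr e" using u v by (simp add: z_def powr_mult)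
  have z1: "1 \<le> z powr e" using z e0 by (intro ge_one_powr_ge_zero)
  have mult_u: "x \<le> y * u powr e" if "x \<le> y * u powr \<alpha>" "0 \<le> y" for x y
    using that mult_left_mono[OF ue(1), of y] by linarith
  have mult_v: "x \<le> y * v powr e" if "x \<le> y * v powr \<alpha>" "0 \<le> y" for x y
    using that mult_left_mono[OF ue(2), of y] by linarith
  have am: "a \<le> m * u powr e" and bm: "b \<le> m * v powr e"
    using mult_u[of a m] mult_v[of b m] beta_le_upper[OF \<alpha>, of \<omega> \<xi>] beta_le_upper[OF \<alpha>, of \<omega>' \<xi>] pos(3)
    by (simp_all add: a_def b_def m_def u_def v_def less_imp_le)
  have ma: "m \<le> a * u powr e" and mb: "m \<le> b * v powr e"
    using beta_le_lower[OF \<alpha>, of \<xi> \<omega>] beta_le_lower[OF \<alpha>, of \<xi> \<omega>']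
    by (auto simp: a_def b_def m_def u_def v_def e_def p_def)
  have ab: "a \<le> b * z powr e" and ba: "b \<le> a * z powr e"
    using order_trans[OF am mult_right_mono[OF mb]] order_trans[OF bm mult_right_mono[OF ma]]
    by (auto simp: ze mult_ac)
  \<comment> \<open>Each squared scale is bounded by \<open>a * b\<close>, the square of
    \<open>l\<close>, at the same price \<open>z powr e\<close>. For \<open>m\<close> this takes one
    comparison with \<open>a\<close> and one with \<open>b\<close>.\<close>
  have a2: "a\<^sup>2 \<le> a * b * z powr e" and b2: "b\<^sup>2 \<le> a * b * z powr e" and m2: "m\<^sup>2 \<le> a * b * z powr e"
    using mult_left_mono[OF ab, of a] mult_left_mono[OF ba, of b] mult_mono[OF ma mb] pos
    by (auto simp: power2_eq_square ze mult_ac)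
  define l where "l = sqrt (a * b)"
  have l: "l > 0" "l\<^sup>2 = a * b" "l * l = a * b" using pos by (auto simp: l_def)
  \<comment> \<open>Three squares, each bounded through \<open>a * b * z powr e\<close>, give
    \<open>6 + 3 * k\<^sup>2\<close>; the summand 1 of the rate raises this to 7, since
    \<open>z powr e \<ge> 1\<close>.\<close>
  have "(a + b + k * m)\<^sup>2 \<le> 3 * (a\<^sup>2 + b\<^sup>2 + k\<^sup>2 * m\<^sup>2)"
    using sum_squares_bound[of a b] sum_squares_bound[of a "k * m"] sum_squares_bound[of b "k * m"]
    by (simp add: power2_eq_square algebra_simps)
  also have "\<dots> \<le> 3 * (a * b * z powr e + a * b * z powr e + k\<^sup>2 * (a * b * z powr e))"
    using a2 b2 m2 by (intro mult_left_mono add_mono) auto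
  finally have sq: "((a + b + k * m) / l)\<^sup>2 \<le> (6 + 3 * k\<^sup>2) * z powr e"
    using l pos by (simp add: power_divide divide_le_eq algebra_simps)
  have "1 + ((a + b + k * m) / l)\<^sup>2 \<le> (7 + 3 * k\<^sup>2) * z powr e"
    using sq z1 by (simp add: algebra_simps)
  then have rate: "l * (1 + ((a + b + k * m) / l)\<^sup>2) \<le> l * ((7 + 3 * k\<^sup>2) * z powr e)"
    using l by (intro mult_left_mono) auto
  have zr: "u powr (- r) * v powr (- r) = z powr (- r)" using u v by (simp add: z_def powr_mult)
  have "weight s \<omega> \<omega>' * ((sqrt a * u powr (- r)) * (sqrt b * v powr (- r)) * (l * (1 + ((a + b + k * m) / l)\<^sup>2)))
     = weight s \<omega> \<omega>' * ((l * z powr (- r)) * (l * (1 + ((a + b + k * m) / l)\<^sup>2)))"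
    unfolding zr[symmetric] by (simp add: l_def real_sqrt_mult mult_ac)
  also have "\<dots> \<le> z powr (p * s) * ((l * z powr (- r)) * (l * ((7 + 3 * k\<^sup>2) * z powr e)))"
    using w0 l by (intro mult_mono w order_refl rate mult_nonneg_nonneg) auto
  also have "\<dots> = (7 + 3 * k\<^sup>2) * (a * b * (z powr (p * s) * z powr (- r) * z powr e))"
    unfolding l(3)[symmetric] by (simp only: mult_ac)
  also have "z powr (p * s) * z powr (- r) * z powr e = z powr (- q)"
  proof -
    have "p * s + - r + e = - q" by (simp add: q_def e_def p_def add_divide_distrib)
    then show ?thesis by (simp flip: powr_add)
  qed
  also have "a * b * z powr (- q) = envelope \<alpha> q \<xi> \<omega> * envelope \<alpha> q \<xi> \<omega>'"
    using u v by (simp add: envelope_def a_def b_def z_def u_def v_def powr_mult)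
  finally show ?thesis unfolding a_def b_def m_def u_def v_def l_def .
qed

text \<open>The decisive consequence is \<open>1 + s < r * (1 - \<alpha>)\<close>: divided by
  \<open>1 - \<alpha>\<close> it is the condition \<open>q > 1\<close>, and the other two bounds
  follow from it.\<close>

lemma decay_exponent:
  fixes \<alpha> s r :: real
  assumes \<alpha>: "0 \<le> \<alpha>" "\<alpha> < 1" and s: "0 \<le> s" and r: "r > (2 + 2 * s + 7 * \<alpha> - 4 * \<alpha>\<^sup>2) / (2 * (1 - \<alpha>)\<^sup>2)"
  shows "r - (s + \<alpha>) / (1 - \<alpha>) > 1" "2 * r > 1 + 2 * \<alpha>" "r > 1"
proof -
  have p: "2 * (1 - \<alpha>)\<^sup>2 > 0" using \<alpha> by simp
  from r have "2 + 2 * s + 7 * \<alpha> - 4 * \<alpha>\<^sup>2 < r * (2 * (1 - \<alpha>)\<^sup>2)" by (simp only: pos_divide_less_eq[OF p])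
  moreover have "\<alpha>\<^sup>2 \<le> \<alpha>" using mult_left_mono[of \<alpha> 1 \<alpha>] \<alpha> by (simp add: power2_eq_square)
  ultimately have "1 + s < r * (1 - \<alpha>) * (1 - \<alpha>)" using \<alpha> by (simp add: power2_eq_square)
  moreover have "(1 + s) * (1 - \<alpha>) \<le> 1 + s" using \<alpha> s by (intro mult_right_le_one_le) auto
  ultimately have "(1 + s) * (1 - \<alpha>) < (r * (1 - \<alpha>)) * (1 - \<alpha>)" by linarith
  then have *: "1 + s < r * (1 - \<alpha>)" using \<alpha> by simp
  then have "(1 - \<alpha>) + (s + \<alpha>) < r * (1 - \<alpha>)" by simp
  then have "((1 - \<alpha>) + (s + \<alpha>)) / (1 - \<alpha>) < r" using \<alpha> by (simp only: pos_divide_less_eq diff_gt_0_iff_gt)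
  moreover have "((1 - \<alpha>) + (s + \<alpha>)) / (1 - \<alpha>) = 1 + (s + \<alpha>) / (1 - \<alpha>)"
    using \<alpha> by (subst add_divide_distrib) simp
  ultimately show "r - (s + \<alpha>) / (1 - \<alpha>) > 1" by linarith
  have "r > 1 + \<alpha>"
  proof (rule ccontr)
    assume "\<not> r > 1 + \<alpha>"
    then have "r * (1 - \<alpha>) \<le> (1 + \<alpha>) * (1 - \<alpha>)" using \<alpha> by (intro mult_right_mono) auto
    also have "\<dots> \<le> 1" by (simp add: algebra_simps)
    finally show False using * s by simp
  qed
  then show "2 * r > 1 + 2 * \<alpha>" "r > 1" using \<alpha> by auto
qed

text \<open>The lower bound on the symbol starts from a frequency at which the transform does not
  vanish; one exists because the two norms agree.\<close>

lemma has_fourier_L2_nonzero: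
  assumes "has_fourier_L2 f F" "\<not> (AE t in lborel. f t = 0)"
  obtains y where "F y \<noteq> 0"
proof -
  note f = has_fourier_L2_dest[OF assms(1)]
  have "sqnorm F \<noteq> 0" using plancherel_L2[OF assms(1)] assms(2) sqnorm_eq_0_iff[OF f(1)] by simp
  moreover have "sqnorm F = 0" if "\<And>y. F y = 0" using that by (simp add: sqnorm_def)
  ultimately show thesis using \<open>\<And>y. F y \<noteq> 0 \<Longrightarrow> thesis\<close> by blast
qed

theorem theorem5p1:
  fixes \<alpha> s r C :: real and \<kappa> :: nat
    and \<psi> \<phi> \<psi>hat \<phi>hat :: "real \<Rightarrow> complex"
  assumes "0 \<le> \<alpha>" and "\<alpha> < 1" and "0 \<le> s"
    and "\<psi> \<in> L2" and "\<phi> \<in> L2"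
    and "\<not> (AE t in lborel. \<psi> t = 0)"
    and "has_fourier_L2 \<psi> \<psi>hat" and "has_fourier_L2 \<phi> \<phi>hat"
    and "C2 \<psi>hat" and "C2 \<phi>hat"
    and "C > 0"
    and "\<And>l \<xi>. l \<in> {0, 1, 2::nat} \<Longrightarrow> cmod ((vderiv ^^ l) \<psi>hat \<xi>) \<le> C * (1 + \<bar>\<xi>\<bar>) powr (- r)"
    and "\<And>l \<xi>. l \<in> {0, 1, 2::nat} \<Longrightarrow> cmod ((vderiv ^^ l) \<phi>hat \<xi>) \<le> C * (1 + \<bar>\<xi>\<bar>) powr (- r)"
    and "r > (2 + 2 * s + 7 * \<alpha> - 4 * \<alpha>\<^sup>2) / (2 * (1 - \<alpha>)\<^sup>2)"
    and "\<kappa> \<in> {0, 1, 2}"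
  shows "(SUP (x', \<omega>') \<in> (UNIV :: (real \<times> real) set).
            \<integral>\<^sup>+ \<omega>. (\<integral>\<^sup>+ x. ennreal (cmod (atom_kernel \<alpha> \<kappa> \<psi> \<phi> x \<omega> x' \<omega>') * weight s \<omega> \<omega>') \<partial>lborel) \<partial>lborel)
          < \<infinity>"
proof -
  let ?J = "\<lambda>\<omega> x' \<omega>'. \<integral>\<^sup>+ x. ennreal (cmod (atom_kernel \<alpha> \<kappa> \<psi> \<phi> x \<omega> x' \<omega>') * weight s \<omega> \<omega>') \<partial>lborel"
  note \<alpha> = assms(1,2)
  define q where "q = r - (s + \<alpha>) / (1 - \<alpha>)"
  have q: "q > 1" and r2: "2 * r > 1 + 2 * \<alpha>" and r1: "r > 1"
    using decay_exponent[OF \<alpha> assms(3,14)] by (auto simp: q_def)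
  have r21: "2 * r > 1" using r1 by simp
  define R where "R \<xi> = C * (1 + \<bar>\<xi>\<bar>) powr (- r)" for \<xi>
  have P: "C2_bounded \<psi>hat (vderiv \<psi>hat) (vderiv (vderiv \<psi>hat)) R (\<lambda>_. 1)"
    and Q: "C2_bounded \<phi>hat (vderiv \<phi>hat) (vderiv (vderiv \<phi>hat)) R (\<lambda>_. 1)"
    unfolding R_def[abs_def]
    by (rule C2_decay_bounded[OF assms(9,12)], assumption) (rule C2_decay_bounded[OF assms(10,13)])
  have decay: "cmod (\<psi>hat y) \<le> C * (1 + \<bar>y\<bar>) powr (- r)" for y using C2_boundedD(5)[OF P] by (simp add: R_def)
  obtain B m1 m2 where m: "C2_bounded (\<lambda>\<xi>. complex_of_real (symbol \<alpha> \<psi>hat \<xi>)) m1 m2 (\<lambda>_. B) (beta \<alpha>)"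
    using symbol_C2_bounded[OF \<alpha> r2 P[unfolded R_def[abs_def]]] .
  obtain y0 where "\<psi>hat y0 \<noteq> 0" using has_fourier_L2_nonzero[OF assms(7,6)] .
  then obtain c where c: "c > 0" "\<And>\<xi>. c \<le> symbol \<alpha> \<psi>hat \<xi>"
    using symbol_lower_bound[OF \<alpha> r21 C2_bounded_continuous(1)[OF P] decay] by blast
  have "symbol \<alpha> \<psi>hat \<xi> \<le> B" for \<xi> using C2_boundedD(5)[OF m, of \<xi>] by simp
  then interpret admissible_window \<alpha> r C B c \<psi> \<psi>hat
    by (intro admissible_window.intro \<alpha> r21 assms(7) decay c)
  have "c \<le> cmod (complex_of_real (symbol \<alpha> \<psi>hat \<xi>))" for \<xi> using c(2)[of \<xi>] by simp
  then obtain A k g1 g2 where k: "k \<ge> 0" and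
    g: "C2_bounded (\<lambda>\<xi>. (1 / complex_of_real (symbol \<alpha> \<psi>hat \<xi>)) ^ \<kappa>) g1 g2 (\<lambda>_. A) (\<lambda>\<xi>. k * beta \<alpha> \<xi>)"
    by (rule C2_bounded_inverse_power[OF m c(1), of \<kappa>])
  have A: "0 \<le> A" using order_trans[OF norm_ge_zero C2_boundedD(5)[OF g]] .
  \<comment> \<open>One \<open>C\<close> for each window, \<open>A\<close> for the power of the
    symbol, and the last factor from \<open>product_rate_bound\<close>.\<close>
  define W where "W = C * C * A * (7 + 3 * k\<^sup>2)"
  have W: "0 \<le> W" using assms(11) A by (simp add: W_def)
  let ?e = "\<lambda>\<omega> \<omega>' \<xi>. ennreal (W * (envelope \<alpha> q \<xi> \<omega> * envelope \<alpha> q \<xi> \<omega>'))"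
  \<comment> \<open>Amplitude and rate (\<open>L\<close> below) of the profile \<open>G\<close>, as
    two applications of the product rule produce them: the windows have constant rates, the power of
    the symbol has rate \<open>k * beta \<alpha> \<xi>\<close>.\<close>
  define E where "E \<omega> \<omega>' \<xi> = (sqrt (beta \<alpha> \<omega>) * R (beta \<alpha> \<omega> * (\<xi> - \<omega>))) * (sqrt (beta \<alpha> \<omega>') * R (beta \<alpha> \<omega>' * (\<xi> - \<omega>'))) * A" for \<omega> \<omega>' \<xi>
  define L where "L \<omega> \<omega>' \<xi> = beta \<alpha> \<omega> + beta \<alpha> \<omega>' + k * beta \<alpha> \<xi>" for \<omega> \<omega>' \<xi>
  have R\<beta>: "R (beta \<alpha> \<omega> * (\<xi> - \<omega>)) = C * (1 + beta \<alpha> \<omega> * \<bar>\<xi> - \<omega>\<bar>) powr (- r)" for \<omega> \<xi>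
    by (simp add: R_def abs_mult less_imp_le)
  have inner: "?J \<omega> x' \<omega>'
      \<le> 2 * tail_integral 2 * (\<integral>\<^sup>+\<xi>. ?e \<omega> \<omega>' \<xi> \<partial>lborel)" for \<omega> x' \<omega>'
  proof -
    define G where "G \<xi> = complex_of_real (sqrt (beta \<alpha> \<omega>)) * \<psi>hat (beta \<alpha> \<omega> * (\<xi> - \<omega>))
     * cnj (complex_of_real (sqrt (beta \<alpha> \<omega>')) * \<phi>hat (beta \<alpha> \<omega>' * (\<xi> - \<omega>')))
     * (1 / complex_of_real (symbol \<alpha> \<psi>hat \<xi>)) ^ \<kappa>" for \<xi>
    have b0: "0 \<le> beta \<alpha> \<omega>" for \<omega> by (simp add: less_imp_le)
    have sb0: "0 \<le> sqrt (beta \<alpha> \<omega>)" for \<omega> by (simp add: less_imp_le)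
    obtain G1 G2 where G: "C2_bounded G G1 G2 (E \<omega> \<omega>') (L \<omega> \<omega>')"
      using C2_bounded_mult[OF C2_bounded_mult[OF C2_bounded_affine[OF P b0 sb0, of \<omega> \<omega>]
        C2_bounded_cnj[OF C2_bounded_affine[OF Q b0 sb0, of \<omega>' \<omega>']]] g]
      unfolding G_def[abs_def] E_def[abs_def] L_def[abs_def] by blast
    define l where "l = sqrt (beta \<alpha> \<omega> * beta \<alpha> \<omega>')"
    have l: "l > 0" by (simp add: l_def)
    let ?r = "\<lambda>\<xi>. E \<omega> \<omega>' \<xi> * (l * (1 + (L \<omega> \<omega>' \<xi> / l)\<^sup>2))"
    have w0: "0 \<le> weight s \<omega> \<omega>'" by (simp add: weight_def)
    have [measurable]: "G \<in> borel_measurable borel"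
      using C2_bounded_continuous(1)[OF G] by (rule borel_measurable_continuous_onI)
    have "?J \<omega> x' \<omega>'
        = (\<integral>\<^sup>+ x. ennreal (weight s \<omega> \<omega>') * ennreal (cmod (fourier G (x - x'))) \<partial>lborel)"
      unfolding atom_kernel_fourier[OF assms(8)] G_def[symmetric]
      using w0 by (intro nn_integral_cong) (simp add: ennreal_mult' mult.commute)
    also have "\<dots> = ennreal (weight s \<omega> \<omega>') * (\<integral>\<^sup>+ x. ennreal (cmod (fourier G (x - x'))) \<partial>lborel)"
      by (intro nn_integral_cmult) measurable
    also have "\<dots> \<le> ennreal (weight s \<omega> \<omega>') * (2 * tail_integral 2 * (\<integral>\<^sup>+\<xi>. ennreal (?r \<xi>) \<partial>lborel))"
    proof (intro mult_left_mono fourier_L1_bound[OF G _ _ _ r1 l])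
      have "k * beta \<alpha> \<xi> \<le> k * 1" for \<xi> using k beta_le_1[OF \<alpha>(1)] by (intro mult_left_mono) auto
      then show "L \<omega> \<omega>' \<xi> \<le> 2 + k" for \<xi>
        using beta_le_1[OF \<alpha>(1), of \<omega>] beta_le_1[OF \<alpha>(1), of \<omega>'] by (simp add: L_def add_mono)
      \<comment> \<open>For decay at infinity it is enough to keep the profile of one window; the
        other is bounded by \<open>C\<close>, as \<open>sqrt (beta \<alpha> \<omega>)\<close> is at
        most 1.\<close>
      show "E \<omega> \<omega>' \<xi> \<le> (C * C * A) * (1 + beta \<alpha> \<omega>' * \<bar>\<xi> - \<omega>'\<bar>) powr (- r)" for \<xi>
      proof -
        have s1: "sqrt (beta \<alpha> \<omega>) \<le> 1" for \<omega> using beta_le_1[OF \<alpha>(1), of \<omega>] by simp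
        have "(1 + beta \<alpha> \<omega> * \<bar>\<xi> - \<omega>\<bar>) powr (- r) \<le> (1 + beta \<alpha> \<omega> * \<bar>\<xi> - \<omega>\<bar>) powr 0"
          using r1 b0 by (intro powr_mono) auto
        then have p1: "(1 + beta \<alpha> \<omega> * \<bar>\<xi> - \<omega>\<bar>) powr (- r) \<le> 1" by (auto split: if_splits)
        have "E \<omega> \<omega>' \<xi> \<le> (1 * (C * 1)) * (1 * (C * (1 + beta \<alpha> \<omega>' * \<bar>\<xi> - \<omega>'\<bar>) powr (- r))) * A"
          unfolding E_def R\<beta> using assms(11) A p1 s1 b0
          by (intro mult_right_mono mult_mono mult_left_mono mult_nonneg_nonneg) auto
        then show ?thesis by (simp add: mult_ac)
      qed
    qed auto
    also have "\<dots> = 2 * tail_integral 2 * (ennreal (weight s \<omega> \<omega>') * (\<integral>\<^sup>+\<xi>. ennreal (?r \<xi>) \<partial>lborel))"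
      by (simp only: mult_ac)
    also have "ennreal (weight s \<omega> \<omega>') * (\<integral>\<^sup>+\<xi>. ennreal (?r \<xi>) \<partial>lborel)
        = (\<integral>\<^sup>+\<xi>. ennreal (weight s \<omega> \<omega>' * ?r \<xi>) \<partial>lborel)"
      using w0 unfolding E_def L_def R_def
      by (subst nn_integral_cmult[symmetric]) (auto simp: ennreal_mult')
    also have "\<dots> \<le> (\<integral>\<^sup>+\<xi>. ?e \<omega> \<omega>' \<xi> \<partial>lborel)"
    proof (intro nn_integral_mono ennreal_leI)
      fix \<xi>
      have "weight s \<omega> \<omega>' * ?r \<xi> =
        (C * C * A) * (weight s \<omega> \<omega>' * ((sqrt (beta \<alpha> \<omega>) * (1 + beta \<alpha> \<omega> * \<bar>\<xi> - \<omega>\<bar>) powr (- r)) *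
        (sqrt (beta \<alpha> \<omega>') * (1 + beta \<alpha> \<omega>' * \<bar>\<xi> - \<omega>'\<bar>) powr (- r)) * (l * (1 + (L \<omega> \<omega>' \<xi> / l)\<^sup>2))))"
        unfolding E_def R\<beta> by (simp only: mult_ac)
      also have "\<dots> \<le> (C * C * A) * ((7 + 3 * k\<^sup>2) * (envelope \<alpha> q \<xi> \<omega> * envelope \<alpha> q \<xi> \<omega>'))"
        unfolding l_def L_def q_def using assms(11) A
        by (intro mult_left_mono product_rate_bound[OF \<alpha> assms(3) k]) auto
      finally show "weight s \<omega> \<omega>' * ?r \<xi> \<le> W * (envelope \<alpha> q \<xi> \<omega> * envelope \<alpha> q \<xi> \<omega>')"
        by (simp add: W_def mult.assoc)
    qed
    finally show ?thesis by (simp add: mult_left_mono)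
  qed
  obtain D where D: "D \<ge> 0" "\<And>\<xi>. (\<integral>\<^sup>+\<omega>. ennreal (envelope \<alpha> q \<xi> \<omega>) \<partial>lborel) \<le> ennreal D"
    using envelope_bound[OF \<alpha> q] by metis
  \<comment> \<open>Free of \<open>x'\<close> and \<omega>': the translation by \<open>x'\<close>
    drops out of the integral over \<open>x\<close>, and the last integral over \<xi> does not see
    its centre \<omega>'.\<close>
  define Z where "Z = 2 * tail_integral 2 * (ennreal W * (ennreal D * tail_integral q))"
  have outer: "(\<integral>\<^sup>+ \<omega>. ?J \<omega> x' \<omega>' \<partial>lborel) \<le> Z" for x' \<omega>'
  proof -
    have "(\<integral>\<^sup>+ \<omega>. ?J \<omega> x' \<omega>' \<partial>lborel)
        \<le> (\<integral>\<^sup>+\<omega>. 2 * tail_integral 2 * (\<integral>\<^sup>+\<xi>. ?e \<omega> \<omega>' \<xi> \<partial>lborel) \<partial>lborel)"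
      by (intro nn_integral_mono inner)
    also have "\<dots> = 2 * tail_integral 2 * (\<integral>\<^sup>+\<omega>. (\<integral>\<^sup>+\<xi>. ?e \<omega> \<omega>' \<xi> \<partial>lborel) \<partial>lborel)"
      by (intro nn_integral_cmult) measurable
    also have "(\<integral>\<^sup>+\<omega>. (\<integral>\<^sup>+\<xi>. ?e \<omega> \<omega>' \<xi> \<partial>lborel) \<partial>lborel)
        = (\<integral>\<^sup>+\<xi>. (\<integral>\<^sup>+\<omega>. ?e \<omega> \<omega>' \<xi> \<partial>lborel) \<partial>lborel)"
      by (rule lborel_pair.Fubini') measurable
    also have "\<dots> \<le> (\<integral>\<^sup>+\<xi>. ennreal W * (ennreal D * ennreal (envelope \<alpha> q \<xi> \<omega>')) \<partial>lborel)"
    proof (intro nn_integral_mono)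
      fix \<xi>
      have "(\<integral>\<^sup>+\<omega>. ?e \<omega> \<omega>' \<xi> \<partial>lborel)
          = (\<integral>\<^sup>+\<omega>. ennreal (W * envelope \<alpha> q \<xi> \<omega>') * ennreal (envelope \<alpha> q \<xi> \<omega>) \<partial>lborel)"
        using W by (intro nn_integral_cong) (simp add: mult_ac flip: ennreal_mult')
      also have "\<dots> = ennreal (W * envelope \<alpha> q \<xi> \<omega>') * (\<integral>\<^sup>+\<omega>. ennreal (envelope \<alpha> q \<xi> \<omega>) \<partial>lborel)"
        by (intro nn_integral_cmult) measurable
      also have "\<dots> \<le> ennreal (W * envelope \<alpha> q \<xi> \<omega>') * ennreal D" by (intro mult_left_mono D) auto
      also have "\<dots> = ennreal W * (ennreal D * ennreal (envelope \<alpha> q \<xi> \<omega>'))"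
        using W D(1) by (simp add: mult_ac flip: ennreal_mult')
      finally show "(\<integral>\<^sup>+\<omega>. ?e \<omega> \<omega>' \<xi> \<partial>lborel)
        \<le> ennreal W * (ennreal D * ennreal (envelope \<alpha> q \<xi> \<omega>'))" .
    qed
    also have "\<dots> = ennreal W * (ennreal D * (\<integral>\<^sup>+\<xi>. ennreal (envelope \<alpha> q \<xi> \<omega>') \<partial>lborel))"
      by (subst nn_integral_cmult; (subst nn_integral_cmult)?) auto
    also have "(\<integral>\<^sup>+\<xi>. ennreal (envelope \<alpha> q \<xi> \<omega>') \<partial>lborel) = tail_integral q"
      unfolding envelope_def by (rule tail_integral_affine) simp
    finally show ?thesis unfolding Z_def by (simp add: mult_left_mono)
  qed
  have "(SUP (x', \<omega>') \<in> (UNIV :: (real \<times> real) set).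
      \<integral>\<^sup>+ \<omega>. ?J \<omega> x' \<omega>' \<partial>lborel) \<le> Z"
    by (rule SUP_least) (auto intro: outer)
  also have "Z < \<infinity>"
    unfolding Z_def using tail_integral_finite[of 2] tail_integral_finite[OF q] by (simp add: ennreal_mult_less_top)
  finally show ?thesis .
qed

end
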